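(* Let $\alpha>0$ and let $\{(X_i,Y_i)\}_{i\ge1}$ be i.i.d. random vectors whose generic vector $(X,Y)$ follows a bivariate Sarmanov distribution with marginal distribution functions $F$ (of $X$) and $G$ (of $Y$), kernels $\phi_1,\phi_2$ and parameter $\theta\in\mathbb{R}$, with $X\in RV_{-\alpha}$; write $\overline F(x)=P[X>x]=x^{-\alpha}L(x)$ with $L$ slowly varying, and $\overline G(x)=P[Y>x]$. Let $E[Y^\alpha]<1$, $\overline G(x)=o(\overline F(x))$ as $x\to\infty$, and $\lim_{x\to\infty}\phi_1(x)=d_1$ (in $\mathbb{R}$). Assume that one of the four conditions (DZ1), (DZ2), (DZ3), (DZ4) (see context) holds for $(X,Y)$. Let $\zeta_i=\prod_{j=1}^{i-1}Y_j$. If the condition satisfied is one of (DZ2), (DZ3), (DZ4), define $$C_i=\begin{cases}\sup_{x\ge1}\dfrac{P[\zeta_i>x]}{P[X_1>x]},&\text{when (DZ2) holds,}\\[1ex] \sup_{x\ge1}\dfrac{P[\zeta_i>x]}{x^{-\alpha}P[U>\log x]},&\text{when (DZ3) holds,}\\[1ex] \sup_{x\ge1}\dfrac{P[\zeta_i>x]}{P[X_1>x]}\,m(x),&\text{when (DZ4) holds,}\end{cases}$$ (with $U$ and $m$ as in conditions (DZ3) and (DZ4)), and further assume that $$\sum_{i=2}^\infty C_i<\infty\ \text{ when }\alpha<1,\qquad \sum_{i=2}^\infty C_i^{\frac1{\alpha+\varepsilon}}<\infty\ \text{ when }\alpha\ge1,$$ for some $\varepsilon>0$. Then, as $x\to\infty$,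 $$P\left[\sup_{n\ge1}\sum_{i=1}^nX_i\prod_{j=1}^iY_j>x\right]\sim\frac{E[Y^\alpha]+\theta d_1E[\phi_2(Y)Y^\alpha]}{1-E[Y^\alpha]}\,P[X_1>x].$$
   Context: Asymptotics: $a(x)\sim b(x)$ means $a(x)/b(x)\to1$ as $x\to\infty$. Regular variation: $X\in RV_{-\alpha}$ means $\overline F(xy)\sim y^{-\alpha}\overline F(x)$ as $x\to\infty$ for every $y>0$, where $\overline F(x)=P[X>x]$. Bivariate Sarmanov distribution: $(X,Y)$ with $X$ real valued and $Y\ge 0$ follows a bivariate Sarmanov distribution if $P(X\in dx,Y\in dy)=(1+\theta\phi_1(x)\phi_2(y))F(dx)G(dy)$, $x\in\mathbb{R}$, $y\ge0$, where $F,G$ are the marginal distributions of $X,Y$, the kernels $\phi_1,\phi_2$ are real-valued functions and $\theta$ is a real constant such that $E\{\phi_1(X)\}=E\{\phi_2(Y)\}=0$ and $1+\theta\phi_1(x)\phi_2(y)\ge0$ for all $x\in D_X$, $y\in D_Y$, where $D_X\subset\mathbb{R}$ and $D_Y\subset\mathbb{R}^+$ are the supports of $X$ and $Y$. Long-tailed: a random variable $U$ is long tailed if $P[U>x]\sim P[U>x+y]$ as $x\to\infty$ for any $y$. Class $\mathcal S_d$: a nonnegative function $f$ is in $\mathcal S_d$ if $\lim_{x\to\infty}\int_0^x \frac{f(x-y)}{f(x)}f(y)\,dy=2\int_0^\infty f(u)\,du<\infty$. Write $U\in\mathcal S^*$ if $f(x)=P[U>x]$ is in $\mathcal S_d$.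 Types of $L(x)=x^{\alpha}\overline F(x)$: $L$ is of type (iii) if $L(x)=c(x)P(U>\log x)$, and of type (iv) if $L(x)=c(x)P(U>\log x)/P(V>\log x)$, where $U,V$ are long-tailed random variables and $\lim_{x\to\infty}c(x)=c\in(0,\infty)$. The conditions: (DZ1) $\limsup_{x\to\infty}\sup_{y\in[1,x]}L(y)/L(x)<\infty$. (DZ2) $L$ is of type (iii) or (iv), and the function $x\mapsto L(e^x)$ is in $\mathcal S_d$. (DZ3) $L$ is of type (iii) or (iv), $U\in\mathcal S^*$ (with $U$ from that representation), and $P(Y>x)=o(x^{-\alpha}P[U>\log x])$. (DZ4) $m(x):=\int_0^x v^\alpha F(dv)\to\infty$ as $x\to\infty$ (infinite $\alpha$-th moment of $X$); moreover $P(Y>x)=o(P[X>x]/m(x))$ and $\limsup_{x\to\infty}\sup_{\sqrt x\le y\le x}L(y)/L(x)<\infty$. *)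

theory Defs
  imports "HOL-Probability.Probability" "HOL-Library.Landau_Symbols"
begin

text \<open>Random variables that enter only through their law are represented by that law, a
  probability measure on the Borel sets of the reals.\<close>

definition tail :: "real measure \<Rightarrow> real \<Rightarrow> real" where
  "tail \<mu> x = measure \<mu> {x<..}"

text \<open>The library's \<open>asymp_equiv\<close> also relates functions that are eventually zero; with
  \<open>a / 0 = 0\<close> the limit below forces \<open>b\<close> to be eventually nonzero, as a quotient tending
  to 1 requires.\<close>

definition tail_equiv :: "(real \<Rightarrow> real) \<Rightarrow> (real \<Rightarrow> real) \<Rightarrow> bool" where
  "tail_equiv a b \<longleftrightarrow> ((\<lambda>x. a x / b x) \<longlongrightarrow> 1) at_top"

definition regularly_varying_tail :: "real \<Rightarrow> real measure \<Rightarrow> bool" where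
  "regularly_varying_tail \<alpha> F \<longleftrightarrow>
     (\<forall>y>0. tail_equiv (\<lambda>x. tail F (x * y)) (\<lambda>x. y powr (-\<alpha>) * tail F x))"

definition long_tailed :: "real measure \<Rightarrow> bool" where
  "long_tailed U \<longleftrightarrow> (\<forall>y. tail_equiv (\<lambda>x. tail U x) (\<lambda>x. tail U (x + y)))"

definition law_support :: "real measure \<Rightarrow> real set" where
  "law_support \<mu> = {x. \<forall>e>0. measure \<mu> {x - e<..<x + e} > 0}"

text \<open>\<open>F\<close> and \<open>G\<close> are the marginal laws.  The density is nonnegative on the product of the
  supports, which carries the product measure, so \<open>ennreal\<close> truncates it only on a null set.\<close>

definition sarmanov ::
  "'a measure \<Rightarrow> ('a \<Rightarrow> real) \<Rightarrow> ('a \<Rightarrow> real) \<Rightarrow> real measure \<Rightarrow> real measure \<Rightarrow>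
   (real \<Rightarrow> real) \<Rightarrow> (real \<Rightarrow> real) \<Rightarrow> real \<Rightarrow> bool" where
  "sarmanov M X Y F G \<phi>1 \<phi>2 \<theta> \<longleftrightarrow>
     X \<in> borel_measurable M \<and> Y \<in> borel_measurable M \<and> (AE \<omega> in M. 0 \<le> Y \<omega>) \<and>
     distr M borel X = F \<and> distr M borel Y = G \<and>
     \<phi>1 \<in> borel_measurable borel \<and> \<phi>2 \<in> borel_measurable borel \<and>
     integrable M (\<lambda>\<omega>. \<phi>1 (X \<omega>)) \<and> (\<integral>\<omega>. \<phi>1 (X \<omega>) \<partial>M) = 0 \<and>
     integrable M (\<lambda>\<omega>. \<phi>2 (Y \<omega>)) \<and> (\<integral>\<omega>. \<phi>2 (Y \<omega>) \<partial>M) = 0 \<and>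
     (\<forall>x\<in>law_support F. \<forall>y\<in>law_support G. 0 \<le> 1 + \<theta> * \<phi>1 x * \<phi>2 y) \<and>
     distr M (borel \<Otimes>\<^sub>M borel) (\<lambda>\<omega>. (X \<omega>, Y \<omega>)) =
       density (F \<Otimes>\<^sub>M G) (\<lambda>(x, y). ennreal (1 + \<theta> * \<phi>1 x * \<phi>2 y))"

text \<open>The functions of the class live on \<open>{0..}\<close>; values at negative arguments are irrelevant.\<close>

definition class_Sd :: "(real \<Rightarrow> real) \<Rightarrow> bool" where
  "class_Sd f \<longleftrightarrow>
     set_borel_measurable borel {0..} f \<and> (\<forall>x\<ge>0. 0 \<le> f x) \<and> (\<forall>\<^sub>F x in at_top. 0 < f x) \<and>
     ((\<lambda>x. \<integral>\<^sup>+y\<in>{0..x}. ennreal (f (x - y) / f x * f y) \<partial>lborel)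
        \<longlongrightarrow> 2 * (\<integral>\<^sup>+u\<in>{0..}. ennreal (f u) \<partial>lborel)) at_top \<and>
     2 * (\<integral>\<^sup>+u\<in>{0..}. ennreal (f u) \<partial>lborel) < \<infinity>"

definition class_S_star :: "real measure \<Rightarrow> bool" where
  "class_S_star U \<longleftrightarrow> class_Sd (tail U)"

definition slow_part :: "real \<Rightarrow> real measure \<Rightarrow> real \<Rightarrow> real" where
  "slow_part \<alpha> F x = x powr \<alpha> * tail F x"

definition type_iii :: "(real \<Rightarrow> real) \<Rightarrow> real measure \<Rightarrow> bool" where
  "type_iii L U \<longleftrightarrow>
     real_distribution U \<and> long_tailed U \<and>
     (\<exists>c c0. 0 < c0 \<and> (c \<longlongrightarrow> c0) at_top \<and> (\<forall>x>0. L x = c x * tail U (ln x)))"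

definition type_iv :: "(real \<Rightarrow> real) \<Rightarrow> real measure \<Rightarrow> real measure \<Rightarrow> bool" where
  "type_iv L U V \<longleftrightarrow>
     real_distribution U \<and> long_tailed U \<and> real_distribution V \<and> long_tailed V \<and>
     (\<exists>c c0. 0 < c0 \<and> (c \<longlongrightarrow> c0) at_top \<and>
        (\<forall>x>0. L x = c x * tail U (ln x) / tail V (ln x)))"

definition type_iii_or_iv :: "(real \<Rightarrow> real) \<Rightarrow> real measure \<Rightarrow> bool" where
  "type_iii_or_iv L U \<longleftrightarrow> type_iii L U \<or> (\<exists>V. type_iv L U V)"

definition truncated_moment :: "real \<Rightarrow> real measure \<Rightarrow> real \<Rightarrow> real" where
  "truncated_moment \<alpha> F x = (LINT v:{0..x}|F. v powr \<alpha>)"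

definition DZ1 :: "real \<Rightarrow> real measure \<Rightarrow> bool" where
  "DZ1 \<alpha> F \<longleftrightarrow>
     Limsup at_top (\<lambda>x. SUP y\<in>{1..x}. ereal (slow_part \<alpha> F y / slow_part \<alpha> F x)) < \<infinity>"

definition DZ2 :: "real \<Rightarrow> real measure \<Rightarrow> bool" where
  "DZ2 \<alpha> F \<longleftrightarrow>
     (\<exists>U. type_iii_or_iv (slow_part \<alpha> F) U) \<and> class_Sd (\<lambda>x. slow_part \<alpha> F (exp x))"

definition DZ3 :: "real \<Rightarrow> real measure \<Rightarrow> real measure \<Rightarrow> real measure \<Rightarrow> bool" where
  "DZ3 \<alpha> F G U \<longleftrightarrow>
     type_iii_or_iv (slow_part \<alpha> F) U \<and> class_S_star U \<and>
     tail G \<in> o[at_top](\<lambda>x. x powr (-\<alpha>) * tail U (ln x))"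

definition DZ4 :: "real \<Rightarrow> real measure \<Rightarrow> real measure \<Rightarrow> bool" where
  "DZ4 \<alpha> F G \<longleftrightarrow>
     filterlim (truncated_moment \<alpha> F) at_top at_top \<and>
     tail G \<in> o[at_top](\<lambda>x. tail F x / truncated_moment \<alpha> F x) \<and>
     Limsup at_top (\<lambda>x. SUP y\<in>{sqrt x..x}. ereal (slow_part \<alpha> F y / slow_part \<alpha> F x)) < \<infinity>"

definition zeta_prod :: "(nat \<Rightarrow> 'a \<Rightarrow> real) \<Rightarrow> nat \<Rightarrow> 'a \<Rightarrow> real" where
  "zeta_prod Y i \<omega> = (\<Prod>j\<in>{1..<i}. Y j \<omega>)"

definition C_DZ2 :: "'a measure \<Rightarrow> (nat \<Rightarrow> 'a \<Rightarrow> real) \<Rightarrow> real measure \<Rightarrow> nat \<Rightarrow> ereal" where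
  "C_DZ2 M Y F i =
     (SUP x\<in>{1..}. ereal (measure M {\<omega> \<in> space M. zeta_prod Y i \<omega> > x} / tail F x))"

definition C_DZ3 ::
  "'a measure \<Rightarrow> (nat \<Rightarrow> 'a \<Rightarrow> real) \<Rightarrow> real \<Rightarrow> real measure \<Rightarrow> nat \<Rightarrow> ereal" where
  "C_DZ3 M Y \<alpha> U i =
     (SUP x\<in>{1..}. ereal (measure M {\<omega> \<in> space M. zeta_prod Y i \<omega> > x}
                            / (x powr (-\<alpha>) * tail U (ln x))))"

definition C_DZ4 ::
  "'a measure \<Rightarrow> (nat \<Rightarrow> 'a \<Rightarrow> real) \<Rightarrow> real \<Rightarrow> real measure \<Rightarrow> nat \<Rightarrow> ereal" where
  "C_DZ4 M Y \<alpha> F i =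
     (SUP x\<in>{1..}. ereal (measure M {\<omega> \<in> space M. zeta_prod Y i \<omega> > x} / tail F x
                            * truncated_moment \<alpha> F x))"

text \<open>The suprema above may be infinite, and \<open>real_of_ereal \<infinity> = 0\<close>, so that a finite series
  requires finiteness of every \<open>C i\<close> as a separate conjunct.\<close>

definition C_summable :: "real \<Rightarrow> (nat \<Rightarrow> ereal) \<Rightarrow> bool" where
  "C_summable \<alpha> C \<longleftrightarrow>
     (\<forall>i\<ge>2. C i < \<infinity>) \<and>
     (\<alpha> < 1 \<longrightarrow> summable (\<lambda>i. real_of_ereal (C (i + 2)))) \<and>
     (\<alpha> \<ge> 1 \<longrightarrow> (\<exists>\<epsilon>>0. summable (\<lambda>i. real_of_ereal (C (i + 2)) powr (1 / (\<alpha> + \<epsilon>)))))"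

end

theory Submission
  imports Defs
begin

text \<open>Write \<open>\<zeta>\<^sub>i\<close> for the product of the first \<open>i - 1\<close> weights and \<open>Z\<^sub>i = \<zeta>\<^sub>i X\<^sub>i Y\<^sub>i\<close>, so that the partial sums are
\<open>Z\<^sub>1 + \<dots> + Z\<^sub>n\<close>.  The supremum is large essentially only if exactly one \<open>Z\<^sub>i\<close> is large, hence its tail
is asymptotically the sum of the tails of the \<open>Z\<^sub>i\<close>.  With \<open>\<rho> = E[Y\<^sup>\<alpha>]\<close> and \<open>k\<close> the limit of
\<open>P[X\<^sub>1 Y\<^sub>1 > x] / P[X\<^sub>1 > x]\<close>, each ratio \<open>P[Z\<^sub>i > x] / P[X\<^sub>1 > x]\<close> tends to \<open>k\<close> times the
power of \<open>\<rho>\<close> with exponent \<open>i - 1\<close>, and the geometric series gives \<open>k / (1 - \<rho>)\<close>.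

Say that a nonnegative \<open>V\<close> satisfies Breiman's lemma if \<open>P[V X > x] / P[X > x]\<close> tends to
\<open>E[V\<^sup>\<alpha>]\<close> for \<open>X\<close> independent of \<open>V\<close> (predicate \<open>breiman\<close>).  Since the integrands converge pointwise,
this convergence of means is convergence in mean, and by a Pratt type theorem it carries over to every
tail comparable with that of \<open>X\<close>, even with a bounded weight inside the expectation
(\<open>weighted_breiman\<close>).  Four things follow at once: independent products stay in the class, so
only \<open>Y\<^sub>1\<close> itself must be treated; the Sarmanov factor contributes the second summand of \<open>k\<close>, because
\<open>\<phi>\<^sub>1\<close> is nearly \<open>d\<^sub>1\<close> where \<open>X\<close> is large and \<open>\<phi>\<^sub>2\<close> is bounded unless the dependence is trivial;
\<open>P[\<zeta>\<^sub>i > x] = o(P[X > x])\<close> for \<open>i \<ge> 2\<close>, because this holds for \<open>Y\<close>; and that two of the \<open>Z\<^sub>i\<close> are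
large together has negligible probability (\<open>cross_negligible\<close>), also if one of them is negative, for which
no tail estimate is available.

The four Denisov-Zwart conditions enter only through one estimate (predicate \<open>controls\<close>): for
a suitable comparison function \<open>h\<close>, a bound \<open>P[V > t] \<le> \<eta> h(t)\<close> for large \<open>t\<close> yields
\<open>P[V X > x, V > B] \<le> C (\<eta> + E[V\<^sup>\<alpha>]) P[X > x]\<close> for large \<open>x\<close>, with constants that
do not depend on \<open>V\<close>.  Here \<open>h(t)\<close> is
\<open>t\<close> to the power \<open>-\<alpha>\<close>, the tail of \<open>X\<close>, \<open>P[U > ln t]\<close> over \<open>t\<^sup>\<alpha>\<close>, or the tail of \<open>X\<close> over its truncated
moment.  Applied to \<open>Y\<^sub>1\<close> with \<open>\<eta>\<close> arbitrarily small the estimate gives Breiman's lemma; applied to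
\<open>\<zeta>\<^sub>i\<close>, with \<open>\<eta>\<close> the constant \<open>C\<^sub>i\<close> or, under the first condition, \<open>E[\<zeta>\<^sub>i\<^sup>\<alpha>]\<close>, it gives bounds for the
tail of \<open>Z\<^sub>i\<close> whose \<open>p\<close>-th roots are summable in \<open>i\<close> for some \<open>p \<ge> 1\<close> with \<open>p > \<alpha>\<close>.
Truncating the summands at \<open>x\<close> and applying Markov's and
Minkowski's inequalities with exponent \<open>p > \<alpha>\<close> (\<open>sum_tail_bound\<close>), these bounds make the remainder
of the series uniformly negligible, so that finitely many summands decide (\<open>perpetuity_tail\<close>).\<close>

section \<open>Convergence of integrals and moments\<close>

text \<open>Pratt's extension of dominated convergence: the dominating functions may vary, provided that their
integrals converge to the integral of their limit.  Clipping \<open>f x\<close> to the interval between \<open>- g0\<close>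
and \<open>g0\<close> makes the ordinary theorem applicable, and the error is at most what clipping removes from
\<open>g x\<close>, whose integral tends to zero.\<close>

lemma pratt_at_top:
  fixes f g :: "real \<Rightarrow> 'a \<Rightarrow> real"
  assumes f_meas: "\<And>x. f x \<in> borel_measurable M" and f0_meas: "f0 \<in> borel_measurable M"
    and f_lim: "\<And>\<omega>. \<omega> \<in> space M \<Longrightarrow> ((\<lambda>x. f x \<omega>) \<longlongrightarrow> f0 \<omega>) at_top"
    and g_lim: "\<And>\<omega>. \<omega> \<in> space M \<Longrightarrow> ((\<lambda>x. g x \<omega>) \<longlongrightarrow> g0 \<omega>) at_top"
    and dom: "\<And>x \<omega>. x0 \<le> x \<Longrightarrow> \<omega> \<in> space M \<Longrightarrow> \<bar>f x \<omega>\<bar> \<le> g x \<omega>"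
    and g_int: "\<And>x. integrable M (g x)" and g0_int: "integrable M g0"
    and g_conv: "((\<lambda>x. \<integral>\<omega>. g x \<omega> \<partial>M) \<longlongrightarrow> (\<integral>\<omega>. g0 \<omega> \<partial>M)) at_top"
  shows "((\<lambda>x. \<integral>\<omega>. f x \<omega> \<partial>M) \<longlongrightarrow> (\<integral>\<omega>. f0 \<omega> \<partial>M)) at_top"
proof -
  have [measurable]: "g x \<in> borel_measurable M" for x using g_int by auto
  have [measurable]: "g0 \<in> borel_measurable M" using g0_int by auto
  note f_meas[measurable] f0_meas[measurable]
  have f0_le: "\<bar>f0 \<omega>\<bar> \<le> g0 \<omega>" if "\<omega> \<in> space M" for \<omega>
  proof (rule tendsto_le[OF _ g_lim[OF that] tendsto_rabs[OF f_lim[OF that]]])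
    show "\<forall>\<^sub>F x in at_top. \<bar>f x \<omega>\<bar> \<le> g x \<omega>"
      using eventually_ge_at_top[of x0] by eventually_elim (rule dom[OF _ that])
  qed simp
  define fc where "fc = (\<lambda>x \<omega>. max (- g0 \<omega>) (min (g0 \<omega>) (f x \<omega>)))"
  define gm where "gm = (\<lambda>x \<omega>. max (- g0 \<omega>) (min (g0 \<omega>) (g x \<omega>)))"
  have [measurable]: "fc x \<in> borel_measurable M" "gm x \<in> borel_measurable M" for x
    unfolding fc_def gm_def by measurable
  have fc_conv: "((\<lambda>x. \<integral>\<omega>. fc x \<omega> \<partial>M) \<longlongrightarrow> (\<integral>\<omega>. f0 \<omega> \<partial>M)) at_top"
  proof (rule integral_dominated_convergence_at_top[where w=g0])
    show "AE \<omega> in M. ((\<lambda>x. fc x \<omega>) \<longlongrightarrow> f0 \<omega>) at_top"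
    proof (rule AE_I2)
      fix \<omega> assume w: "\<omega> \<in> space M"
      have "((\<lambda>x. fc x \<omega>) \<longlongrightarrow> max (- g0 \<omega>) (min (g0 \<omega>) (f0 \<omega>))) at_top"
        unfolding fc_def by (intro tendsto_intros f_lim w)
      then show "((\<lambda>x. fc x \<omega>) \<longlongrightarrow> f0 \<omega>) at_top" using f0_le[OF w] by (simp add: max_def min_def split: if_splits)
    qed
    show "\<forall>\<^sub>F x in at_top. AE \<omega> in M. norm (fc x \<omega>) \<le> g0 \<omega>"
      using f0_le by (intro always_eventually allI AE_I2) (fastforce simp: fc_def)
  qed (use g0_int in auto)
  have gm_conv: "((\<lambda>x. \<integral>\<omega>. gm x \<omega> \<partial>M) \<longlongrightarrow> (\<integral>\<omega>. g0 \<omega> \<partial>M)) at_top"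
  proof (rule integral_dominated_convergence_at_top[where w=g0])
    show "AE \<omega> in M. ((\<lambda>x. gm x \<omega>) \<longlongrightarrow> g0 \<omega>) at_top"
    proof (rule AE_I2)
      fix \<omega> assume w: "\<omega> \<in> space M"
      have "((\<lambda>x. gm x \<omega>) \<longlongrightarrow> max (- g0 \<omega>) (min (g0 \<omega>) (g0 \<omega>))) at_top"
        unfolding gm_def by (intro tendsto_intros g_lim w)
      then show "((\<lambda>x. gm x \<omega>) \<longlongrightarrow> g0 \<omega>) at_top" using f0_le[OF w] by (simp add: max_def min_def split: if_splits)
    qed
    show "\<forall>\<^sub>F x in at_top. AE \<omega> in M. norm (gm x \<omega>) \<le> g0 \<omega>"
      using f0_le by (intro always_eventually allI AE_I2) (fastforce simp: gm_def)
  qed (use g0_int in auto)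
  have fc_int: "integrable M (fc x)" and gm_int: "integrable M (gm x)" for x
    by (rule Bochner_Integration.integrable_bound[OF g0_int]; use f0_le in \<open>fastforce simp: fc_def gm_def\<close>)+
  have f_int: "integrable M (f x)" if "x0 \<le> x" for x
    by (rule Bochner_Integration.integrable_bound[OF g_int[of x]]; use dom[OF that] in fastforce)
  have close: "\<bar>(\<integral>\<omega>. f x \<omega> \<partial>M) - (\<integral>\<omega>. fc x \<omega> \<partial>M)\<bar> \<le> (\<integral>\<omega>. g x \<omega> \<partial>M) - (\<integral>\<omega>. gm x \<omega> \<partial>M)"
    if x: "x0 \<le> x" for x
  proof -
    have "\<bar>(\<integral>\<omega>. f x \<omega> \<partial>M) - (\<integral>\<omega>. fc x \<omega> \<partial>M)\<bar> = \<bar>\<integral>\<omega>. f x \<omega> - fc x \<omega> \<partial>M\<bar>"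
      using f_int[OF x] fc_int by simp
    also have "\<dots> \<le> (\<integral>\<omega>. \<bar>f x \<omega> - fc x \<omega>\<bar> \<partial>M)" by (rule integral_abs_bound)
    also have "\<dots> \<le> (\<integral>\<omega>. g x \<omega> - gm x \<omega> \<partial>M)"
    proof (rule integral_mono)
      fix \<omega> assume w: "\<omega> \<in> space M"
      show "\<bar>f x \<omega> - fc x \<omega>\<bar> \<le> g x \<omega> - gm x \<omega>"
        using dom[OF x w] f0_le[OF w] unfolding fc_def gm_def by linarith
    qed (use f_int[OF x] fc_int g_int gm_int in auto)
    also have "\<dots> = (\<integral>\<omega>. g x \<omega> \<partial>M) - (\<integral>\<omega>. gm x \<omega> \<partial>M)" using g_int gm_int by simp
    finally show ?thesis .
  qed
  have "((\<lambda>x. (\<integral>\<omega>. g x \<omega> \<partial>M) - (\<integral>\<omega>. gm x \<omega> \<partial>M)) \<longlongrightarrow> 0) at_top"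
    using tendsto_diff[OF g_conv gm_conv] by simp
  then have "((\<lambda>x. (\<integral>\<omega>. f x \<omega> \<partial>M) - (\<integral>\<omega>. fc x \<omega> \<partial>M)) \<longlongrightarrow> 0) at_top"
    by (rule tendsto_0_le[where K=1])
       (use eventually_ge_at_top[of x0] in \<open>eventually_elim, use close in force\<close>)
  from tendsto_add[OF this fc_conv] show ?thesis by simp
qed

text \<open>As a function of \<open>v\<close>, with \<open>H\<close> the tail of a variable, this is the tail at \<open>x \<ge> 0\<close> of the product of
that variable with the constant \<open>v \<ge> 0\<close>.  The case distinction is needed because \<open>x / 0 = 0\<close>.\<close>

definition scaled :: "(real \<Rightarrow> real) \<Rightarrow> real \<Rightarrow> real \<Rightarrow> real" where
  "scaled H x v = (if 0 < v then H (x / v) else 0)"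

abbreviation (input) moment :: "'a measure \<Rightarrow> ('a \<Rightarrow> real) \<Rightarrow> real \<Rightarrow> real" where
  "moment M V p \<equiv> (\<integral>\<omega>. V \<omega> powr p \<partial>M)"

abbreviation (input) mean_scaled :: "'a measure \<Rightarrow> (real \<Rightarrow> real) \<Rightarrow> ('a \<Rightarrow> real) \<Rightarrow> real \<Rightarrow> real" where
  "mean_scaled M H V x \<equiv> (\<integral>\<omega>. scaled H x (V \<omega>) \<partial>M)"

lemma scaled_measurable[measurable]:
  assumes [measurable]: "H \<in> borel_measurable borel" "V \<in> borel_measurable M"
  shows "(\<lambda>\<omega>. scaled H x (V \<omega>)) \<in> borel_measurable M"
  unfolding scaled_def by measurable

lemma antimono_borel:
  fixes f :: "real \<Rightarrow> real" assumes "antimono f" shows "f \<in> borel_measurable borel"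
proof -
  have "mono (\<lambda>x. - f x)" using assms by (simp add: monotone_on_def)
  then have "(\<lambda>x. - f x) \<in> borel_measurable borel" by (rule borel_measurable_mono)
  then show ?thesis by simp
qed

lemma (in prob_space) upper_moment_tendsto_0:
  assumes [measurable]: "Y \<in> borel_measurable M" and int: "integrable M (\<lambda>\<omega>. Y \<omega> powr \<alpha>)"
  shows "((\<lambda>t::real. \<integral>\<omega>. indicator {t<..} (Y \<omega>) * Y \<omega> powr \<alpha> \<partial>M) \<longlongrightarrow> 0) at_top"
proof -
  have "((\<lambda>t. \<integral>\<omega>. indicator {t<..} (Y \<omega>) * Y \<omega> powr \<alpha> \<partial>M) \<longlongrightarrow> (\<integral>\<omega>. 0 \<partial>M)) at_top"
  proof (rule integral_dominated_convergence_at_top[where w="\<lambda>\<omega>. Y \<omega> powr \<alpha>"])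
    show "AE \<omega> in M. ((\<lambda>t. indicator {t<..} (Y \<omega>) * Y \<omega> powr \<alpha>) \<longlongrightarrow> 0) at_top"
    proof (rule AE_I2)
      fix \<omega>
      show "((\<lambda>t. indicator {t<..} (Y \<omega>) * Y \<omega> powr \<alpha>) \<longlongrightarrow> 0) at_top"
        by (rule tendsto_eventually, use eventually_ge_at_top[of "Y \<omega>"] in eventually_elim) (auto simp: indicator_def)
    qed
  qed (use int in \<open>auto simp: indicator_def\<close>)
  then show ?thesis by simp
qed

lemma product_set_measurable: "{z :: real \<times> real. fst z * snd z > t} \<in> sets (borel \<Otimes>\<^sub>M borel)"
proof -
  have "{z \<in> space (borel \<Otimes>\<^sub>M borel). t < fst z * snd z} \<in> sets (borel \<Otimes>\<^sub>M borel)" by measurable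
  moreover have "{z \<in> space (borel \<Otimes>\<^sub>M borel). t < fst z * snd z} = {z. fst z * snd z > t}" by (auto simp: space_pair_measure)
  ultimately show ?thesis by (simp only:)
qed

lemma powr_le_one_plus_powr:
  fixes v p q :: real
  assumes "0 \<le> v" "0 \<le> p" "p \<le> q" shows "v powr p \<le> 1 + v powr q"
proof (cases "v \<le> 1")
  case True
  then have "v powr p \<le> 1" using assms by (intro powr_le1) auto
  then show ?thesis using powr_ge_zero[of v q] by linarith
next
  case False
  then have "v powr p \<le> v powr q" using assms by (intro powr_mono) auto
  then show ?thesis by simp
qed

lemma integrable_lower_powr:
  fixes V :: "'a \<Rightarrow> real"
  assumes M: "prob_space M" and V: "V \<in> borel_measurable M" "\<And>\<omega>. \<omega> \<in> space M \<Longrightarrow> 0 \<le> V \<omega>"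
    and int: "integrable M (\<lambda>\<omega>. V \<omega> powr q)" and pq: "0 \<le> p" "p \<le> q"
  shows "integrable M (\<lambda>\<omega>. V \<omega> powr p)"
proof (rule Bochner_Integration.integrable_bound)
  interpret prob_space M by fact
  show "integrable M (\<lambda>\<omega>. 1 + V \<omega> powr q)" using int by simp
  show "(\<lambda>\<omega>. V \<omega> powr p) \<in> borel_measurable M" using V(1) by simp
  show "AE \<omega> in M. norm (V \<omega> powr p) \<le> norm (1 + V \<omega> powr q)"
    using powr_le_one_plus_powr[OF V(2) pq] by (intro AE_I2) simp
qed

section \<open>Regularly varying tails\<close>

locale rv_law =
  fixes F :: "real measure" and \<alpha> :: real
  assumes law: "real_distribution F" and alpha_pos: "0 < \<alpha>"
    and rv: "regularly_varying_tail \<alpha> F"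
begin

sublocale F: real_distribution F by (rule law)

abbreviation Fbar :: "real \<Rightarrow> real" where "Fbar \<equiv> tail F"

lemma Fbar_antimono: "antimono Fbar"
  unfolding tail_def by (intro antimonoI F.finite_measure_mono) auto

lemma Fbar_mono: "x \<le> y \<Longrightarrow> Fbar y \<le> Fbar x"
  using Fbar_antimono by (rule antimonoD)

lemma Fbar_le_1: "Fbar x \<le> 1" and Fbar_nonneg: "0 \<le> Fbar x"
  unfolding tail_def by auto

lemma Fbar_borel[measurable]: "Fbar \<in> borel_measurable borel"
  by (rule antimono_borel[OF Fbar_antimono])

lemma Fbar_pos: "0 < Fbar x"
proof -
  have "((\<lambda>x. Fbar x / Fbar x) \<longlongrightarrow> 1) at_top"
    using rv[unfolded regularly_varying_tail_def tail_equiv_def, rule_format, of 1] by simp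
  then have "\<forall>\<^sub>F t in at_top. 0 < Fbar t / Fbar t" by (rule order_tendstoD) simp
  then have "\<forall>\<^sub>F t in at_top. 0 < Fbar t"
    by eventually_elim (use Fbar_nonneg in \<open>auto simp: order_less_le split: if_splits\<close>)
  then obtain t where "x \<le> t" "0 < Fbar t"
    using eventually_conj[OF eventually_ge_at_top[of x], THEN eventually_happens] by fastforce
  then show ?thesis using Fbar_mono[of x t] by linarith
qed

lemma Fbar_nz[simp]: "Fbar x \<noteq> 0" using Fbar_pos[of x] by simp

lemma Fbar_ratio:
  assumes "0 < c" shows "((\<lambda>x. Fbar (x * c) / Fbar x) \<longlongrightarrow> c powr (- \<alpha>)) at_top"
proof -
  have "((\<lambda>x. c powr (-\<alpha>) * (Fbar (x * c) / (c powr (-\<alpha>) * Fbar x))) \<longlongrightarrow> c powr (-\<alpha>) * 1) at_top"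
    using rv[unfolded regularly_varying_tail_def tail_equiv_def, rule_format, OF assms]
    by (rule tendsto_mult_left)
  then show ?thesis using assms by simp
qed

lemma Fbar_ratio':
  assumes "0 < v" shows "((\<lambda>x. Fbar (x / v) / Fbar x) \<longlongrightarrow> v powr \<alpha>) at_top"
  using Fbar_ratio[of "1/v"] assms by (simp add: powr_divide powr_minus field_simps)

text \<open>Beyond any fixed range the ratio converges; below it, positivity gives a bound.\<close>

lemma Fbar_bounded_ratio:
  assumes c: "1 \<le> c"
  obtains D where "1 \<le> D" "\<And>t. 0 \<le> t \<Longrightarrow> Fbar t \<le> D * Fbar (c * t)"
proof -
  have "((\<lambda>x. Fbar (x * c) / Fbar x) \<longlongrightarrow> c powr (- \<alpha>)) at_top" using Fbar_ratio c by simp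
  moreover have "c powr (-\<alpha>) / 2 < c powr (-\<alpha>)" using c by simp
  ultimately have "\<forall>\<^sub>F x in at_top. c powr (-\<alpha>) / 2 < Fbar (x * c) / Fbar x" by (rule order_tendstoD)
  then obtain t0 where t0: "\<And>x. t0 \<le> x \<Longrightarrow> c powr (-\<alpha>) / 2 < Fbar (x * c) / Fbar x"
    unfolding eventually_at_top_linorder by auto
  define D where "D = max 1 (max (2 * c powr \<alpha>) (1 / Fbar (c * max 0 t0)))"
  show ?thesis
  proof (rule that[of D])
    show "1 \<le> D" unfolding D_def by simp
    fix t :: real assume t: "0 \<le> t"
    show "Fbar t \<le> D * Fbar (c * t)"
    proof (cases "t0 \<le> t")
      case True
      from t0[OF True] have "Fbar t * (c powr (-\<alpha>) / 2) < Fbar (c * t)"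
        using Fbar_pos[of t] by (simp add: field_simps)
      then have "Fbar t < 2 * c powr \<alpha> * Fbar (c * t)" using c by (simp add: powr_minus field_simps)
      also have "\<dots> \<le> D * Fbar (c * t)" unfolding D_def by (intro mult_right_mono Fbar_nonneg) auto
      finally show ?thesis by simp
    next
      case False
      then have "c * t \<le> c * max 0 t0" using c by (intro mult_left_mono) auto
      then have "Fbar (c * max 0 t0) \<le> Fbar (c * t)" by (rule Fbar_mono)
      then have "1 \<le> 1 / Fbar (c * max 0 t0) * Fbar (c * t)" using Fbar_pos by (simp add: field_simps)
      also have "\<dots> \<le> D * Fbar (c * t)" unfolding D_def by (intro mult_right_mono Fbar_nonneg) auto
      finally show ?thesis using Fbar_le_1[of t] by linarith
    qed
  qed
qed

lemma Fbar_bounded_below: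
  obtains D where "1 \<le> D" "\<And>t. t \<le> T \<Longrightarrow> 1 \<le> D * Fbar t"
proof (rule that[of "1 / Fbar T"])
  show "1 \<le> 1 / Fbar T" using Fbar_pos[of T] Fbar_le_1[of T] by (simp add: field_simps)
  show "1 \<le> 1 / Fbar T * Fbar t" if "t \<le> T" for t
    using Fbar_pos[of T] Fbar_mono[OF that] by (simp add: field_simps)
qed

lemma dyadic_step:
  fixes l :: real
  assumes "1 \<le> l"
  obtains n :: nat where "2 ^ n \<le> l" "l < 2 * 2 ^ n"
proof -
  define n where "n = nat \<lfloor>log 2 l\<rfloor>"
  have l: "0 \<le> log 2 l" using assms by simp
  have "real n \<le> log 2 l" "log 2 l < real n + 1" unfolding n_def using l by linarith+
  then have "2 powr real n \<le> l" "l < 2 powr (real n + 1)"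
    using assms by (auto simp: le_log_iff log_less_iff)
  then show ?thesis by (intro that[of n]) (auto simp: powr_realpow powr_add)
qed

text \<open>One half of Potter's bounds: one doubling step with a slightly worse exponent holds beyond some
point, and it can be iterated.\<close>

lemma potter_upper:
  assumes q: "q < \<alpha>"  and q0: "0 \<le> q"
  obtains C t0 where "1 \<le> C" "0 < t0"
    "\<And>l t. 1 \<le> l \<Longrightarrow> t0 \<le> t \<Longrightarrow> Fbar (l * t) \<le> C * l powr (- q) * Fbar t"
proof -
  have "((\<lambda>x. Fbar (x * 2) / Fbar x) \<longlongrightarrow> 2 powr (- \<alpha>)) at_top" using Fbar_ratio by simp
  moreover have "2 powr (-\<alpha>) < (2::real) powr (-q)" using q by simp
  ultimately have "\<forall>\<^sub>F x in at_top. Fbar (x * 2) / Fbar x < 2 powr (-q)" by (rule order_tendstoD)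
  then obtain t1 where t1: "\<And>x. t1 \<le> x \<Longrightarrow> Fbar (x * 2) / Fbar x < 2 powr (-q)"
    unfolding eventually_at_top_linorder by auto
  define t0 where "t0 = max 1 t1"
  have pow: "Fbar (2 ^ n * t) \<le> (2 powr (-q)) ^ n * Fbar t" if t: "t0 \<le> t" for n t
  proof (induction n)
    case (Suc n)
    have "t1 \<le> 1 * t" using t unfolding t0_def by simp
    also have "\<dots> \<le> 2 ^ n * t" using t unfolding t0_def by (intro mult_right_mono) auto
    finally have "Fbar (2 ^ n * t * 2) < 2 powr (-q) * Fbar (2 ^ n * t)"
      using t1[of "2 ^ n * t"] Fbar_pos[of "2 ^ n * t"] by (simp add: field_simps)
    also have "\<dots> \<le> 2 powr (-q) * ((2 powr (-q)) ^ n * Fbar t)" using Suc by (intro mult_left_mono) auto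
    finally show ?case by (simp add: mult_ac)
  qed simp
  show ?thesis
  proof (rule that[of "2 powr q" t0])
    show "1 \<le> (2::real) powr q" using q0 by (simp add: ge_one_powr_ge_zero)
    show "0 < t0" unfolding t0_def by simp
    fix l t :: real assume l: "1 \<le> l" and t: "t0 \<le> t"
    obtain n :: nat where n: "2 ^ n \<le> l" "l < 2 * 2 ^ n" using dyadic_step[OF l] .
    have "t > 0" using t unfolding t0_def by simp
    then have "Fbar (l * t) \<le> Fbar (2 ^ n * t)" using n by (intro Fbar_mono mult_right_mono) auto
    also have "\<dots> \<le> (2 powr (-q)) ^ n * Fbar t" by (rule pow[OF t])
    also have "(2 powr (-q)) ^ n = (2 ^ n) powr (-q)"
      by (simp add: powr_power powr_powr flip: powr_realpow) (simp add: mult_ac)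
    also have "(2 ^ n) powr (-q) \<le> (l / 2) powr (-q)"
      using n l q0 by (intro powr_mono2') auto
    also have "\<dots> = 2 powr q * l powr (-q)" using l by (simp add: powr_divide powr_minus field_simps)
    finally show "Fbar (l * t) \<le> 2 powr q * l powr (-q) * Fbar t"
      using Fbar_nonneg by (simp add: mult_right_mono)
  qed
qed

lemma potter_lower:
  assumes r: "\<alpha> < r"
  obtains C t0 where "1 \<le> C" "0 < t0"
    "\<And>l t. 1 \<le> l \<Longrightarrow> t0 \<le> t \<Longrightarrow> Fbar t \<le> C * l powr r * Fbar (l * t)"
proof -
  have "((\<lambda>x. Fbar (x * 2) / Fbar x) \<longlongrightarrow> 2 powr (- \<alpha>)) at_top" using Fbar_ratio by simp
  moreover have "2 powr (-r) < (2::real) powr (-\<alpha>)" using r by simp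
  ultimately have "\<forall>\<^sub>F x in at_top. 2 powr (-r) < Fbar (x * 2) / Fbar x" by (rule order_tendstoD)
  then obtain t1 where t1: "\<And>x. t1 \<le> x \<Longrightarrow> 2 powr (-r) < Fbar (x * 2) / Fbar x"
    unfolding eventually_at_top_linorder by auto
  define t0 where "t0 = max 1 t1"
  have pow: "Fbar t \<le> (2 powr r) ^ n * Fbar (2 ^ n * t)" if t: "t0 \<le> t" for n t
  proof (induction n)
    case (Suc n)
    have "t1 \<le> 1 * t" using t unfolding t0_def by simp
    also have "\<dots> \<le> 2 ^ n * t" using t unfolding t0_def by (intro mult_right_mono) auto
    finally have "Fbar (2 ^ n * t) \<le> 2 powr r * Fbar (2 ^ n * t * 2)"
      using t1[of "2 ^ n * t"] Fbar_pos[of "2 ^ n * t"] by (simp add: field_simps powr_minus)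
    then have "(2 powr r) ^ n * Fbar (2 ^ n * t) \<le> (2 powr r) ^ n * (2 powr r * Fbar (2 ^ n * t * 2))"
      by (intro mult_left_mono) auto
    also have "\<dots> = (2 powr r) ^ Suc n * Fbar (2 ^ Suc n * t)" by (simp add: ac_simps)
    finally show ?case using Suc by linarith
  qed simp
  show ?thesis
  proof (rule that[of "2 powr r" t0])
    have r0: "0 < r" using r alpha_pos by simp
    show "1 \<le> (2::real) powr r" using r0 by (simp add: ge_one_powr_ge_zero)
    show "0 < t0" unfolding t0_def by simp
    fix l t :: real assume l: "1 \<le> l" and t: "t0 \<le> t"
    obtain n :: nat where n: "2 ^ n \<le> l" "l < 2 * 2 ^ n" using dyadic_step[OF l] .
    have t': "t > 0" using t unfolding t0_def by simp
    have "Fbar t \<le> (2 powr r) ^ Suc n * Fbar (2 ^ Suc n * t)" by (rule pow[OF t])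
    also have "\<dots> \<le> (2 powr r) ^ Suc n * Fbar (l * t)"
      using n t' by (intro mult_left_mono Fbar_mono mult_right_mono) auto
    also have "(2 powr r) ^ Suc n = 2 powr r * (2 ^ n) powr r"
      by (simp add: powr_power powr_powr flip: powr_realpow) (simp add: mult_ac)
    also have "2 powr r * (2 ^ n) powr r * Fbar (l * t) \<le> 2 powr r * l powr r * Fbar (l * t)"
      using n r0 by (intro mult_right_mono mult_left_mono powr_mono2 Fbar_nonneg) auto
    finally show "Fbar t \<le> 2 powr r * l powr r * Fbar (l * t)" .
  qed
qed

text \<open>Regular variation in the form in which it is integrated below.\<close>

lemma scaled_tail_limit:
  assumes "((\<lambda>t. H t / Fbar t) \<longlongrightarrow> k) at_top" "0 \<le> v"
  shows "((\<lambda>x. scaled H x v / Fbar x) \<longlongrightarrow> k * v powr \<alpha>) at_top"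
proof (cases "v = 0")
  case False
  with assms have v: "0 < v" by simp
  have "filterlim (\<lambda>x::real. x / v) at_top at_top"
    using filterlim_tendsto_pos_mult_at_top[OF tendsto_const[of "1/v"], of "\<lambda>x. x" at_top] v
    by (simp add: filterlim_ident)
  then have "((\<lambda>x. H (x/v) / Fbar (x/v) * (Fbar (x / v) / Fbar x)) \<longlongrightarrow> k * v powr \<alpha>) at_top"
    by (intro tendsto_mult Fbar_ratio' v filterlim_compose[OF assms(1)])
  then show ?thesis using v by (simp add: scaled_def)
qed (simp add: scaled_def)

end

section \<open>The class of factors satisfying Breiman's lemma\<close>

text \<open>Independence is used only through Fubini's theorem.  Both integrals are taken over the original
space, which avoids having to name the image laws.\<close>

lemma (in prob_space) expectation_indep_pair:
  fixes k :: "'b \<times> 'b \<Rightarrow> real"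
  assumes ind: "indep_var S V T Q" and k[measurable]: "k \<in> borel_measurable (S \<Otimes>\<^sub>M T)"
    and bd: "\<And>z. \<bar>k z\<bar> \<le> B"
  shows "(\<integral>\<omega>. k (V \<omega>, Q \<omega>) \<partial>M) = (\<integral>\<omega>. (\<integral>\<omega>'. k (V \<omega>, Q \<omega>') \<partial>M) \<partial>M)"
proof -
  have [measurable]: "V \<in> measurable M S" "Q \<in> measurable M T"
    using ind by (auto dest: indep_var_rv1 indep_var_rv2)
  interpret V: prob_space "distr M S V" by (rule prob_space_distr) simp
  interpret Q: prob_space "distr M T Q" by (rule prob_space_distr) simp
  interpret P: pair_prob_space "distr M S V" "distr M T Q" ..
  have k': "integrable (distr M S V \<Otimes>\<^sub>M distr M T Q) k"
    by (rule P.P.integrable_const_bound[where B=B]) (use bd in auto)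
  have "(\<integral>\<omega>. k (V \<omega>, Q \<omega>) \<partial>M) = integral\<^sup>L (distr M (S \<Otimes>\<^sub>M T) (\<lambda>\<omega>. (V \<omega>, Q \<omega>))) k"
    by (simp add: integral_distr)
  also have "\<dots> = integral\<^sup>L (distr M S V \<Otimes>\<^sub>M distr M T Q) k"
    using ind by (simp add: indep_var_distribution_eq)
  also have "\<dots> = (\<integral>v. (\<integral>q. k (v, q) \<partial>distr M T Q) \<partial>distr M S V)"
    using P.integral_fst'[OF k'] by simp
  also have "\<dots> = (\<integral>\<omega>. (\<integral>q. k (V \<omega>, q) \<partial>distr M T Q) \<partial>M)"
    by (subst integral_distr) auto
  also have "\<dots> = (\<integral>\<omega>. (\<integral>\<omega>'. k (V \<omega>, Q \<omega>') \<partial>M) \<partial>M)"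
  proof (rule Bochner_Integration.integral_cong[OF refl])
    fix \<omega> assume "\<omega> \<in> space M"
    then have "V \<omega> \<in> space S" by (rule measurable_space[rotated]) simp
    then show "(\<integral>q. k (V \<omega>, q) \<partial>distr M T Q) = (\<integral>\<omega>'. k (V \<omega>, Q \<omega>') \<partial>M)"
      by (subst integral_distr) auto
  qed
  finally show ?thesis .
qed

lemma (in prob_space) tail_antimono:
  assumes [measurable]: "Q \<in> borel_measurable M"
  shows "antimono (\<lambda>t::real. prob {\<omega> \<in> space M. Q \<omega> > t})"
  by (intro antimonoI finite_measure_mono) auto

lemma (in prob_space) product_tail:
  fixes V Q :: "'a \<Rightarrow> real"
  assumes ind: "indep_var borel V borel Q" and V: "\<And>\<omega>. \<omega> \<in> space M \<Longrightarrow> 0 \<le> V \<omega>" and x: "0 \<le> x"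
  shows "prob {\<omega> \<in> space M. V \<omega> * Q \<omega> > x}
    = (\<integral>\<omega>. scaled (\<lambda>t. prob {\<omega> \<in> space M. Q \<omega> > t}) x (V \<omega>) \<partial>M)"
proof -
  have [measurable]: "V \<in> borel_measurable M" "Q \<in> borel_measurable M"
    using ind by (auto dest: indep_var_rv1 indep_var_rv2)
  let ?k = "\<lambda>z::real \<times> real. indicator {z. fst z * snd z > x} z :: real"
  have "prob {\<omega> \<in> space M. V \<omega> * Q \<omega> > x} = (\<integral>\<omega>. indicator {\<omega> \<in> space M. V \<omega> * Q \<omega> > x} \<omega> \<partial>M)"
    by (simp add: Int_def conj_ac cong: conj_cong)
  also have "\<dots> = (\<integral>\<omega>. ?k (V \<omega>, Q \<omega>) \<partial>M)"
    by (intro Bochner_Integration.integral_cong) (auto simp: indicator_def)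
  also have "\<dots> = (\<integral>\<omega>. (\<integral>\<omega>'. ?k (V \<omega>, Q \<omega>') \<partial>M) \<partial>M)"
  proof (rule expectation_indep_pair[OF ind, where B=1])
    show "?k \<in> borel_measurable (borel \<Otimes>\<^sub>M borel)"
      by (rule borel_measurable_indicator[OF product_set_measurable])
  qed (auto simp: indicator_def)
  also have "\<dots> = (\<integral>\<omega>. scaled (\<lambda>t. prob {\<omega> \<in> space M. Q \<omega> > t}) x (V \<omega>) \<partial>M)"
  proof (rule Bochner_Integration.integral_cong[OF refl])
    fix \<omega> assume "\<omega> \<in> space M"
    then consider "V \<omega> = 0" | "V \<omega> > 0" using V by fastforce
    then show "(\<integral>\<omega>'. ?k (V \<omega>, Q \<omega>') \<partial>M) = scaled (\<lambda>t. prob {\<omega> \<in> space M. Q \<omega> > t}) x (V \<omega>)"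
    proof cases
      case 2
      have "(\<integral>\<omega>'. ?k (V \<omega>, Q \<omega>') \<partial>M) = (\<integral>\<omega>'. indicator {\<omega>' \<in> space M. Q \<omega>' > x / V \<omega>} \<omega>' \<partial>M)"
        using 2 by (intro Bochner_Integration.integral_cong) (auto simp: indicator_def field_simps)
      then show ?thesis using 2 by (simp add: scaled_def Int_def conj_ac cong: conj_cong)
    qed (use x in \<open>simp add: scaled_def indicator_def\<close>)
  qed
  finally show ?thesis .
qed

context rv_law begin

text \<open>The conclusion of Breiman's lemma for the factor \<open>V\<close>, taken as a property of \<open>V\<close> so that it can be
propagated along products.\<close>

definition breiman :: "'b measure \<Rightarrow> ('b \<Rightarrow> real) \<Rightarrow> bool" where
  "breiman M V \<longleftrightarrow> V \<in> borel_measurable M \<and> (\<forall>\<omega>\<in>space M. 0 \<le> V \<omega>) \<and>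
     integrable M (\<lambda>\<omega>. V \<omega> powr \<alpha>) \<and>
     ((\<lambda>x. mean_scaled M Fbar V x / Fbar x) \<longlongrightarrow> moment M V \<alpha>) at_top"

lemma comparable_bound:
  assumes lim: "((\<lambda>t. H t / Fbar t) \<longlongrightarrow> k) at_top" and bd: "\<And>t. \<bar>H t\<bar> \<le> B"
  obtains C where "0 \<le> C" "\<And>t. 0 \<le> t \<Longrightarrow> \<bar>H t\<bar> \<le> C * Fbar t"
proof -
  have "((\<lambda>t. \<bar>H t / Fbar t\<bar>) \<longlongrightarrow> \<bar>k\<bar>) at_top" by (intro tendsto_intros lim)
  then have "\<forall>\<^sub>F t in at_top. \<bar>H t / Fbar t\<bar> < \<bar>k\<bar> + 1" by (rule order_tendstoD) simp
  then obtain T where T: "\<And>t. T \<le> t \<Longrightarrow> \<bar>H t / Fbar t\<bar> < \<bar>k\<bar> + 1"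
    unfolding eventually_at_top_linorder by auto
  obtain D where D: "1 \<le> D" "\<And>t. t \<le> T \<Longrightarrow> 1 \<le> D * Fbar t" using Fbar_bounded_below[of T] by blast
  have B: "0 \<le> B" using bd[of 0] by linarith
  show ?thesis
  proof (rule that[of "max (\<bar>k\<bar> + 1) (B * D)"])
    show "0 \<le> max (\<bar>k\<bar> + 1) (B * D)" by simp
    fix t :: real
    show "\<bar>H t\<bar> \<le> max (\<bar>k\<bar> + 1) (B * D) * Fbar t"
    proof (cases "T \<le> t")
      case True
      have "\<bar>H t\<bar> \<le> (\<bar>k\<bar> + 1) * Fbar t" using T[OF True] Fbar_pos[of t] by (simp add: abs_divide field_simps)
      also have "\<dots> \<le> max (\<bar>k\<bar> + 1) (B * D) * Fbar t" by (intro mult_right_mono Fbar_nonneg) auto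
      finally show ?thesis .
    next
      case False
      have "\<bar>H t\<bar> \<le> B * 1" using bd by simp
      also have "\<dots> \<le> B * (D * Fbar t)" using D(2)[of t] False B by (intro mult_left_mono) auto
      also have "\<dots> \<le> max (\<bar>k\<bar> + 1) (B * D) * Fbar t"
        unfolding mult.assoc[symmetric] by (intro mult_right_mono Fbar_nonneg) auto
      finally show ?thesis .
    qed
  qed
qed

lemma scaled_Fbar_bounds: "0 \<le> scaled Fbar x v" "scaled Fbar x v \<le> 1"
  using Fbar_nonneg Fbar_le_1 by (auto simp: scaled_def)

lemma scaled_Fbar_integrable:
  assumes "prob_space M" "V \<in> borel_measurable M"
  shows "integrable M (\<lambda>\<omega>. scaled Fbar x (V \<omega>))"
proof -
  interpret prob_space M by fact
  note assms(2)[measurable]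
  show ?thesis by (rule integrable_const_bound[where B=1]) (use scaled_Fbar_bounds in auto)
qed

text \<open>Pratt's theorem turns the convergence of the means that \<open>breiman\<close> postulates into the same
statement for any tail that is asymptotically \<open>k\<close> times the given one.  The weight \<open>w\<close> may depend on
\<open>V\<close>; indicators and the second Sarmanov kernel will be used for it.\<close>

lemma weighted_breiman:
  fixes M :: "'b measure"
  assumes M: "prob_space M" and V: "breiman M V" and H[measurable]: "H \<in> borel_measurable borel"
    and lim: "((\<lambda>t. H t / Fbar t) \<longlongrightarrow> k) at_top" and bd: "\<And>t. \<bar>H t\<bar> \<le> B"
    and w[measurable]: "w \<in> borel_measurable M" and wbd: "\<And>\<omega>. \<omega> \<in> space M \<Longrightarrow> \<bar>w \<omega>\<bar> \<le> W"
  shows "((\<lambda>x. (\<integral>\<omega>. w \<omega> * scaled H x (V \<omega>) \<partial>M) / Fbar x) \<longlongrightarrow> k * (\<integral>\<omega>. w \<omega> * V \<omega> powr \<alpha> \<partial>M)) at_top"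
proof -
  interpret M: prob_space M by fact
  have [measurable]: "V \<in> borel_measurable M" and V0: "\<And>\<omega>. \<omega> \<in> space M \<Longrightarrow> 0 \<le> V \<omega>"
    and Vint: "integrable M (\<lambda>\<omega>. V \<omega> powr \<alpha>)"
    and Vlim: "((\<lambda>x. mean_scaled M Fbar V x / Fbar x) \<longlongrightarrow> moment M V \<alpha>) at_top"
    using V unfolding breiman_def by auto
  obtain C where C: "0 \<le> C" "\<And>t. 0 \<le> t \<Longrightarrow> \<bar>H t\<bar> \<le> C * Fbar t" using comparable_bound[OF lim bd] by blast
  have W: "0 \<le> W" using M.not_empty wbd by fastforce
  let ?f = "\<lambda>x \<omega>. w \<omega> * (scaled H x (V \<omega>) / Fbar x)"
  let ?g = "\<lambda>x \<omega>. W * C * (scaled Fbar x (V \<omega>) / Fbar x)"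
  have "((\<lambda>x. \<integral>\<omega>. ?f x \<omega> \<partial>M) \<longlongrightarrow> (\<integral>\<omega>. w \<omega> * (k * V \<omega> powr \<alpha>) \<partial>M)) at_top"
  proof (rule pratt_at_top[where g="?g" and ?g0.0="\<lambda>\<omega>. W * C * (1 * V \<omega> powr \<alpha>)" and ?x0.0=0])
    fix \<omega> assume \<omega>: "\<omega> \<in> space M"
    show "((\<lambda>x. ?f x \<omega>) \<longlongrightarrow> w \<omega> * (k * V \<omega> powr \<alpha>)) at_top"
      by (intro tendsto_mult_left scaled_tail_limit lim V0 \<omega>)
    show "((\<lambda>x. ?g x \<omega>) \<longlongrightarrow> W * C * (1 * V \<omega> powr \<alpha>)) at_top"
      by (intro tendsto_mult_left scaled_tail_limit V0 \<omega>) simp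
    fix x :: real assume x: "0 \<le> x"
    have "\<bar>scaled H x (V \<omega>)\<bar> \<le> C * scaled Fbar x (V \<omega>)" using x C by (auto simp: scaled_def)
    then have "\<bar>w \<omega>\<bar> * \<bar>scaled H x (V \<omega>)\<bar> \<le> W * (C * scaled Fbar x (V \<omega>))"
      using wbd[OF \<omega>] W by (intro mult_mono) auto
    then show "\<bar>?f x \<omega>\<bar> \<le> ?g x \<omega>"
      using Fbar_pos[of x] by (simp add: abs_mult abs_divide divide_right_mono mult_ac)
  next
    show "((\<lambda>x. \<integral>\<omega>. ?g x \<omega> \<partial>M) \<longlongrightarrow> (\<integral>\<omega>. W * C * (1 * V \<omega> powr \<alpha>) \<partial>M)) at_top"
      using tendsto_mult_left[OF Vlim, of "W * C"] by simp
  next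
    show "integrable M (?g x)" for x
      using scaled_Fbar_integrable[OF M, of V x] by (intro integrable_mult_right integrable_divide) auto
    show "integrable M (\<lambda>\<omega>. W * C * (1 * V \<omega> powr \<alpha>))"
      using Vint by (intro integrable_mult_right) auto
  qed measurable
  then show ?thesis by (simp add: mult.left_commute)
qed

lemma breiman_tail:
  assumes M: "prob_space M" and V: "breiman M V" and ind: "prob_space.indep_var M borel V borel Q"
    and lim: "((\<lambda>t. \<P>(\<omega> in M. Q \<omega> > t) / Fbar t) \<longlongrightarrow> k) at_top"
  shows "((\<lambda>x. \<P>(\<omega> in M. V \<omega> * Q \<omega> > x) / Fbar x) \<longlongrightarrow> k * moment M V \<alpha>) at_top"
proof -
  interpret M: prob_space M by fact
  have [measurable]: "Q \<in> borel_measurable M" using ind by (auto dest: M.indep_var_rv2)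
  have "((\<lambda>x. (\<integral>\<omega>. 1 * scaled (\<lambda>t. \<P>(\<omega> in M. Q \<omega> > t)) x (V \<omega>) \<partial>M) / Fbar x)
      \<longlongrightarrow> k * (\<integral>\<omega>. 1 * V \<omega> powr \<alpha> \<partial>M)) at_top"
    by (rule weighted_breiman[OF M V _ lim, where B=1 and W=1])
       (auto intro: antimono_borel M.tail_antimono)
  moreover have "\<forall>\<^sub>F x in at_top. (\<integral>\<omega>. 1 * scaled (\<lambda>t. \<P>(\<omega> in M. Q \<omega> > t)) x (V \<omega>) \<partial>M) / Fbar x
      = \<P>(\<omega> in M. V \<omega> * Q \<omega> > x) / Fbar x"
    using eventually_ge_at_top[of 0]
    by eventually_elim (use V in \<open>simp add: breiman_def M.product_tail[OF ind]\<close>)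
  ultimately have "((\<lambda>x. \<P>(\<omega> in M. V \<omega> * Q \<omega> > x) / Fbar x)
      \<longlongrightarrow> k * (\<integral>\<omega>. 1 * V \<omega> powr \<alpha> \<partial>M)) at_top"
    by (rule Lim_transform_eventually)
  then show ?thesis by simp
qed

text \<open>Multiplying by an indicator is the way in which events that depend on \<open>V\<close> enter the estimates for
joint exceedances.\<close>

lemma breiman_restrict:
  assumes M: "prob_space M" and V: "breiman M V" and D[measurable]: "D \<in> sets M"
  shows "breiman M (\<lambda>\<omega>. V \<omega> * indicator D \<omega>)"
proof -
  interpret M: prob_space M by fact
  have [measurable]: "V \<in> borel_measurable M" using V by (simp add: breiman_def)
  have eq: "(V \<omega> * indicator D \<omega>) powr \<alpha> = indicator D \<omega> * V \<omega> powr \<alpha>"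
    "scaled Fbar x (V \<omega> * indicator D \<omega>) = indicator D \<omega> * scaled Fbar x (V \<omega>)" for \<omega> x
    by (auto simp: indicator_def scaled_def)
  have "((\<lambda>x. (\<integral>\<omega>. indicator D \<omega> * scaled Fbar x (V \<omega>) \<partial>M) / Fbar x)
      \<longlongrightarrow> 1 * (\<integral>\<omega>. indicator D \<omega> * V \<omega> powr \<alpha> \<partial>M)) at_top"
    by (rule weighted_breiman[OF M V, where B=1 and W=1])
       (auto simp: Fbar_le_1 abs_le_iff intro: order_trans[OF _ Fbar_nonneg])
  moreover have "integrable M (\<lambda>\<omega>. indicator D \<omega> * V \<omega> powr \<alpha>)"
    using integrable_real_mult_indicator[OF D, of "\<lambda>\<omega>. V \<omega> powr \<alpha>"] V
    by (simp add: breiman_def mult.commute)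
  ultimately show ?thesis using V unfolding breiman_def eq by auto
qed

text \<open>Integrating out \<open>Y\<close> first leaves the function \<open>g\<close> in place of the tail, and \<open>g\<close> is comparable with
the tail because \<open>Y\<close> is in the class; so \<open>weighted_breiman\<close> applies to \<open>V\<close>.\<close>

lemma breiman_product:
  assumes M: "prob_space M" and V: "breiman M V" and Y: "breiman M Y"
    and ind: "prob_space.indep_var M borel V borel Y"
  shows "breiman M (\<lambda>\<omega>. V \<omega> * Y \<omega>)"
    and "(\<integral>\<omega>. (V \<omega> * Y \<omega>) powr \<alpha> \<partial>M) = moment M V \<alpha> * moment M Y \<alpha>"
proof -
  interpret M: prob_space M by fact
  have [measurable]: "V \<in> borel_measurable M" "Y \<in> borel_measurable M"
    using V Y by (auto simp: breiman_def)
  have V0: "\<And>\<omega>. \<omega> \<in> space M \<Longrightarrow> 0 \<le> V \<omega>" and Y0: "\<And>\<omega>. \<omega> \<in> space M \<Longrightarrow> 0 \<le> Y \<omega>"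
    using V Y by (auto simp: breiman_def)
  define g where "g = (\<lambda>t. \<integral>\<omega>. scaled Fbar t (Y \<omega>) \<partial>M)"
  have "(\<lambda>(t, \<omega>). scaled Fbar t (Y \<omega>)) \<in> borel_measurable (borel \<Otimes>\<^sub>M M)"
    unfolding scaled_def by measurable
  then have g_meas[measurable]: "g \<in> borel_measurable borel"
    unfolding g_def by (intro M.borel_measurable_lebesgue_integral)
  have g_bd: "\<bar>g t\<bar> \<le> 1" for t
  proof -
    have "0 \<le> g t" unfolding g_def by (intro Bochner_Integration.integral_nonneg scaled_Fbar_bounds)
    moreover have "g t \<le> (\<integral>\<omega>. 1 \<partial>M)" unfolding g_def
      by (intro integral_mono scaled_Fbar_integrable M scaled_Fbar_bounds) auto
    ultimately show ?thesis by (simp add: M.prob_space)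
  qed
  have glim: "((\<lambda>x. (\<integral>\<omega>. 1 * scaled g x (V \<omega>) \<partial>M) / Fbar x)
      \<longlongrightarrow> moment M Y \<alpha> * (\<integral>\<omega>. 1 * V \<omega> powr \<alpha> \<partial>M)) at_top"
    by (rule weighted_breiman[OF M V, where B=1 and W=1]) (use Y g_bd g_meas in \<open>auto simp: breiman_def g_def\<close>)
  have geq: "(\<integral>\<omega>. 1 * scaled g x (V \<omega>) \<partial>M) = (\<integral>\<omega>. scaled Fbar x (V \<omega> * Y \<omega>) \<partial>M)" for x
  proof -
    let ?k = "\<lambda>z::real\<times>real. scaled Fbar x (fst z * snd z)"
    have "(\<integral>\<omega>. ?k (V \<omega>, Y \<omega>) \<partial>M) = (\<integral>\<omega>. (\<integral>\<omega>'. ?k (V \<omega>, Y \<omega>') \<partial>M) \<partial>M)"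
      by (rule M.expectation_indep_pair[OF ind, where B=1])
         (use scaled_Fbar_bounds in \<open>auto simp: abs_le_iff intro: order_trans[OF _ scaled_Fbar_bounds(1)]\<close>)
    also have "\<dots> = mean_scaled M g V x"
    proof (rule Bochner_Integration.integral_cong[OF refl])
      fix \<omega> assume "\<omega> \<in> space M"
      then consider "V \<omega> = 0" | "V \<omega> > 0" using V0 by fastforce
      then show "(\<integral>\<omega>'. ?k (V \<omega>, Y \<omega>') \<partial>M) = scaled g x (V \<omega>)"
      proof cases
        case 2
        then have "scaled Fbar x (V \<omega> * y) = scaled Fbar (x / V \<omega>) y" for y
          by (auto simp: scaled_def zero_less_mult_iff field_simps)
        then show ?thesis using 2 by (simp add: scaled_def[of g] scaled_def[of "\<lambda>t. LINT \<omega>|M. scaled Fbar t (Y \<omega>)"] g_def)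
      qed (simp add: scaled_def)
    qed
    finally show ?thesis by simp
  qed
  have pw: "(V \<omega> * Y \<omega>) powr \<alpha> = V \<omega> powr \<alpha> * Y \<omega> powr \<alpha>" if "\<omega> \<in> space M" for \<omega>
    using V0[OF that] Y0[OF that] by (simp add: powr_mult)
  have ind': "M.indep_var borel (\<lambda>\<omega>. V \<omega> powr \<alpha>) borel (\<lambda>\<omega>. Y \<omega> powr \<alpha>)"
    using M.indep_var_compose[OF ind, of "\<lambda>v. v powr \<alpha>" borel "\<lambda>v. v powr \<alpha>" borel] by (simp add: comp_def)
  have int: "integrable M (\<lambda>\<omega>. V \<omega> powr \<alpha>)" "integrable M (\<lambda>\<omega>. Y \<omega> powr \<alpha>)"
    using V Y by (auto simp: breiman_def)
  have "(\<integral>\<omega>. (V \<omega> * Y \<omega>) powr \<alpha> \<partial>M) = (\<integral>\<omega>. V \<omega> powr \<alpha> * Y \<omega> powr \<alpha> \<partial>M)"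
    by (rule Bochner_Integration.integral_cong[OF refl pw])
  also have "\<dots> = moment M V \<alpha> * moment M Y \<alpha>"
    by (rule M.indep_var_lebesgue_integral[OF ind' int])
  finally show E: "(\<integral>\<omega>. (V \<omega> * Y \<omega>) powr \<alpha> \<partial>M) = moment M V \<alpha> * moment M Y \<alpha>" .
  have "integrable M (\<lambda>\<omega>. V \<omega> powr \<alpha> * Y \<omega> powr \<alpha>)"
    by (rule M.indep_var_integrable[OF ind' int])
  then have "integrable M (\<lambda>\<omega>. (V \<omega> * Y \<omega>) powr \<alpha>)"
    using pw by (subst Bochner_Integration.integrable_cong[OF refl]) auto
  then show "breiman M (\<lambda>\<omega>. V \<omega> * Y \<omega>)"
    using glim V0 Y0 unfolding breiman_def E geq by (simp add: mult.commute)
qed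

section \<open>Control of large factors\<close>

abbreviation (input) large_part :: "'b measure \<Rightarrow> ('b \<Rightarrow> real) \<Rightarrow> real \<Rightarrow> real \<Rightarrow> real" where
  "large_part M V B x \<equiv> (\<integral>\<omega>. (if B < V \<omega> then Fbar (x / V \<omega>) else 0) \<partial>M)"

text \<open>The bound has to hold with the same constants for all \<open>V\<close>, because it will be applied to all
products of weights simultaneously.  The threshold \<open>x0\<close> may depend on the level \<open>A\<close>, and the factor
\<open>\<kappa>\<close> leaves room for discretisation errors.\<close>

definition large_part_bound :: "'b measure \<Rightarrow> (real \<Rightarrow> real) \<Rightarrow> real \<Rightarrow> real \<Rightarrow> real \<Rightarrow> real \<Rightarrow> bool" where
  "large_part_bound M h C \<kappa> A x0 \<longleftrightarrow> (\<forall>V \<eta> x.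
     V \<in> borel_measurable M \<longrightarrow> (\<forall>\<omega>\<in>space M. 0 \<le> V \<omega>) \<longrightarrow> integrable M (\<lambda>\<omega>. V \<omega> powr \<alpha>) \<longrightarrow> 0 \<le> \<eta> \<longrightarrow>
     (\<forall>t\<ge>A. \<P>(\<omega> in M. V \<omega> > t) \<le> \<eta> * h t) \<longrightarrow> x0 \<le> x \<longrightarrow>
     large_part M V (\<kappa> * A) x \<le> C * (\<eta> + moment M V \<alpha>) * Fbar x)"

definition controls :: "'b measure \<Rightarrow> (real \<Rightarrow> real) \<Rightarrow> bool" where
  "controls M h \<longleftrightarrow> (\<exists>C \<kappa> A0. 0 \<le> C \<and> 1 \<le> \<kappa> \<and> 1 \<le> A0 \<and> (\<forall>A\<ge>A0. \<exists>x0. large_part_bound M h C \<kappa> A x0))"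

lemma large_part_bound_upper:
  assumes "large_part_bound M h C \<kappa> A x0" "V \<in> borel_measurable M" "\<And>\<omega>. \<omega> \<in> space M \<Longrightarrow> 0 \<le> V \<omega>"
    "integrable M (\<lambda>\<omega>. V \<omega> powr \<alpha>)" "0 \<le> \<eta>" "\<And>t. A \<le> t \<Longrightarrow> \<P>(\<omega> in M. V \<omega> > t) \<le> \<eta> * h t" "x0 \<le> x"
  shows "large_part M V (\<kappa> * A) x \<le> C * (\<eta> + moment M V \<alpha>) * Fbar x"
  using assms unfolding large_part_bound_def by blast

text \<open>The case covered by regular variation alone: for bounded factors the ratios are uniformly bounded.\<close>

lemma breiman_bounded:
  assumes M: "prob_space M" and V[measurable]: "V \<in> borel_measurable M"
    and bd: "\<And>\<omega>. \<omega> \<in> space M \<Longrightarrow> 0 \<le> V \<omega>" "\<And>\<omega>. \<omega> \<in> space M \<Longrightarrow> V \<omega> \<le> c" and c: "1 \<le> c"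
  shows "breiman M V"
proof -
  interpret M: prob_space M by fact
  obtain D where D: "1 \<le> D" "\<And>t. 0 \<le> t \<Longrightarrow> Fbar t \<le> D * Fbar (c * t)"
    using Fbar_bounded_ratio[OF c] by blast
  have int: "integrable M (\<lambda>\<omega>. V \<omega> powr \<alpha>)"
    by (rule M.integrable_const_bound[where B="c powr \<alpha>"])
       (use bd alpha_pos in \<open>auto intro!: AE_I2 powr_mono2\<close>)
  have "((\<lambda>x. \<integral>\<omega>. scaled Fbar x (V \<omega>) / Fbar x \<partial>M) \<longlongrightarrow> moment M V \<alpha>) at_top"
  proof (rule integral_dominated_convergence_at_top[where w="\<lambda>_. D"])
    show "AE \<omega> in M. ((\<lambda>x. scaled Fbar x (V \<omega>) / Fbar x) \<longlongrightarrow> V \<omega> powr \<alpha>) at_top"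
      using scaled_tail_limit[of Fbar 1] bd by (intro AE_I2) auto
    show "\<forall>\<^sub>F x in at_top. AE \<omega> in M. norm (scaled Fbar x (V \<omega>) / Fbar x) \<le> D"
      using eventually_ge_at_top[of 0]
    proof eventually_elim
      fix x :: real assume x: "0 \<le> x"
      have "scaled Fbar x (V \<omega>) \<le> D * Fbar x" if "\<omega> \<in> space M" for \<omega>
      proof (cases "V \<omega> > 0")
        case True
        have "Fbar (x / V \<omega>) \<le> Fbar (x / c)"
          using True bd(2)[OF that] x by (intro Fbar_mono divide_left_mono) auto
        also have "\<dots> \<le> D * Fbar (c * (x / c))" using x c by (intro D) auto
        finally show ?thesis using True c by (simp add: scaled_def)
      qed (use D(1) Fbar_nonneg in \<open>simp add: scaled_def\<close>)
      then show "AE \<omega> in M. norm (scaled Fbar x (V \<omega>) / Fbar x) \<le> D"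
        using scaled_Fbar_bounds(1) Fbar_pos[of x] by (intro AE_I2) (simp add: abs_divide divide_le_eq)
    qed
  qed auto
  then show ?thesis using int bd unfolding breiman_def by auto
qed

text \<open>Split \<open>Y\<close> at a high level.  The bounded part satisfies Breiman's lemma, and the control estimate,
applied to \<open>Y\<close> restricted to \<open>Y > A\<close>, makes the rest as small as desired, since both its tail
coefficient and its \<open>\<alpha>\<close>-th moment are small.\<close>

lemma controls_imp_breiman:
  assumes M: "prob_space M" and con: "controls M h" and Y[measurable]: "Y \<in> borel_measurable M"
    and Y0: "\<And>\<omega>. \<omega> \<in> space M \<Longrightarrow> 0 \<le> Y \<omega>" and Yint: "integrable M (\<lambda>\<omega>. Y \<omega> powr \<alpha>)"
    and small: "\<And>\<eta>. 0 < \<eta> \<Longrightarrow> \<exists>A. \<forall>t\<ge>A. \<P>(\<omega> in M. Y \<omega> > t) \<le> \<eta> * h t"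
  shows "breiman M Y"
proof -
  interpret M: prob_space M by fact
  obtain C \<kappa> A0 where C: "0 \<le> C" and \<kappa>: "1 \<le> \<kappa>" and A0: "1 \<le> A0" and
    ctl: "\<And>A. A0 \<le> A \<Longrightarrow> \<exists>x0. large_part_bound M h C \<kappa> A x0"
    using con unfolding controls_def by blast
  note tail0 = M.upper_moment_tendsto_0[OF Y Yint]
  have "((\<lambda>x. mean_scaled M Fbar Y x / Fbar x - moment M Y \<alpha>) \<longlongrightarrow> 0) at_top"
  proof (rule tendstoI)
    fix e :: real assume e: "0 < e"
    define \<epsilon> where "\<epsilon> = e / (2 * C + 3)"
    have \<epsilon>1: "0 < \<epsilon>" and "\<epsilon> * (2 * C + 3) = e" using e C by (auto simp: \<epsilon>_def)
    then have \<epsilon>: "0 < \<epsilon>" "2 * C * \<epsilon> + 2 * \<epsilon> < e" using \<epsilon>1 by (auto simp: algebra_simps)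
    obtain A1 where A1: "\<And>t. A1 \<le> t \<Longrightarrow> \<P>(\<omega> in M. Y \<omega> > t) \<le> \<epsilon> * h t"
      using small[OF \<epsilon>(1)] by blast
    have "\<forall>\<^sub>F A in at_top. (\<integral>\<omega>. indicator {A<..} (Y \<omega>) * Y \<omega> powr \<alpha> \<partial>M) < \<epsilon>"
      using tail0 \<epsilon>(1) by (intro order_tendstoD) auto
    from eventually_happens'[OF trivial_limit_at_top_linorder eventually_conj[OF this eventually_ge_at_top[of "max A0 A1"]]]
    obtain A where A: "(\<integral>\<omega>. indicator {A<..} (Y \<omega>) * Y \<omega> powr \<alpha> \<partial>M) < \<epsilon>" "A0 \<le> A" "A1 \<le> A" by auto
    \<comment> \<open>The large part of \<open>Y\<close> and its bounded remainder overlap, since \<open>A \<le> \<kappa> * A\<close>.\<close>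
    let ?V = "\<lambda>\<omega>. Y \<omega> * indicator {A<..} (Y \<omega>)"
    let ?B = "\<lambda>\<omega>. Y \<omega> * indicator {..\<kappa> * A} (Y \<omega>)"
    have A': "A \<le> \<kappa> * A" "1 \<le> \<kappa> * A" using A0 A(2) \<kappa> mult_mono[of 1 \<kappa> 1 A] mult_right_mono[of 1 \<kappa> A] by auto
    have A'': "\<And>y. \<kappa> * A < y \<Longrightarrow> A < y" using A'(1) by linarith
    have Vp: "?V \<omega> powr \<alpha> = indicator {A<..} (Y \<omega>) * Y \<omega> powr \<alpha>" for \<omega> by (simp add: indicator_def)
    have Vint: "integrable M (\<lambda>\<omega>. ?V \<omega> powr \<alpha>)"
      unfolding Vp by (rule Bochner_Integration.integrable_bound[OF Yint]) (auto simp: indicator_def)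
    have Vt: "\<P>(\<omega> in M. ?V \<omega> > t) \<le> \<epsilon> * h t" if t: "A \<le> t" for t
    proof -
      have "0 \<le> t" using t A0 A(2) by linarith
      then have "\<P>(\<omega> in M. ?V \<omega> > t) \<le> \<P>(\<omega> in M. Y \<omega> > t)"
        by (intro M.finite_measure_mono) (auto simp: indicator_def)
      with A1[of t] t A(3) show ?thesis by linarith
    qed
    obtain x0 where x0: "large_part_bound M h C \<kappa> A x0" using ctl[OF A(2)] by blast
    have large: "large_part M Y (\<kappa> * A) x \<le> 2 * C * \<epsilon> * Fbar x" if "x0 \<le> x" for x
    proof -
      have "large_part M Y (\<kappa> * A) x
          = large_part M ?V (\<kappa> * A) x"
        using A'(2) by (intro Bochner_Integration.integral_cong) (auto simp: indicator_def dest: A'')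
      also have "\<dots> \<le> C * (\<epsilon> + moment M ?V \<alpha>) * Fbar x"
        using Y0 \<epsilon>(1) Vt that Vint by (intro large_part_bound_upper[OF x0]) auto
      also have "\<dots> \<le> C * (\<epsilon> + \<epsilon>) * Fbar x"
        using A(1) C Fbar_nonneg unfolding Vp by (intro mult_right_mono mult_left_mono) auto
      finally show ?thesis by simp
    qed
    have "breiman M ?B"
      by (rule breiman_bounded[OF M, where c="\<kappa> * A"]) (use Y0 A' in \<open>auto simp: indicator_def\<close>)
    then have Bint: "integrable M (\<lambda>\<omega>. ?B \<omega> powr \<alpha>)" and
      "((\<lambda>x. mean_scaled M Fbar ?B x / Fbar x) \<longlongrightarrow> moment M ?B \<alpha>) at_top"
      by (auto simp: breiman_def)
    then have "\<forall>\<^sub>F x in at_top. dist (mean_scaled M Fbar ?B x / Fbar x) (moment M ?B \<alpha>) < \<epsilon>"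
      using \<epsilon>(1) by (intro tendstoD)
    then show "\<forall>\<^sub>F x in at_top. dist (mean_scaled M Fbar Y x / Fbar x - moment M Y \<alpha>) 0 < e"
      using eventually_ge_at_top[of x0]
    proof eventually_elim
      fix x assume lim: "dist (mean_scaled M Fbar ?B x / Fbar x) (moment M ?B \<alpha>) < \<epsilon>"
        and x: "x0 \<le> x"
      let ?L = "\<integral>\<omega>. (if \<kappa> * A < Y \<omega> then Fbar (x / Y \<omega>) else 0) \<partial>M"
      have Lint: "integrable M (\<lambda>\<omega>. if \<kappa> * A < Y \<omega> then Fbar (x / Y \<omega>) else 0)"
        by (rule M.integrable_const_bound[where B=1]) (use Fbar_le_1 Fbar_nonneg in auto)
      have "mean_scaled M Fbar Y x
          = (\<integral>\<omega>. scaled Fbar x (?B \<omega>) + (if \<kappa> * A < Y \<omega> then Fbar (x / Y \<omega>) else 0) \<partial>M)"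
        using A' by (intro Bochner_Integration.integral_cong) (auto simp: indicator_def scaled_def)
      also have "\<dots> = mean_scaled M Fbar ?B x + ?L"
        by (intro Bochner_Integration.integral_add Lint scaled_Fbar_integrable M) auto
      finally have 1: "mean_scaled M Fbar Y x / Fbar x = mean_scaled M Fbar ?B x / Fbar x + ?L / Fbar x"
        by (simp add: add_divide_distrib)
      have 2: "?L / Fbar x \<le> 2 * C * \<epsilon>" using large[OF x] Fbar_pos[of x] by (simp add: field_simps)
      have 3: "0 \<le> ?L / Fbar x" using Fbar_nonneg by (intro divide_nonneg_nonneg Bochner_Integration.integral_nonneg) auto
      have 4: "moment M ?B \<alpha> \<le> moment M Y \<alpha>"
        using Bint Yint by (intro integral_mono) (auto simp: indicator_def)
      have "moment M Y \<alpha> \<le> (\<integral>\<omega>. ?B \<omega> powr \<alpha> + ?V \<omega> powr \<alpha> \<partial>M)"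
        using Bint Vint Yint A' by (intro integral_mono) (auto simp: indicator_def dest: A'')
      also have "\<dots> = moment M ?B \<alpha> + moment M ?V \<alpha>"
        using Bint Vint by simp
      finally have 5: "moment M Y \<alpha> \<le> moment M ?B \<alpha> + \<epsilon>" using A(1) unfolding Vp by simp
      show "dist (mean_scaled M Fbar Y x / Fbar x - moment M Y \<alpha>) 0 < e"
        using lim 1 2 3 4 5 \<epsilon>(2) unfolding dist_real_def by linarith
    qed
  qed
  from LIM_zero_cancel[OF this] Y0 Yint show ?thesis unfolding breiman_def by auto
qed

lemma power_bound:
  assumes q: "0 \<le> q" "q < \<alpha>"
  obtains C where "1 \<le> C" "\<And>t. 0 < t \<Longrightarrow> Fbar t \<le> C * t powr (- q)"
proof -
  obtain C t0 where C: "1 \<le> C" "0 < t0"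
    "\<And>l t. 1 \<le> l \<Longrightarrow> t0 \<le> t \<Longrightarrow> Fbar (l * t) \<le> C * l powr (- q) * Fbar t"
    using potter_upper[OF q(2,1)] by metis
  have "Fbar t \<le> max 1 (C * t0 powr q) * t powr (- q)" if t: "0 < t" for t
  proof (cases "t0 \<le> t")
    case True
    have "Fbar t = Fbar (t / t0 * t0)" using C(2) by simp
    also have "\<dots> \<le> C * (t / t0) powr (- q) * Fbar t0" using True C(2) by (intro C(3)) auto
    also have "\<dots> \<le> C * (t / t0) powr (- q) * 1" using C(1) Fbar_le_1 by (intro mult_left_mono) auto
    also have "\<dots> = C * t0 powr q * t powr (- q)" using t C(2) by (simp add: powr_divide powr_minus field_simps)
    also have "\<dots> \<le> max 1 (C * t0 powr q) * t powr (- q)" by (intro mult_right_mono) auto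
    finally show ?thesis .
  next
    case False
    have "t0 powr (- q) \<le> t powr (- q)" using False t q by (intro powr_mono2') auto
    then have "1 \<le> t0 powr q * t powr (- q)" using C(2) by (simp add: powr_minus field_simps)
    also have "\<dots> \<le> C * (t0 powr q * t powr (-q))" using C(1) mult_right_mono[of 1 C "t0 powr q * t powr (-q)"] by simp
    also have "\<dots> \<le> max 1 (C * t0 powr q) * t powr (- q)"
      unfolding mult.assoc[symmetric] by (intro mult_right_mono) auto
    finally show ?thesis using Fbar_le_1[of t] by linarith
  qed
  then show ?thesis by (intro that[of "max 1 (C * t0 powr q)"]) auto
qed

text \<open>The estimate behind the summability conditions.  For large \<open>u\<close> the values of \<open>V\<close> above a fixed level
are handled by \<open>controls\<close> and those below it by Potter's bound, which produces the moment of order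
\<open>q\<close>; for small \<open>u\<close> the power bound on the tail suffices, at the price of the factor
\<open>u powr (- q)\<close>.  Along the products of weights all three quantities in the bracket will have summable roots.\<close>

lemma controls_uniform_bound:
  assumes M: "prob_space M" and con: "controls M h" and q: "0 \<le> q" "q < \<alpha>"
  obtains C where "0 \<le> C" "\<And>V c u. V \<in> borel_measurable M \<Longrightarrow> (\<forall>\<omega>\<in>space M. 0 \<le> V \<omega>) \<Longrightarrow>
     integrable M (\<lambda>\<omega>. V \<omega> powr \<alpha>) \<Longrightarrow> 0 \<le> c \<Longrightarrow>
     (\<And>t. A \<le> t \<Longrightarrow> \<P>(\<omega> in M. V \<omega> > t) \<le> c * h t) \<Longrightarrow> 0 < u \<Longrightarrow>
     (mean_scaled M Fbar V u)
       \<le> C * (c + moment M V \<alpha> + moment M V q) * (Fbar u * max 1 (u powr (- q)))"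
proof -
  interpret M: prob_space M by fact
  obtain C \<kappa> A0 where C: "0 \<le> C" and \<kappa>: "1 \<le> \<kappa>" and A0: "1 \<le> A0" and
    ctl: "\<And>A. A0 \<le> A \<Longrightarrow> \<exists>x0. large_part_bound M h C \<kappa> A x0"
    using con unfolding controls_def by blast
  define A' where "A' = max A0 A"
  define B where "B = \<kappa> * A'"
  have B: "1 \<le> B" unfolding B_def A'_def using \<kappa> A0 mult_mono[of 1 \<kappa> 1 "max A0 A"] by auto
  obtain x0 where x0: "large_part_bound M h C \<kappa> A' x0" using ctl[of A'] unfolding A'_def by auto
  obtain C1 t0 where C1: "1 \<le> C1" "0 < t0"
    "\<And>l t. 1 \<le> l \<Longrightarrow> t0 \<le> t \<Longrightarrow> Fbar (l * t) \<le> C1 * l powr (- q) * Fbar t"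
    using potter_upper[OF q(2,1)] by metis
  obtain C2 where C2: "1 \<le> C2" "\<And>t. 0 < t \<Longrightarrow> Fbar t \<le> C2 * t powr (- q)"
    using power_bound[OF q] by metis
  obtain D where D: "1 \<le> D" "\<And>t. 0 \<le> t \<Longrightarrow> Fbar t \<le> D * Fbar (B * t)"
    using Fbar_bounded_ratio[OF B] by blast
  define x1 where "x1 = max x0 (B * t0)"
  obtain D2 where D2: "1 \<le> D2" "\<And>t. t \<le> x1 \<Longrightarrow> 1 \<le> D2 * Fbar t" using Fbar_bounded_below[of x1] by blast
  define K where "K = max (max C (C1 * D)) (C2 * D2)"
  have K: "C \<le> K" "C1 * D \<le> K" "C2 * D2 \<le> K" "0 \<le> K" unfolding K_def using C by auto
  show ?thesis
  proof (rule that[of K])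
    show "0 \<le> K" by fact
    fix V :: "'a \<Rightarrow> real" and c u :: real
    assume V[measurable]: "V \<in> borel_measurable M" and V0: "\<forall>\<omega>\<in>space M. 0 \<le> V \<omega>"
      and Vint: "integrable M (\<lambda>\<omega>. V \<omega> powr \<alpha>)" and c: "0 \<le> c"
      and Vt: "\<And>t. A \<le> t \<Longrightarrow> \<P>(\<omega> in M. V \<omega> > t) \<le> c * h t" and u: "0 < u"
    let ?E = "\<integral>\<omega>. V \<omega> powr \<alpha> \<partial>M" and ?Q = "\<integral>\<omega>. V \<omega> powr q \<partial>M"
    have E0: "0 \<le> ?E" "0 \<le> ?Q" by (auto intro: Bochner_Integration.integral_nonneg)
    have Qint: "integrable M (\<lambda>\<omega>. V \<omega> powr q)"
      using V0 q by (intro integrable_lower_powr[OF M V _ Vint]) auto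
    have base: "Fbar u \<le> Fbar u * max 1 (u powr (-q))"
      using mult_left_mono[of 1 "max 1 (u powr (-q))", OF _ Fbar_nonneg[of u]] by simp
    show "(mean_scaled M Fbar V u) \<le> K * (c + ?E + ?Q) * (Fbar u * max 1 (u powr (- q)))"
    proof (cases "x1 \<le> u")
      case True
      have Lint: "integrable M (\<lambda>\<omega>. if B < V \<omega> then Fbar (u / V \<omega>) else 0)"
        by (rule M.integrable_const_bound[where B=1]) (use Fbar_le_1 Fbar_nonneg in auto)
      have "(mean_scaled M Fbar V u)
          \<le> (\<integral>\<omega>. C1 * D * Fbar u * V \<omega> powr q + (if B < V \<omega> then Fbar (u / V \<omega>) else 0) \<partial>M)"
      proof (rule integral_mono)
        fix \<omega> assume \<omega>: "\<omega> \<in> space M"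
        have pos: "0 \<le> C1 * D * Fbar u * V \<omega> powr q" using C1 D Fbar_nonneg by auto
        consider "V \<omega> = 0" | "B < V \<omega>" | "0 < V \<omega>" "V \<omega> \<le> B" using V0 \<omega> by fastforce
        then show "scaled Fbar u (V \<omega>) \<le> C1 * D * Fbar u * V \<omega> powr q + (if B < V \<omega> then Fbar (u / V \<omega>) else 0)"
        proof cases
          case 3
          have ut: "t0 \<le> u / B" using True B unfolding x1_def by (simp add: field_simps)
          have "Fbar (u / V \<omega>) = Fbar (B / V \<omega> * (u / B))" using B by simp
          also have "\<dots> \<le> C1 * (B / V \<omega>) powr (- q) * Fbar (u / B)" using 3 ut by (intro C1(3)) auto
          also have "\<dots> \<le> C1 * (B / V \<omega>) powr (- q) * (D * Fbar (B * (u / B)))"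
            using B u C1 by (intro mult_left_mono D) auto
          also have "\<dots> = C1 * D * Fbar u * ((B / V \<omega>) powr (- q))" using B by simp
          also have "(B / V \<omega>) powr (- q) = B powr (-q) * V \<omega> powr q"
            using B 3 by (simp add: powr_divide powr_minus field_simps)
          also have "C1 * D * Fbar u * (B powr (-q) * V \<omega> powr q) \<le> C1 * D * Fbar u * (1 * V \<omega> powr q)"
            using B q C1 D Fbar_nonneg
            by (intro mult_left_mono mult_right_mono) (auto simp: ge_one_powr_ge_zero powr_minus_divide)
          finally show ?thesis using 3 by (simp add: scaled_def)
        qed (use pos B Fbar_nonneg in \<open>auto simp: scaled_def\<close>)
      qed (use Lint Qint scaled_Fbar_integrable[OF M V] in auto)
      also have "\<dots> = C1 * D * Fbar u * ?Q + (\<integral>\<omega>. (if B < V \<omega> then Fbar (u / V \<omega>) else 0) \<partial>M)"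
        using Lint Qint by simp
      also have "\<dots> \<le> C1 * D * Fbar u * ?Q + C * (c + ?E) * Fbar u"
        using True V0 Vint c Vt unfolding x1_def B_def
        by (intro add_left_mono large_part_bound_upper[OF x0]) (auto simp: A'_def)
      also have "\<dots> = (C1 * D * ?Q + C * (c + ?E)) * Fbar u" by (simp add: algebra_simps)
      also have "\<dots> \<le> (K * ?Q + K * (c + ?E)) * Fbar u"
        using K E0 c Fbar_nonneg by (intro mult_right_mono add_mono) auto
      also have "\<dots> = K * (c + ?E + ?Q) * Fbar u" by (simp add: algebra_simps)
      also have "\<dots> \<le> K * (c + ?E + ?Q) * (Fbar u * max 1 (u powr (- q)))"
        using base K E0 c by (intro mult_left_mono) auto
      finally show ?thesis .
    next
      case False
      have "(mean_scaled M Fbar V u) \<le> (\<integral>\<omega>. C2 * u powr (-q) * V \<omega> powr q \<partial>M)"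
      proof (rule integral_mono)
        fix \<omega> assume \<omega>: "\<omega> \<in> space M"
        consider "V \<omega> = 0" | "0 < V \<omega>" using V0 \<omega> by fastforce
        then show "scaled Fbar u (V \<omega>) \<le> C2 * u powr (-q) * V \<omega> powr q"
        proof cases
          case 2
          have "Fbar (u / V \<omega>) \<le> C2 * (u / V \<omega>) powr (- q)" using 2 u by (intro C2) auto
          also have "\<dots> = C2 * u powr (-q) * V \<omega> powr q"
            using u 2 by (simp add: powr_divide powr_minus field_simps)
          finally show ?thesis using 2 by (simp add: scaled_def)
        qed (simp add: scaled_def)
      qed (use Qint scaled_Fbar_integrable[OF M V] in auto)
      also have "\<dots> = C2 * ?Q * (1 * u powr (-q))" using Qint by simp
      also have "\<dots> \<le> C2 * ?Q * (D2 * Fbar u * max 1 (u powr (-q)))"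
        using D2(2)[of u] False C2 E0 by (intro mult_left_mono mult_mono) auto
      also have "\<dots> = C2 * D2 * ?Q * (Fbar u * max 1 (u powr (-q)))" by simp
      also have "\<dots> \<le> K * (c + ?E + ?Q) * (Fbar u * max 1 (u powr (- q)))"
        using K E0 c Fbar_nonneg C2 D2 by (intro mult_right_mono mult_mono) auto
      finally show ?thesis .
    qed
  qed
qed

end

section \<open>The Denisov-Zwart conditions\<close>

text \<open>A function with a finite limit is bounded near infinity; this bound on the normalised convolution is
what controls large factors.\<close>

lemma class_Sd_convolution_bound:
  assumes "class_Sd f"
  obtains C s0 where "0 \<le> C"
    "\<And>s. s0 \<le> s \<Longrightarrow> (\<integral>\<^sup>+y\<in>{0..s}. ennreal (f (s - y) / f s * f y) \<partial>lborel) \<le> ennreal C"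
proof -
  define l where "l = 2 * (\<integral>\<^sup>+u\<in>{0..}. ennreal (f u) \<partial>lborel)"
  have l: "l < \<infinity>" and lim: "((\<lambda>x. \<integral>\<^sup>+y\<in>{0..x}. ennreal (f (x - y) / f x * f y) \<partial>lborel) \<longlongrightarrow> l) at_top"
    using assms unfolding class_Sd_def l_def by auto
  obtain r where r: "l = ennreal r" "0 \<le> r" using l by (cases l) auto
  have "\<forall>\<^sub>F x in at_top. (\<integral>\<^sup>+y\<in>{0..x}. ennreal (f (x - y) / f x * f y) \<partial>lborel) < ennreal (r + 1)"
    using lim r by (intro order_tendstoD(2)) (auto simp: ennreal_less_iff)
  then obtain s0 where "\<And>x. s0 \<le> x \<Longrightarrow> (\<integral>\<^sup>+y\<in>{0..x}. ennreal (f (x - y) / f x * f y) \<partial>lborel) < ennreal (r + 1)"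
    unfolding eventually_at_top_linorder by auto
  then show ?thesis using r by (intro that[of "r + 1" s0]) (auto intro: less_imp_le)
qed

lemma Limsup_SUP_bound:
  fixes L :: "real \<Rightarrow> real"
  assumes "Limsup at_top (\<lambda>x. SUP y\<in>I x. ereal (L y / L x)) < \<infinity>" and pos: "\<And>x. 0 < x \<Longrightarrow> 0 < L x"
  obtains C x0 where "1 \<le> C" "1 \<le> x0" "\<And>x y. x0 \<le> x \<Longrightarrow> y \<in> I x \<Longrightarrow> L y \<le> C * L x"
proof -
  obtain c where c: "Limsup at_top (\<lambda>x. SUP y\<in>I x. ereal (L y / L x)) < ereal c"
    using iffD1[OF less_PInf_Ex_of_nat, OF less_imp_neq[OF assms(1)]] by blast
  from Limsup_lessD[OF c] obtain x0 where
    x0: "\<And>x. x0 \<le> x \<Longrightarrow> (SUP y\<in>I x. ereal (L y / L x)) < ereal c"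
    unfolding eventually_at_top_linorder by auto
  show ?thesis
  proof (rule that[of "max 1 c" "max 1 x0"])
    fix x y assume x: "max 1 x0 \<le> x" and y: "y \<in> I x"
    have "ereal (L y / L x) \<le> (SUP y\<in>I x. ereal (L y / L x))" using y by (rule SUP_upper)
    also have "\<dots> < ereal c" using x by (intro x0) simp
    finally have "L y < c * L x" using pos[of x] x by (simp add: field_simps)
    also have "\<dots> \<le> max 1 c * L x" using pos[of x] x by (intro mult_right_mono) auto
    finally show "L y \<le> max 1 c * L x" by simp
  qed auto
qed

context rv_law begin

lemma slow_part_pos: "0 < x \<Longrightarrow> 0 < slow_part \<alpha> F x"
  unfolding slow_part_def using Fbar_pos by simp

lemma Fbar_slow_part: "0 < x \<Longrightarrow> Fbar x = x powr (-\<alpha>) * slow_part \<alpha> F x"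
  unfolding slow_part_def by (simp add: powr_minus field_simps)

lemma ratio_from_slow_part:
  assumes "0 < x" "0 < v" "slow_part \<alpha> F (x / v) \<le> C * slow_part \<alpha> F x"
  shows "Fbar (x / v) \<le> C * v powr \<alpha> * Fbar x"
proof -
  have "Fbar (x / v) = (x / v) powr (-\<alpha>) * slow_part \<alpha> F (x / v)"
    using assms by (intro Fbar_slow_part) auto
  also have "\<dots> \<le> (x / v) powr (-\<alpha>) * (C * slow_part \<alpha> F x)" using assms by (intro mult_left_mono) auto
  also have "(x / v) powr (-\<alpha>) = v powr \<alpha> * x powr (-\<alpha>)" using assms by (simp add: powr_divide powr_minus field_simps)
  also have "v powr \<alpha> * x powr (-\<alpha>) * (C * slow_part \<alpha> F x) = C * v powr \<alpha> * Fbar x"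
    using Fbar_slow_part[OF assms(1)] by simp
  finally show ?thesis .
qed

text \<open>Here \<open>P[X > x / v] \<le> C v\<^sup>\<alpha> P[X > x]\<close> holds pointwise: for \<open>v \<le> x\<close> this is the hypothesis, and for
\<open>v > x\<close> it follows since the slowly varying part is bounded away from zero.\<close>

lemma DZ1_controls:
  assumes M: "prob_space M" and DZ: "DZ1 \<alpha> F"
  shows "controls M (\<lambda>t. t powr (-\<alpha>))"
proof -
  interpret M: prob_space M by fact
  obtain C x0 where C: "1 \<le> C" "1 \<le> x0" and
    CL: "\<And>x y. x0 \<le> x \<Longrightarrow> y \<in> {1..x} \<Longrightarrow> slow_part \<alpha> F y \<le> C * slow_part \<alpha> F x"
    using Limsup_SUP_bound[OF DZ[unfolded DZ1_def] slow_part_pos] by blast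
  define K where "K = C / Fbar 1"
  have CK: "C \<le> K" unfolding K_def using C Fbar_pos[of 1] Fbar_le_1[of 1] by (simp add: field_simps mult_le_one)
  have key: "Fbar (x / v) \<le> K * v powr \<alpha> * Fbar x" if x: "x0 \<le> x" and v: "1 \<le> v" for x v
  proof (cases "v \<le> x")
    case True
    have "Fbar (x / v) \<le> C * v powr \<alpha> * Fbar x"
      using True v x C by (intro ratio_from_slow_part CL) (auto simp: field_simps mult_left_le)
    also have "\<dots> \<le> K * v powr \<alpha> * Fbar x" using CK Fbar_nonneg by (intro mult_right_mono) auto
    finally show ?thesis .
  next
    case False
    have x': "0 < x" using x C by simp
    have "Fbar 1 \<le> C * (x powr \<alpha> * Fbar x)" using CL[of x 1] x C unfolding slow_part_def by simp
    also have "\<dots> \<le> C * (v powr \<alpha> * Fbar x)"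
      using False C x' alpha_pos Fbar_nonneg by (intro mult_left_mono mult_right_mono powr_mono2) auto
    finally have "1 \<le> K * v powr \<alpha> * Fbar x" unfolding K_def using Fbar_pos[of 1] by (simp add: field_simps)
    then show ?thesis using Fbar_le_1[of "x / v"] by linarith
  qed
  show ?thesis unfolding controls_def
  proof (rule exI[of _ K], rule exI[of _ 1], rule exI[of _ 1], intro conjI allI impI)
    show "0 \<le> K" using C CK by simp
    fix A :: real assume A: "1 \<le> A"
    show "\<exists>x0. large_part_bound M (\<lambda>t. t powr (-\<alpha>)) K 1 A x0" unfolding large_part_bound_def
    proof (intro exI[of _ x0] allI impI)
      fix V :: "'a \<Rightarrow> real" and \<eta> x :: real
      assume V[measurable]: "V \<in> borel_measurable M" and Vint: "integrable M (\<lambda>\<omega>. V \<omega> powr \<alpha>)"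
        and \<eta>: "0 \<le> \<eta>" and x: "x0 \<le> x"
      have "large_part M V (1 * A) x \<le> (\<integral>\<omega>. K * V \<omega> powr \<alpha> * Fbar x \<partial>M)"
      proof (rule integral_mono)
        show "integrable M (\<lambda>\<omega>. if 1 * A < V \<omega> then Fbar (x / V \<omega>) else 0)"
          by (rule M.integrable_const_bound[where B=1]) (use Fbar_le_1 Fbar_nonneg in auto)
        show "(if 1 * A < V \<omega> then Fbar (x / V \<omega>) else 0) \<le> K * V \<omega> powr \<alpha> * Fbar x" for \<omega>
          using key[OF x, of "V \<omega>"] A CK C Fbar_nonneg by auto
      qed (use Vint in auto)
      also have "\<dots> = K * moment M V \<alpha> * Fbar x" using Vint by simp
      also have "\<dots> \<le> K * (\<eta> + moment M V \<alpha>) * Fbar x"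
        using \<eta> CK C Fbar_nonneg by (intro mult_right_mono mult_left_mono) auto
      finally show "large_part M V (1 * A) x \<le> K * (\<eta> + moment M V \<alpha>) * Fbar x" .
    qed
  qed auto
qed

text \<open>For \<open>V \<le> x\<close> one has \<open>P[X > x / V] \<le> D P[X > x exp (-y)]\<close> for every \<open>y\<close> in the interval of unit length
between \<open>ln V - 2\<close> and \<open>ln V - 1\<close>.  Averaging over this interval and exchanging the integrals replaces
the law of \<open>V\<close> by its tail at \<open>exp y\<close>, hence by \<open>\<eta> h (exp y)\<close>, and leaves the convolution integral
of the hypothesis.  The shift by one makes the event that \<open>y\<close> lies in the interval imply
\<open>V > exp y\<close>; the shift by two determines \<open>\<kappa> = exp 2\<close>.\<close>

lemma convolution_controls:
  fixes M :: "'b measure"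
  assumes M: "prob_space M" and h[measurable]: "h \<in> borel_measurable borel" and h0: "\<And>t. 0 \<le> h t"
    and C2: "0 \<le> C2" and conv: "\<And>x. x1 \<le> x \<Longrightarrow>
      (\<integral>\<^sup>+y\<in>{0..ln x}. ennreal (Fbar (x * exp (- y)) * h (exp y)) \<partial>lborel) \<le> ennreal (C2 * Fbar x)"
    and C3: "0 \<le> C3" and hF: "\<And>x. x1 \<le> x \<Longrightarrow> h x \<le> C3 * Fbar x"
  shows "controls M h"
proof -
  interpret M: prob_space M by fact
  interpret P: pair_sigma_finite M lborel ..
  obtain D where D: "1 \<le> D" "\<And>t. 0 \<le> t \<Longrightarrow> Fbar t \<le> D * Fbar (exp 2 * t)"
    using Fbar_bounded_ratio[of "exp 2"] by (metis one_le_exp_iff zero_le_numeral)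
  define C where "C = C3 + D * C2"
  have C: "0 \<le> C" unfolding C_def using C3 C2 D by simp
  show ?thesis unfolding controls_def
  proof (rule exI[of _ C], rule exI[of _ "exp 2"], rule exI[of _ 1], intro conjI allI impI)
    fix A :: real assume A: "1 \<le> A"
    show "\<exists>x0. large_part_bound M h C (exp 2) A x0" unfolding large_part_bound_def
    proof (intro exI[of _ "max x1 A"] allI impI)
      fix V :: "'b \<Rightarrow> real" and \<eta> x :: real
      assume V[measurable]: "V \<in> borel_measurable M" and V0: "\<forall>\<omega>\<in>space M. 0 \<le> V \<omega>"
        and \<eta>: "0 \<le> \<eta>" and Vt: "\<forall>t\<ge>A. \<P>(\<omega> in M. V \<omega> > t) \<le> \<eta> * h t" and x: "max x1 A \<le> x"
      have x': "0 < x" "A \<le> x" "x1 \<le> x" using x A by auto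
      let ?f = "\<lambda>\<omega>. if exp 2 * A < V \<omega> then Fbar (x / V \<omega>) else 0"
      define \<psi> where "\<psi> = (\<lambda>z. ennreal (indicator {ln A..ln x} (snd z) *
        ((if exp (snd z) < V (fst z) then 1 else 0) * Fbar (x * exp (- snd z)))))"
      have \<psi>m: "\<psi> \<in> borel_measurable (M \<Otimes>\<^sub>M lborel)" unfolding \<psi>_def by measurable
      have pt: "ennreal (?f \<omega>) \<le> ennreal D * (\<integral>\<^sup>+y. \<psi> (\<omega>, y) \<partial>lborel) + indicator {\<omega> \<in> space M. V \<omega> > x} \<omega>"
        if \<omega>: "\<omega> \<in> space M" for \<omega>
      proof (cases "exp 2 * A < V \<omega> \<and> V \<omega> \<le> x")
        case True
        have "0 \<le> exp 2 * A" using A by simp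
        then have Vp: "0 < V \<omega>" using True by linarith
        have "ln (exp 2 * A) \<le> ln (V \<omega>)" using True A Vp by (subst ln_le_cancel_iff) auto
        then have l1: "ln A \<le> ln (V \<omega>) - 2" using A by (simp add: ln_mult)
        have l2: "ln (V \<omega>) \<le> ln x" using True Vp x' by simp
        have "ennreal (Fbar (x / V \<omega>)) = (\<integral>\<^sup>+y. ennreal (Fbar (x / V \<omega>)) * indicator {ln (V \<omega>) - 2..ln (V \<omega>) - 1} y \<partial>lborel)"
          by (subst nn_integral_cmult_indicator) auto
        also have "\<dots> \<le> (\<integral>\<^sup>+y. ennreal D * \<psi> (\<omega>, y) \<partial>lborel)"
        proof (rule nn_integral_mono)
          fix y :: real
          show "ennreal (Fbar (x / V \<omega>)) * indicator {ln (V \<omega>) - 2..ln (V \<omega>) - 1} y \<le> ennreal D * \<psi> (\<omega>, y)"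
          proof (cases "y \<in> {ln (V \<omega>) - 2..ln (V \<omega>) - 1}")
            case y: True
            have "exp y < exp (ln (V \<omega>))" using y by (subst exp_less_cancel_iff) auto
            then have e1: "exp y < V \<omega>" using Vp by simp
            have "exp (- y) \<le> exp (2 - ln (V \<omega>))" using y by simp
            also have "\<dots> = exp 2 / V \<omega>" using Vp by (simp add: exp_diff)
            finally have e2: "x * exp (- y) \<le> exp 2 * (x / V \<omega>)" using x' mult_left_mono[of "exp (-y)" "exp 2 / V \<omega>" x] by (simp add: mult_ac)
            have "Fbar (x / V \<omega>) \<le> D * Fbar (exp 2 * (x / V \<omega>))" using x' Vp by (intro D) auto
            also have "\<dots> \<le> D * Fbar (x * exp (- y))" using D e2 by (intro mult_left_mono Fbar_mono) auto
            finally have "Fbar (x / V \<omega>) \<le> D * Fbar (x * exp (- y))" .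
            then show ?thesis using y l1 l2 e1 D Fbar_nonneg
              by (simp add: ennreal_mult'[symmetric] ennreal_leI \<psi>_def)
          qed simp
        qed
        also have "\<dots> = ennreal D * (\<integral>\<^sup>+y. \<psi> (\<omega>, y) \<partial>lborel)"
        proof (rule nn_integral_cmult)
          show "(\<lambda>y. \<psi> (\<omega>, y)) \<in> borel_measurable lborel"
            using measurable_compose[OF measurable_Pair1'[OF \<omega>] \<psi>m] .
        qed
        finally show ?thesis using True by (simp add: add_increasing2)
      next
        case False
        show ?thesis
        proof (cases "exp 2 * A < V \<omega>")
          case True
          then have "V \<omega> > x" using False by simp
          then show ?thesis using \<omega> True Fbar_le_1[of "x / V \<omega>"] by (simp add: add_increasing)
        qed simp
      qed
      have fint: "integrable M ?f"
        by (rule M.integrable_const_bound[where B=1]) (use Fbar_le_1 Fbar_nonneg in auto)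
      have "ennreal (\<integral>\<omega>. ?f \<omega> \<partial>M) = (\<integral>\<^sup>+\<omega>. ennreal (?f \<omega>) \<partial>M)"
        using Fbar_nonneg by (intro nn_integral_eq_integral[symmetric] fint) auto
      also have "\<dots> \<le> (\<integral>\<^sup>+\<omega>. ennreal D * (\<integral>\<^sup>+y. \<psi> (\<omega>, y) \<partial>lborel) + indicator {\<omega> \<in> space M. V \<omega> > x} \<omega> \<partial>M)"
        by (rule nn_integral_mono) (rule pt)
      also have "\<dots> = ennreal D * (\<integral>\<^sup>+\<omega>. (\<integral>\<^sup>+y. \<psi> (\<omega>, y) \<partial>lborel) \<partial>M) + emeasure M {\<omega> \<in> space M. V \<omega> > x}"
        using lborel.borel_measurable_nn_integral_fst[OF \<psi>m]
        by (subst nn_integral_add) (auto simp: nn_integral_cmult)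
      also have "(\<integral>\<^sup>+\<omega>. (\<integral>\<^sup>+y. \<psi> (\<omega>, y) \<partial>lborel) \<partial>M) = (\<integral>\<^sup>+y. (\<integral>\<^sup>+\<omega>. \<psi> (\<omega>, y) \<partial>M) \<partial>lborel)"
        by (rule P.Fubini[OF \<psi>m, symmetric])
      also have "\<dots> \<le> (\<integral>\<^sup>+y. ennreal \<eta> * (ennreal (Fbar (x * exp (- y)) * h (exp y)) * indicator {0..ln x} y) \<partial>lborel)"
      proof (rule nn_integral_mono)
        fix y :: real
        show "(\<integral>\<^sup>+\<omega>. \<psi> (\<omega>, y) \<partial>M) \<le> ennreal \<eta> * (ennreal (Fbar (x * exp (- y)) * h (exp y)) * indicator {0..ln x} y)"
        proof (cases "y \<in> {ln A..ln x}")
          case True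
          have "exp (ln A) \<le> exp y" using True by (subst exp_le_cancel_iff) auto
          then have Ay: "A \<le> exp y" using A by simp
          have y0: "0 \<le> y" using True ln_ge_zero[OF A] by simp
          have "(\<integral>\<^sup>+\<omega>. \<psi> (\<omega>, y) \<partial>M) = (\<integral>\<^sup>+\<omega>. ennreal (Fbar (x * exp (- y))) * indicator {\<omega> \<in> space M. V \<omega> > exp y} \<omega> \<partial>M)"
            using True by (intro nn_integral_cong) (auto simp: indicator_def \<psi>_def)
          also have "\<dots> = ennreal (Fbar (x * exp (- y))) * emeasure M {\<omega> \<in> space M. V \<omega> > exp y}"
            by (rule nn_integral_cmult_indicator) auto
          also have "\<dots> = ennreal (Fbar (x * exp (- y)) * \<P>(\<omega> in M. V \<omega> > exp y))"
            by (simp add: M.emeasure_eq_measure ennreal_mult Fbar_nonneg)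
          also have "\<dots> \<le> ennreal (Fbar (x * exp (- y)) * (\<eta> * h (exp y)))"
            using Vt Ay Fbar_nonneg by (intro ennreal_leI mult_left_mono) auto
          also have "\<dots> = ennreal \<eta> * (ennreal (Fbar (x * exp (- y)) * h (exp y)) * indicator {0..ln x} y)"
            using True y0 \<eta> h0 Fbar_nonneg by (simp add: ennreal_mult[symmetric] mult_ac)
          finally show ?thesis .
        qed (simp add: \<psi>_def)
      qed
      also have "\<dots> \<le> ennreal \<eta> * ennreal (C2 * Fbar x)"
      proof -
        have "(\<integral>\<^sup>+y. ennreal \<eta> * (ennreal (Fbar (x * exp (- y)) * h (exp y)) * indicator {0..ln x} y) \<partial>lborel)
          = ennreal \<eta> * (\<integral>\<^sup>+y\<in>{0..ln x}. ennreal (Fbar (x * exp (- y)) * h (exp y)) \<partial>lborel)"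
          by (rule nn_integral_cmult) measurable
        also have "\<dots> \<le> ennreal \<eta> * ennreal (C2 * Fbar x)" using conv[OF x'(3)] by (intro mult_left_mono) auto
        finally show ?thesis .
      qed
      also have "emeasure M {\<omega> \<in> space M. V \<omega> > x} \<le> ennreal (\<eta> * (C3 * Fbar x))"
      proof -
        have "\<P>(\<omega> in M. V \<omega> > x) \<le> \<eta> * h x" using Vt x' by auto
        also have "\<dots> \<le> \<eta> * (C3 * Fbar x)" using \<eta> hF x' by (intro mult_left_mono) auto
        finally show ?thesis by (simp add: M.emeasure_eq_measure ennreal_leI)
      qed
      finally have "ennreal (\<integral>\<omega>. ?f \<omega> \<partial>M) \<le> ennreal D * (ennreal \<eta> * ennreal (C2 * Fbar x)) + ennreal (\<eta> * (C3 * Fbar x))"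
        by (simp add: mult_left_mono add_mono)
      also have "\<dots> = ennreal (C * \<eta> * Fbar x)"
        using \<eta> C2 C3 D Fbar_nonneg by (simp add: ennreal_mult[symmetric] ennreal_plus[symmetric] C_def algebra_simps del: ennreal_plus)
      finally have "(\<integral>\<omega>. ?f \<omega> \<partial>M) \<le> C * \<eta> * Fbar x"
        using C \<eta> Fbar_nonneg by (subst (asm) ennreal_le_iff) auto
      also have "\<dots> \<le> C * (\<eta> + moment M V \<alpha>) * Fbar x"
        using C Fbar_nonneg by (intro mult_right_mono mult_left_mono) (auto intro: Bochner_Integration.integral_nonneg)
      finally show "(\<integral>\<omega>. ?f \<omega> \<partial>M) \<le> C * (\<eta> + moment M V \<alpha>) * Fbar x" .
    qed
  qed (use C in auto)
qed

text \<open>In logarithmic coordinates the convolution of the tail with itself is the one that defines the class,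
up to the common factor \<open>x powr (- \<alpha>)\<close>.\<close>

lemma DZ2_controls:
  assumes M: "prob_space M" and DZ: "DZ2 \<alpha> F"
  shows "controls M Fbar"
proof -
  let ?f = "\<lambda>x. slow_part \<alpha> F (exp x)"
  have Sd: "class_Sd ?f" using DZ unfolding DZ2_def by simp
  obtain C s0 where C: "0 \<le> C"
    "\<And>s. s0 \<le> s \<Longrightarrow> (\<integral>\<^sup>+y\<in>{0..s}. ennreal (?f (s - y) / ?f s * ?f y) \<partial>lborel) \<le> ennreal C"
    using class_Sd_convolution_bound[OF Sd] by blast
  show ?thesis
  proof (rule convolution_controls[OF M Fbar_borel Fbar_nonneg C(1), where ?x1.0="exp s0" and ?C3.0=1])
    fix x assume x: "exp s0 \<le> x"
    have x0: "0 < x" using x exp_gt_zero[of s0] by linarith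
    have s: "s0 \<le> ln x" using x x0 by (subst ln_ge_iff) auto
    have eq: "Fbar (x * exp (- y)) * Fbar (exp y) = Fbar x * (?f (ln x - y) / ?f (ln x) * ?f y)" for y
    proof -
      have e: "exp (ln x - y) = x * exp (- y)" using x0 by (simp add: exp_diff exp_minus divide_inverse)
      have "x * exp (- y) * exp y = x" by (simp add: exp_minus)
      then have "x powr \<alpha> = (x * exp (- y) * exp y) powr \<alpha>" by (simp only:)
      also have "\<dots> = (x * exp (- y)) powr \<alpha> * exp y powr \<alpha>"
        using x0 by (subst powr_mult) auto
      finally have "x powr \<alpha> = (x * exp (- y)) powr \<alpha> * exp y powr \<alpha>" .
      then show ?thesis unfolding slow_part_def e using x0 by (simp add: field_simps)
    qed
    have "(\<integral>\<^sup>+y\<in>{0..ln x}. ennreal (Fbar (x * exp (- y)) * Fbar (exp y)) \<partial>lborel)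
      = (\<integral>\<^sup>+y. ennreal (Fbar x) * (ennreal (?f (ln x - y) / ?f (ln x) * ?f y) * indicator {0..ln x} y) \<partial>lborel)"
      unfolding eq ennreal_mult'[OF Fbar_nonneg] by (simp only: mult.assoc)
    also have "\<dots> = ennreal (Fbar x) * (\<integral>\<^sup>+y\<in>{0..ln x}. ennreal (?f (ln x - y) / ?f (ln x) * ?f y) \<partial>lborel)"
      unfolding slow_part_def by (rule nn_integral_cmult) measurable
    also have "\<dots> \<le> ennreal (Fbar x) * ennreal C" by (intro mult_left_mono C(2) s) auto
    also have "\<dots> = ennreal (C * Fbar x)" using C Fbar_nonneg by (simp add: ennreal_mult[symmetric] mult.commute)
    finally show "(\<integral>\<^sup>+y\<in>{0..ln x}. ennreal (Fbar (x * exp (- y)) * Fbar (exp y)) \<partial>lborel) \<le> ennreal (C * Fbar x)" .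
  qed auto
qed

lemma long_tailed_pos:
  assumes U: "real_distribution U" "long_tailed U"
  shows "antimono (tail U)" "0 < tail U x" "tail U x \<le> 1"
proof -
  interpret U: real_distribution U by fact
  show am: "antimono (tail U)" unfolding tail_def by (intro antimonoI U.finite_measure_mono) auto
  show "tail U x \<le> 1" unfolding tail_def by simp
  have "((\<lambda>x. tail U x / tail U x) \<longlongrightarrow> 1) at_top"
    using U(2)[unfolded long_tailed_def tail_equiv_def, rule_format, of 0] by simp
  then have "\<forall>\<^sub>F t in at_top. 0 < tail U t / tail U t" by (rule order_tendstoD) simp
  then have "\<forall>\<^sub>F t in at_top. 0 < tail U t"
    by eventually_elim (auto simp: tail_def zero_less_measure_iff split: if_splits)
  then obtain t where "x \<le> t" "0 < tail U t"
    using eventually_happens'[OF trivial_limit_at_top_linorder eventually_conj[OF eventually_ge_at_top[of x]]] by blast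
  then show "0 < tail U x" using antimonoD[OF am, of x t] by linarith
qed

text \<open>Both types are handled together by letting \<open>v\<close> be constant in the first one.\<close>

lemma type_iii_or_iv_common:
  assumes "type_iii_or_iv L U"
  shows "real_distribution U" "long_tailed U" "\<exists>c0 c v. 0 < c0 \<and> (c \<longlongrightarrow> c0) at_top \<and> antimono v \<and>
    (\<forall>s::real. 0 < v s \<and> v s \<le> (1::real)) \<and> (\<forall>x>0. L x = c x * tail U (ln x) / v (ln x))"
proof -
  show U: "real_distribution U" "long_tailed U"
    using assms unfolding type_iii_or_iv_def type_iii_def type_iv_def by auto
  consider "type_iii L U" | V where "type_iv L U V" using assms unfolding type_iii_or_iv_def by auto
  then show "\<exists>c0 c v. 0 < c0 \<and> (c \<longlongrightarrow> c0) at_top \<and> antimono v \<and>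
    (\<forall>s::real. 0 < v s \<and> v s \<le> (1::real)) \<and> (\<forall>x>0. L x = c x * tail U (ln x) / v (ln x))"
  proof cases
    case 1
    then obtain c c0 where "0 < c0" "(c \<longlongrightarrow> c0) at_top" "\<forall>x>0. L x = c x * tail U (ln x)"
      unfolding type_iii_def by auto
    then show ?thesis by (intro exI[of _ c0] exI[of _ c] exI[of _ "\<lambda>_. 1"]) (auto simp: monotone_on_def)
  next
    case (2 V)
    then obtain c c0 where *: "0 < c0" "(c \<longlongrightarrow> c0) at_top"
      "\<forall>x>0. L x = c x * tail U (ln x) / tail V (ln x)" unfolding type_iv_def by auto
    have "real_distribution V" "long_tailed V" using 2 unfolding type_iv_def by auto
    from long_tailed_pos[OF this] * show ?thesis
      by (intro exI[of _ c0] exI[of _ c] exI[of _ "tail V"]) auto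
  qed
qed

text \<open>The denominator \<open>v\<close> is nonincreasing, so inside the convolution it may be replaced by its value at
the endpoint \<open>ln x\<close> and be taken out.  What remains is the convolution of the tail of \<open>U\<close> with itself.\<close>

lemma DZ3_controls:
  assumes M: "prob_space M" and DZ: "DZ3 \<alpha> F G U"
  shows "controls M (\<lambda>t. t powr (-\<alpha>) * tail U (ln t))"
proof -
  have ty: "type_iii_or_iv (slow_part \<alpha> F) U" and Sd: "class_Sd (tail U)"
    using DZ unfolding DZ3_def class_S_star_def by auto
  obtain c0 c v where U: "real_distribution U" "long_tailed U" and c0: "0 < c0" "(c \<longlongrightarrow> c0) at_top"
    and v: "antimono v" "\<And>s::real. 0 < v s" "\<And>s. v s \<le> (1::real)"
    and L: "\<And>x. 0 < x \<Longrightarrow> slow_part \<alpha> F x = c x * tail U (ln x) / v (ln x)"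
    using type_iii_or_iv_common[OF ty] by auto
  note Upos = long_tailed_pos[OF U]
  have [measurable]: "tail U \<in> borel_measurable borel" by (rule antimono_borel[OF Upos(1)])
  obtain C s0 where C: "0 \<le> C"
    "\<And>s. s0 \<le> s \<Longrightarrow> (\<integral>\<^sup>+y\<in>{0..s}. ennreal (tail U (s - y) / tail U s * tail U y) \<partial>lborel) \<le> ennreal C"
    using class_Sd_convolution_bound[OF Sd] by blast
  have "\<forall>\<^sub>F x in at_top. c0 / 2 < c x \<and> c x < 2 * c0"
    using c0 by (intro eventually_conj order_tendstoD[OF c0(2)]) auto
  then obtain T' where T': "\<And>x. T' \<le> x \<Longrightarrow> c0 / 2 < c x \<and> c x < 2 * c0"
    unfolding eventually_at_top_linorder by auto
  define T where "T = max 1 T'"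
  have T: "1 \<le> T" "\<And>x. T \<le> x \<Longrightarrow> c0 / 2 < c x" "\<And>x. T \<le> x \<Longrightarrow> c x < 2 * c0"
    using T' unfolding T_def by auto
  define C1 where "C1 = max (2 * c0) (T powr \<alpha> / tail U (ln T))"
  have C1: "0 < C1" unfolding C1_def using c0 by simp
  \<comment> \<open>Below \<open>T\<close> nothing is known about \<open>c\<close>, but there it is a quotient of bounded positive functions.\<close>
  have c_bd: "c t \<le> C1" if t: "1 \<le> t" for t
  proof (cases "T \<le> t")
    case True then show ?thesis using T(3)[OF True] unfolding C1_def by simp
  next
    case False
    have "c t = t powr \<alpha> * Fbar t * v (ln t) / tail U (ln t)"
      using L[of t] t Upos(2)[of "ln t"] v(2)[of "ln t"] by (simp add: slow_part_def field_simps)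
    also have "\<dots> \<le> T powr \<alpha> * 1 * 1 / tail U (ln T)"
    proof (intro frac_le mult_mono)
      show "t powr \<alpha> \<le> T powr \<alpha>" using False t alpha_pos by (intro powr_mono2) auto
      show "tail U (ln T) \<le> tail U (ln t)" using False t T by (intro antimonoD[OF Upos(1)]) auto
    qed (use v Fbar_le_1 Fbar_nonneg Upos in \<open>auto intro: less_imp_le\<close>)
    finally show ?thesis unfolding C1_def by simp
  qed
  have lower: "x powr (-\<alpha>) * (tail U (ln x) / v (ln x)) \<le> 2 / c0 * Fbar x" if x: "T \<le> x" for x
  proof -
    have x0: "0 < x" using x T by simp
    have "c0 / 2 * (tail U (ln x) / v (ln x)) \<le> c x * (tail U (ln x) / v (ln x))"
      using T(2)[OF x] Upos v by (intro mult_right_mono) (auto intro: less_imp_le)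
    also have "\<dots> = slow_part \<alpha> F x" using L[OF x0] by simp
    finally have "c0 / 2 * (tail U (ln x) / v (ln x)) \<le> slow_part \<alpha> F x" .
    moreover have "w \<le> 2 / c0 * b" if "c0 / 2 * w \<le> b" for w b using that c0(1) by (simp add: field_simps)
    ultimately have "tail U (ln x) / v (ln x) \<le> 2 / c0 * slow_part \<alpha> F x" by blast
    then have "x powr (-\<alpha>) * (tail U (ln x) / v (ln x)) \<le> x powr (-\<alpha>) * (2 / c0 * slow_part \<alpha> F x)"
      by (intro mult_left_mono) auto
    also have "\<dots> = 2 / c0 * Fbar x" using Fbar_slow_part[OF x0] by simp
    finally show ?thesis .
  qed
  define x1 where "x1 = max T (exp s0)"
  show ?thesis
  proof (rule convolution_controls[OF M, where ?x1.0=x1 and ?C3.0="2 / c0" and ?C2.0="2 / c0 * C1 * C"])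
    show "0 \<le> 2 / c0" "0 \<le> 2 / c0 * C1 * C" using c0 C C1 by auto
    show "0 \<le> t powr - \<alpha> * tail U (ln t)" for t using Upos(2) by (simp add: less_imp_le)
    fix x assume x: "x1 \<le> x"
    have x': "T \<le> x" "exp s0 \<le> x" "0 < x" using x T unfolding x1_def by auto
    have s: "s0 \<le> ln x" using x' by (subst ln_ge_iff) auto
    have "tail U (ln x) \<le> tail U (ln x) / v (ln x)"
      using v(2,3)[of "ln x"] Upos(2)[of "ln x"] by (simp add: field_simps mult_left_le)
    then have "x powr - \<alpha> * tail U (ln x) \<le> x powr (-\<alpha>) * (tail U (ln x) / v (ln x))"
      by (intro mult_left_mono) auto
    with lower[OF x'(1)] show "x powr - \<alpha> * tail U (ln x) \<le> 2 / c0 * Fbar x" by linarith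
    have bd: "Fbar (x * exp (- y)) * (exp y powr - \<alpha> * tail U (ln (exp y)))
        \<le> 2 / c0 * C1 * Fbar x * (tail U (ln x - y) / tail U (ln x) * tail U y)" if y: "y \<in> {0..ln x}" for y
    proof -
      have e: "x * exp (- y) = exp (ln x - y)" using x' by (simp add: exp_diff exp_minus divide_inverse)
      have "1 \<le> exp (ln x - y)" using y by simp
      then have t: "1 \<le> x * exp (- y)" unfolding e .
      have "slow_part \<alpha> F (x * exp (- y)) = c (x * exp (- y)) * (tail U (ln x - y) / v (ln x - y))"
        using L[of "x * exp (- y)"] t e by simp
      also have "\<dots> \<le> C1 * (tail U (ln x - y) / v (ln x))"
      proof (intro mult_mono c_bd t frac_le)
        show "v (ln x) \<le> v (ln x - y)" using y by (intro antimonoD[OF v(1)]) auto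
      qed (use C1 v Upos in \<open>auto intro: less_imp_le divide_nonneg_pos\<close>)
      finally have S: "slow_part \<alpha> F (x * exp (- y)) \<le> C1 * (tail U (ln x - y) / v (ln x))" .
      have "Fbar (x * exp (- y)) * (exp y powr - \<alpha> * tail U (ln (exp y)))
          = ((x * exp (- y)) powr - \<alpha> * exp y powr - \<alpha>) * slow_part \<alpha> F (x * exp (- y)) * tail U y"
        using Fbar_slow_part[of "x * exp (- y)"] t by simp
      also have "(x * exp (- y)) powr - \<alpha> * exp y powr - \<alpha> = (x * exp (- y) * exp y) powr - \<alpha>"
        by (rule powr_mult[symmetric]; use x' in simp)
      also have "x * exp (- y) * exp y = x" by (simp add: exp_minus)
      also have "x powr - \<alpha> * slow_part \<alpha> F (x * exp (- y)) * tail U y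
          \<le> x powr - \<alpha> * (C1 * (tail U (ln x - y) / v (ln x))) * tail U y"
        using S Upos(2)[of y] by (intro mult_right_mono mult_left_mono) auto
      also have "\<dots> = C1 * (x powr - \<alpha> * (tail U (ln x) / v (ln x))) * (tail U (ln x - y) / tail U (ln x) * tail U y)"
        using Upos(2)[of "ln x"] by (simp add: field_simps)
      also have "\<dots> \<le> C1 * (2 / c0 * Fbar x) * (tail U (ln x - y) / tail U (ln x) * tail U y)"
        using lower[OF x'(1)] C1 Upos by (intro mult_right_mono mult_left_mono) (auto intro!: mult_nonneg_nonneg divide_nonneg_pos less_imp_le)
      finally show ?thesis by (simp add: mult_ac)
    qed
    have "(\<integral>\<^sup>+y\<in>{0..ln x}. ennreal (Fbar (x * exp (- y)) * (exp y powr - \<alpha> * tail U (ln (exp y)))) \<partial>lborel)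
      \<le> (\<integral>\<^sup>+y. ennreal (2 / c0 * C1 * Fbar x) * (ennreal (tail U (ln x - y) / tail U (ln x) * tail U y) * indicator {0..ln x} y) \<partial>lborel)"
    proof (rule nn_integral_mono)
      fix y :: real
      show "ennreal (Fbar (x * exp (- y)) * (exp y powr - \<alpha> * tail U (ln (exp y)))) * indicator {0..ln x} y
        \<le> ennreal (2 / c0 * C1 * Fbar x) * (ennreal (tail U (ln x - y) / tail U (ln x) * tail U y) * indicator {0..ln x} y)"
      proof (cases "y \<in> {0..ln x}")
        case True
        have "0 \<le> 2 / c0 * C1 * Fbar x" using c0 C1 Fbar_nonneg by auto
        then have "ennreal (2 / c0 * C1 * Fbar x) * ennreal (tail U (ln x - y) / tail U (ln x) * tail U y)
          = ennreal (2 / c0 * C1 * Fbar x * (tail U (ln x - y) / tail U (ln x) * tail U y))"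
          by (rule ennreal_mult'[symmetric])
        then show ?thesis using ennreal_leI[OF bd[OF True]] True by (simp del: ln_exp)
      qed simp
    qed
    also have "\<dots> = ennreal (2 / c0 * C1 * Fbar x) * (\<integral>\<^sup>+y\<in>{0..ln x}. ennreal (tail U (ln x - y) / tail U (ln x) * tail U y) \<partial>lborel)"
      by (rule nn_integral_cmult) measurable
    also have "\<dots> \<le> ennreal (2 / c0 * C1 * Fbar x) * ennreal C" by (intro mult_left_mono C(2) s) auto
    also have "\<dots> = ennreal (2 / c0 * C1 * C * Fbar x)"
      using C C1 c0 Fbar_nonneg by (simp add: ennreal_mult[symmetric] mult_ac)
    finally show "(\<integral>\<^sup>+y\<in>{0..ln x}. ennreal (Fbar (x * exp (- y)) * (exp y powr - \<alpha> * tail U (ln (exp y)))) \<partial>lborel)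
      \<le> ennreal (2 / c0 * C1 * C * Fbar x)" .
  qed measurable
qed

lemma truncated_moment_integrable: "integrable F (\<lambda>v. indicator {0..x} v * v powr \<alpha>)"
proof (rule F.integrable_const_bound[where B="\<bar>x\<bar> powr \<alpha>"])
  show "AE v in F. norm (indicator {0..x} v * v powr \<alpha>) \<le> \<bar>x\<bar> powr \<alpha>"
    using alpha_pos by (intro AE_I2) (auto simp: indicator_def intro!: powr_mono2)
qed measurable

lemma truncated_moment_eq: "truncated_moment \<alpha> F x = (\<integral>v. indicator {0..x} v * v powr \<alpha> \<partial>F)"
  unfolding truncated_moment_def set_lebesgue_integral_def by simp

lemma truncated_moment_mono: "x \<le> y \<Longrightarrow> truncated_moment \<alpha> F x \<le> truncated_moment \<alpha> F y"
  unfolding truncated_moment_eq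
  by (intro integral_mono truncated_moment_integrable) (auto simp: indicator_def)

text \<open>Already the mass between \<open>x / 2\<close> and \<open>x\<close> contributes a fixed multiple of the slowly varying part to
the truncated moment, because halving the argument multiplies the tail by nearly
\<open>2 powr \<alpha>\<close>, which exceeds one.\<close>

lemma slow_part_le_truncated_moment:
  obtains C x0 where "0 < C" "\<And>x. x0 \<le> x \<Longrightarrow> slow_part \<alpha> F x \<le> C * truncated_moment \<alpha> F x"
proof -
  \<comment> \<open>Half of the excess of the limiting ratio over one.\<close>
  define c where "c = ((2::real) powr \<alpha> - 1) / 2"
  have p: "1 < (2::real) powr \<alpha>" using alpha_pos by (simp add: gr_one_powr)
  have c: "0 < c" using p unfolding c_def by simp
  have "((\<lambda>x. Fbar (x / 2) / Fbar x) \<longlongrightarrow> 2 powr \<alpha>) at_top" by (rule Fbar_ratio') simp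
  moreover have "1 + c < 2 powr \<alpha>" using p unfolding c_def by (simp add: field_simps)
  ultimately have "\<forall>\<^sub>F x in at_top. 1 + c < Fbar (x / 2) / Fbar x" by (rule order_tendstoD)
  then obtain x0 where x0: "\<And>x. x0 \<le> x \<Longrightarrow> 1 + c < Fbar (x / 2) / Fbar x"
    unfolding eventually_at_top_linorder by auto
  show ?thesis
  proof (rule that[of "2 powr \<alpha> / c" "max 1 x0"])
    show "0 < 2 powr \<alpha> / c" using c by simp
    fix x assume x: "max 1 x0 \<le> x"
    have "(1 + c) * Fbar x \<le> Fbar (x / 2)" using x0[of x] x Fbar_pos[of x] by (simp add: field_simps)
    then have "c * Fbar x \<le> Fbar (x / 2) - Fbar x" by (simp add: algebra_simps)
    also have "\<dots> = measure F {x/2<..x}"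
    proof -
      have "{x/2<..x} \<union> {x<..} = {x/2<..}" using x by (intro set_eqI) auto
      moreover have "measure F ({x/2<..x} \<union> {x<..}) = measure F {x/2<..x} + measure F {x<..}"
        by (rule F.finite_measure_Union) auto
      ultimately have "measure F {x/2<..} = measure F {x/2<..x} + measure F {x<..}" by simp
      then show ?thesis unfolding tail_def by simp
    qed
    finally have 1: "c * Fbar x \<le> measure F {x/2<..x}" .
    have "(x / 2) powr \<alpha> * measure F {x/2<..x} = (\<integral>v. (x / 2) powr \<alpha> * indicator {x/2<..x} v \<partial>F)"
      by simp
    also have "\<dots> \<le> truncated_moment \<alpha> F x"
      unfolding truncated_moment_eq
    proof (intro integral_mono truncated_moment_integrable)
      show "integrable F (\<lambda>v. (x / 2) powr \<alpha> * indicator {x/2<..x} v)"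
        by (intro integrable_mult_right F.integrable_const_bound[where B=1]) auto
      show "(x / 2) powr \<alpha> * indicator {x/2<..x} v \<le> indicator {0..x} v * v powr \<alpha>" for v
        using x alpha_pos by (auto simp: indicator_def intro!: powr_mono2)
    qed
    finally have "(x / 2) powr \<alpha> * (c * Fbar x) \<le> truncated_moment \<alpha> F x"
      using mult_left_mono[OF 1, of "(x / 2) powr \<alpha>"] by simp
    then have "2 powr \<alpha> / c * ((x / 2) powr \<alpha> * (c * Fbar x)) \<le> 2 powr \<alpha> / c * truncated_moment \<alpha> F x"
      by (rule mult_left_mono) (use c in simp)
    moreover have "(x / 2) powr \<alpha> = x powr \<alpha> / 2 powr \<alpha>" by (rule powr_divide)
    ultimately show "slow_part \<alpha> F x \<le> 2 powr \<alpha> / c * truncated_moment \<alpha> F x"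
      using c unfolding slow_part_def by simp
  qed
qed

text \<open>Let \<open>r\<close> be the square root of \<open>x\<close>.  For \<open>V \<le> r\<close> the hypothesis on the slowly varying part gives the
pointwise bound with \<open>V powr \<alpha>\<close>.  For \<open>V > r\<close> the roles are exchanged: integrating first over \<open>V\<close>,
the tail of \<open>V\<close> at \<open>x / u\<close> is at most \<open>\<eta>\<close> times a multiple of
\<open>u powr \<alpha> * P[X > x] / m(r)\<close>, and the integral of \<open>u powr \<alpha>\<close> up to \<open>r\<close> is exactly \<open>m(r)\<close>.  That
\<open>X\<close> and \<open>V\<close> both exceed \<open>r\<close> has a probability of the right order by \<open>slow_part_le_truncated_moment\<close>.\<close>

lemma DZ4_controls:
  fixes M :: "'b measure"
  assumes M: "prob_space M" and DZ: "DZ4 \<alpha> F G"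
  shows "controls M (\<lambda>t. Fbar t / truncated_moment \<alpha> F t)"
proof -
  interpret M: prob_space M by fact
  interpret P: pair_prob_space M F ..
  let ?m = "truncated_moment \<alpha> F"
  have lim: "Limsup at_top (\<lambda>x. SUP y\<in>{sqrt x..x}. ereal (slow_part \<alpha> F y / slow_part \<alpha> F x)) < \<infinity>"
    using DZ unfolding DZ4_def by simp
  obtain C x1 where C: "1 \<le> C" "1 \<le> x1" and
    CL: "\<And>x y. x1 \<le> x \<Longrightarrow> y \<in> {sqrt x..x} \<Longrightarrow> slow_part \<alpha> F y \<le> C * slow_part \<alpha> F x"
    using Limsup_SUP_bound[OF lim slow_part_pos] by blast
  obtain C4 x3 where C4: "0 < C4" "\<And>x. x3 \<le> x \<Longrightarrow> slow_part \<alpha> F x \<le> C4 * ?m x"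
    using slow_part_le_truncated_moment by blast
  have "\<forall>\<^sub>F x in at_top. 1 \<le> ?m x" using DZ unfolding DZ4_def filterlim_at_top by blast
  then obtain x2 where x2: "\<And>x. x2 \<le> x \<Longrightarrow> 1 \<le> ?m x" unfolding eventually_at_top_linorder by auto
  define A0 where "A0 = max 1 (max x2 x3)"
  have A0: "1 \<le> A0" "x2 \<le> A0" "x3 \<le> A0" unfolding A0_def by auto
  define K where "K = C * C4 + C + 1"
  have K: "C \<le> K" "0 \<le> K" unfolding K_def using C C4 by auto
  show ?thesis unfolding controls_def
  proof (rule exI[of _ K], rule exI[of _ 1], rule exI[of _ A0], intro conjI allI impI)
    fix A :: real assume A: "A0 \<le> A"
    show "\<exists>x0. large_part_bound M (\<lambda>t. Fbar t / ?m t) K 1 A x0" unfolding large_part_bound_def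
    proof (intro exI[of _ "max x1 (A^2)"] allI impI)
      fix V :: "'b \<Rightarrow> real" and \<eta> x :: real
      assume V[measurable]: "V \<in> borel_measurable M" and V0: "\<forall>\<omega>\<in>space M. 0 \<le> V \<omega>"
        and Vint: "integrable M (\<lambda>\<omega>. V \<omega> powr \<alpha>)" and \<eta>: "0 \<le> \<eta>"
        and Vt: "\<forall>t\<ge>A. \<P>(\<omega> in M. V \<omega> > t) \<le> \<eta> * (Fbar t / ?m t)" and x: "max x1 (A^2) \<le> x"
      define r where "r = sqrt x"
      have A1: "1 \<le> A" using A A0 by simp
      have x': "1 \<le> x" "x1 \<le> x" using x C by auto
      have rA: "A \<le> r" unfolding r_def using x A1 by (intro real_le_rsqrt) simp
      have r1: "1 \<le> r" using rA A1 by simp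
      have rr: "r * r = x" unfolding r_def using x' by simp
      have rx: "r \<le> x" using mult_right_mono[of 1 r r] r1 rr by simp
      have m1: "1 \<le> ?m t" if "r \<le> t" for t using that rA A A0 by (intro x2) auto
      have CF: "Fbar (x / u) \<le> C * u powr \<alpha> * Fbar x" if "1 \<le> u" "u \<le> r" for u
      proof (intro ratio_from_slow_part CL x')
        have "r * u \<le> r * r" using that r1 by (intro mult_left_mono) auto
        then have "r \<le> x / u" using that rr by (simp add: field_simps)
        moreover have "x / u \<le> x" using that x' by (simp add: field_simps mult_left_le)
        ultimately show "x / u \<in> {sqrt x..x}" unfolding r_def by simp
      qed (use that x' in auto)
      let ?k = "\<lambda>z::'b \<times> real. if r < V (fst z) \<and> x < V (fst z) * snd z then 1 else 0 :: real"
      define g where "g = (\<lambda>u. \<eta> * (Fbar r / ?m r) * indicator {r<..} u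
          + \<eta> * (C * Fbar x / ?m r) * (indicator {0..r} u * u powr \<alpha>) + \<eta> * Fbar x)"
      have kint: "integrable (M \<Otimes>\<^sub>M F) ?k"
        by (rule P.P.integrable_const_bound[where B=1]) auto
      have inner1: "(\<integral>u. ?k (\<omega>, u) \<partial>F) = (if r < V \<omega> then Fbar (x / V \<omega>) else 0)" if "\<omega> \<in> space M" for \<omega>
      proof (cases "r < V \<omega>")
        case True
        then have "(\<integral>u. ?k (\<omega>, u) \<partial>F) = (\<integral>u. indicator {x / V \<omega><..} u \<partial>F)"
          using r1 by (intro Bochner_Integration.integral_cong) (auto simp: indicator_def field_simps)
        then show ?thesis using True by (simp add: tail_def)
      qed simp
      have Pb: "\<P>(\<omega> in M. V \<omega> > t) \<le> \<eta> * (Fbar t / ?m t)" if "r \<le> t" for t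
        using Vt rA that by auto
      have inner2: "(\<integral>\<omega>. ?k (\<omega>, u) \<partial>M) \<le> g u" for u
      proof -
        have eqm: "(\<integral>\<omega>. ?k (\<omega>, u) \<partial>M) = \<P>(\<omega> in M. r < V \<omega> \<and> x < V \<omega> * u)"
        proof -
          have "(\<integral>\<omega>. ?k (\<omega>, u) \<partial>M) = (\<integral>\<omega>. indicator {\<omega> \<in> space M. r < V \<omega> \<and> x < V \<omega> * u} \<omega> \<partial>M)"
            by (intro Bochner_Integration.integral_cong) (auto simp: indicator_def)
          then show ?thesis by (simp add: Int_def conj_ac cong: conj_cong)
        qed
        have sub: "\<P>(\<omega> in M. r < V \<omega> \<and> x < V \<omega> * u) \<le> \<P>(\<omega> in M. V \<omega> > t)"
          if "\<And>w. r < w \<Longrightarrow> x < w * u \<Longrightarrow> t < w" for t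
          using that by (intro M.finite_measure_mono) auto
        have nn: "0 \<le> \<eta> * (Fbar r / ?m r)" "0 \<le> \<eta> * (C * Fbar x / ?m r)" "0 \<le> \<eta> * Fbar x"
          using \<eta> C Fbar_nonneg m1[of r] by auto
        have g0: "\<eta> * (Fbar r / ?m r) * indicator {r<..} u \<le> g u" 
          "\<eta> * (C * Fbar x / ?m r) * (indicator {0..r} u * u powr \<alpha>) \<le> g u" "\<eta> * Fbar x \<le> g u"
          unfolding g_def using nn mult_nonneg_nonneg[OF nn(1), of "indicator {r<..} u"]
            mult_nonneg_nonneg[OF nn(2), of "indicator {0..r} u * u powr \<alpha>"] by auto
        consider "u > r" | "1 \<le> u" "u \<le> r" | "u < 1" by linarith
        then show ?thesis
        proof cases
          case 1
          then have "\<eta> * (Fbar r / ?m r) \<le> g u" using g0(1) by simp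
          moreover have "\<P>(\<omega> in M. r < V \<omega> \<and> x < V \<omega> * u) \<le> \<eta> * (Fbar r / ?m r)"
            using sub[of r] Pb[of r] by auto
          ultimately show ?thesis unfolding eqm by linarith
        next
          case 2
          have "r * u \<le> r * r" using 2 r1 by (intro mult_left_mono) auto
          then have ru: "r \<le> x / u" using 2 rr by (simp add: field_simps)
          have "\<P>(\<omega> in M. r < V \<omega> \<and> x < V \<omega> * u) \<le> \<eta> * (Fbar (x / u) / ?m (x / u))"
            using sub[of "x / u"] Pb[OF ru] 2 by (auto simp: field_simps)
          also have "\<dots> \<le> \<eta> * (C * u powr \<alpha> * Fbar x / ?m r)"
            using CF[OF 2] m1[of r] truncated_moment_mono[OF ru] \<eta> C Fbar_nonneg
            by (intro mult_left_mono frac_le) auto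
          also have "\<dots> = \<eta> * (C * Fbar x / ?m r) * (indicator {0..r} u * u powr \<alpha>)" using 2 by simp
          finally show ?thesis using g0(2) unfolding eqm by linarith
        next
          case 3
          have "x < w" if "r < w" "x < w * u" for w
          proof -
            have "w * u \<le> w * 1" using 3 that r1 by (intro mult_left_mono) auto
            then show ?thesis using that by simp
          qed
          then have "\<P>(\<omega> in M. r < V \<omega> \<and> x < V \<omega> * u) \<le> \<eta> * (Fbar x / ?m x)"
            using sub[of x] Pb[OF rx] by auto
          also have "\<dots> \<le> \<eta> * (Fbar x / 1)"
            using m1[OF rx] \<eta> Fbar_nonneg by (intro mult_left_mono divide_left_mono) auto
          finally show ?thesis using g0(3) unfolding eqm by simp
        qed
      qed
      have ind: "integrable F (indicator {r<..} :: real \<Rightarrow> real)"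
        by (rule F.integrable_const_bound[where B=1]) auto
      have gint: "integrable F g" unfolding g_def
        by (intro Bochner_Integration.integrable_add integrable_mult_right truncated_moment_integrable ind) auto
      have k1: "integrable M (\<lambda>\<omega>. \<integral>u. ?k (\<omega>, u) \<partial>F)" using P.integrable_fst'[OF kint] .
      have k2: "integrable F (\<lambda>u. \<integral>\<omega>. ?k (\<omega>, u) \<partial>M)"
        using P.integrable_snd[of "\<lambda>\<omega> u. ?k (\<omega>, u)"] kint by (simp add: case_prod_beta')
      have "large_part M V r x = (\<integral>\<omega>. (\<integral>u. ?k (\<omega>, u) \<partial>F) \<partial>M)"
        by (rule Bochner_Integration.integral_cong[OF refl inner1[symmetric]])
      also have "\<dots> = (\<integral>u. (\<integral>\<omega>. ?k (\<omega>, u) \<partial>M) \<partial>F)"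
        using P.Fubini_integral[of "\<lambda>\<omega> u. ?k (\<omega>, u)"] kint by (simp add: case_prod_beta')
      also have "\<dots> \<le> (\<integral>u. g u \<partial>F)" by (intro integral_mono k2 gint inner2)
      also have "\<dots> = \<eta> * (Fbar r / ?m r) * Fbar r + \<eta> * (C * Fbar x / ?m r) * ?m r + \<eta> * Fbar x"
      proof -
        have i1: "integrable F (\<lambda>u. \<eta> * (Fbar r / ?m r) * indicator {r<..} u)"
          by (intro integrable_mult_right ind)
        have i2: "integrable F (\<lambda>u. \<eta> * (C * Fbar x / ?m r) * (indicator {0..r} u * u powr \<alpha>))"
          by (intro integrable_mult_right truncated_moment_integrable)
        have F1: "measure F UNIV = 1" using F.prob_space by simp
        have t: "(\<integral>u. indicator {r<..} u \<partial>F) = Fbar r" by (simp add: tail_def)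
        have "(\<integral>u. g u \<partial>F) = (\<integral>u. \<eta> * (Fbar r / ?m r) * indicator {r<..} u \<partial>F)
           + (\<integral>u. \<eta> * (C * Fbar x / ?m r) * (indicator {0..r} u * u powr \<alpha>) \<partial>F) + (\<integral>u. \<eta> * Fbar x \<partial>F)"
          unfolding g_def using i1 i2 F1 by simp
        then show ?thesis unfolding integral_mult_right_zero t truncated_moment_eq[symmetric] using F1 by simp
      qed
      also have "\<dots> = \<eta> * (Fbar r * (Fbar r / ?m r)) + \<eta> * (C * Fbar x) + \<eta> * Fbar x" using m1[of r] by simp
      also have "\<dots> \<le> \<eta> * (C * C4 * Fbar x) + \<eta> * (C * Fbar x) + \<eta> * Fbar x"
      proof -
        have rp: "0 < r" "0 < x" using r1 x' by auto
        have "Fbar r * (Fbar r / ?m r) = (r powr (-\<alpha>) * r powr (-\<alpha>)) * slow_part \<alpha> F r * (slow_part \<alpha> F r / ?m r)"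
          using Fbar_slow_part[OF rp(1)] by simp
        also have "r powr (-\<alpha>) * r powr (-\<alpha>) = x powr (-\<alpha>)" using rr rp by (simp flip: powr_mult)
        also have "x powr (-\<alpha>) * slow_part \<alpha> F r * (slow_part \<alpha> F r / ?m r) \<le> x powr (-\<alpha>) * (C * slow_part \<alpha> F x) * C4"
        proof (intro mult_mono mult_left_mono)
          show "slow_part \<alpha> F r \<le> C * slow_part \<alpha> F x" using rx by (intro CL x') (auto simp: r_def)
          show "slow_part \<alpha> F r / ?m r \<le> C4"
            using C4(2)[of r] rA A A0 m1[of r] by (simp add: field_simps)
        qed (use slow_part_pos[OF rp(1)] slow_part_pos[OF rp(2)] m1[of r] C in auto)
        also have "\<dots> = C * C4 * Fbar x" using Fbar_slow_part[OF rp(2)] by simp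
        finally show ?thesis using \<eta> C by (intro add_mono mult_left_mono) auto
      qed
      also have "\<dots> = K * \<eta> * Fbar x" by (simp add: K_def algebra_simps)
      finally have far: "large_part M V r x \<le> K * \<eta> * Fbar x" .
      have ifint: "integrable M (\<lambda>\<omega>. if a < V \<omega> then Fbar (x / V \<omega>) else 0)" for a
        by (rule M.integrable_const_bound[where B=1]) (use Fbar_le_1 Fbar_nonneg in auto)
      have "large_part M V (1 * A) x
          \<le> (\<integral>\<omega>. C * V \<omega> powr \<alpha> * Fbar x + (if r < V \<omega> then Fbar (x / V \<omega>) else 0) \<partial>M)"
      proof (rule integral_mono)
        show "(if 1 * A < V \<omega> then Fbar (x / V \<omega>) else 0) \<le> C * V \<omega> powr \<alpha> * Fbar x + (if r < V \<omega> then Fbar (x / V \<omega>) else 0)" for \<omega>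
          using CF[of "V \<omega>"] A1 C Fbar_nonneg by auto
      qed (use ifint[of "1 * A"] ifint[of r] Vint in \<open>auto intro!: Bochner_Integration.integrable_add\<close>)
      also have "\<dots> = C * moment M V \<alpha> * Fbar x + large_part M V r x"
        using Vint ifint[of r] by simp
      also have "\<dots> \<le> K * moment M V \<alpha> * Fbar x + K * \<eta> * Fbar x"
        using far K Fbar_nonneg by (intro add_mono mult_right_mono) (auto intro: Bochner_Integration.integral_nonneg)
      also have "\<dots> = K * (\<eta> + moment M V \<alpha>) * Fbar x" by (simp add: algebra_simps)
      finally show "large_part M V (1 * A) x \<le> K * (\<eta> + moment M V \<alpha>) * Fbar x" .
    qed
  qed (use K A0 in auto)
qed

end

section \<open>Products under Sarmanov dependence\<close>

text \<open>Every point outside the support lies in a null interval with rational endpoints.\<close>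

lemma AE_law_support:
  assumes "real_distribution \<mu>"
  shows "AE x in \<mu>. x \<in> law_support \<mu>"
proof -
  interpret real_distribution \<mu> by fact
  let ?Q = "{(a, b). a \<in> \<rat> \<and> b \<in> \<rat> \<and> measure \<mu> {a<..<b} = 0}"
  have "countable ?Q"
    by (rule countable_subset[OF _ countable_SIGMA[OF countable_rat countable_rat]]) auto
  then have null: "(\<Union>q\<in>?Q. {fst q<..<snd q}) \<in> null_sets \<mu>"
    by (intro null_sets_UN') (auto simp: null_sets_def emeasure_eq_measure)
  have "{x \<in> space \<mu>. \<not> x \<in> law_support \<mu>} \<subseteq> (\<Union>q\<in>?Q. {fst q<..<snd q})"
  proof safe
    fix x assume "x \<notin> law_support \<mu>"
    then obtain e where e: "0 < e" "measure \<mu> {x - e<..<x + e} = 0"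
      unfolding law_support_def by (auto simp: not_less measure_le_0_iff)
    obtain a where a: "a \<in> \<rat>" "x - e < a" "a < x" using Rats_dense_in_real[of "x - e" x] e by auto
    obtain b where b: "b \<in> \<rat>" "x < b" "b < x + e" using Rats_dense_in_real[of x "x + e"] e by auto
    have "measure \<mu> {a<..<b} \<le> measure \<mu> {x - e<..<x + e}" using a b by (intro finite_measure_mono) auto
    then have "measure \<mu> {a<..<b} = 0" using e by (simp add: measure_le_0_iff)
    then show "x \<in> (\<Union>q\<in>?Q. {fst q<..<snd q})" using a b by (intro UN_I[of "(a, b)"]) auto
  qed
  with null show ?thesis by (rule AE_I')
qed

text \<open>If \<open>\<theta> \<phi>1\<close> does not vanish, then, having mean zero, it takes a positive and a negative value on the
support, and the positivity of the density at these two points bounds \<open>\<phi>2\<close> from below and from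
above.\<close>

lemma sarmanov_kernel_bounded:
  assumes S: "sarmanov M X Y F G \<phi>1 \<phi>2 \<theta>" and F: "real_distribution F"
  shows "(AE u in F. \<theta> * \<phi>1 u = 0) \<or> (\<exists>B\<ge>0. \<forall>y\<in>law_support G. \<bar>\<phi>2 y\<bar> \<le> B)"
proof (rule disjCI)
  assume neg: "\<not> (\<exists>B\<ge>0. \<forall>y\<in>law_support G. \<bar>\<phi>2 y\<bar> \<le> B)"
  interpret F: real_distribution F by fact
  have [measurable]: "X \<in> borel_measurable M" "\<phi>1 \<in> borel_measurable borel" and FX: "distr M borel X = F"
    and i1: "integrable M (\<lambda>\<omega>. \<phi>1 (X \<omega>))" "(\<integral>\<omega>. \<phi>1 (X \<omega>) \<partial>M) = 0"
    and pos: "\<And>x y. x \<in> law_support F \<Longrightarrow> y \<in> law_support G \<Longrightarrow> 0 \<le> 1 + \<theta> * \<phi>1 x * \<phi>2 y"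
    using S unfolding sarmanov_def by auto
  have int: "integrable F (\<lambda>u. \<theta> * \<phi>1 u)" using i1(1) unfolding FX[symmetric] by (simp add: integrable_distr_eq)
  have zero: "(\<integral>u. \<theta> * \<phi>1 u \<partial>F) = 0" using i1(2) unfolding FX[symmetric] by (simp add: integral_distr)
  show "AE u in F. \<theta> * \<phi>1 u = 0"
  proof (cases "(\<forall>u\<in>law_support F. 0 \<le> \<theta> * \<phi>1 u) \<or> (\<forall>u\<in>law_support F. \<theta> * \<phi>1 u \<le> 0)")
    case True
    then show ?thesis
    proof
      assume "\<forall>u\<in>law_support F. 0 \<le> \<theta> * \<phi>1 u"
      then have "AE u in F. 0 \<le> \<theta> * \<phi>1 u" using AE_law_support[OF F] by auto
      then show ?thesis using integral_nonneg_eq_0_iff_AE[OF int] zero by simp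
    next
      assume "\<forall>u\<in>law_support F. \<theta> * \<phi>1 u \<le> 0"
      then have "AE u in F. 0 \<le> - (\<theta> * \<phi>1 u)" using AE_law_support[OF F] by auto
      then have "AE u in F. - (\<theta> * \<phi>1 u) = 0" using integral_nonneg_eq_0_iff_AE[of F "\<lambda>u. - (\<theta> * \<phi>1 u)"] int zero by simp
      then show ?thesis by simp
    qed
  next
    case False
    then obtain u u' where u: "u \<in> law_support F" "\<theta> * \<phi>1 u < 0" and u': "u' \<in> law_support F" "0 < \<theta> * \<phi>1 u'"
      by (auto simp: not_le)
    have "\<bar>\<phi>2 y\<bar> \<le> max (1 / (- (\<theta> * \<phi>1 u))) (1 / (\<theta> * \<phi>1 u'))" if "y \<in> law_support G" for y
    proof -
      have "\<phi>2 y \<le> 1 / (- (\<theta> * \<phi>1 u))" using pos[OF u(1) that] u(2) by (simp add: field_simps)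
      moreover have "- \<phi>2 y \<le> 1 / (\<theta> * \<phi>1 u')" using pos[OF u'(1) that] u'(2) by (simp add: field_simps)
      ultimately show ?thesis by linarith
    qed
    moreover have "0 \<le> max (1 / (- (\<theta> * \<phi>1 u))) (1 / (\<theta> * \<phi>1 u'))" using u' by (simp add: le_max_iff_disj)
    ultimately show ?thesis using neg by blast
  qed
qed

context rv_law begin

text \<open>This function plays the role of the tail for the part of the Sarmanov law that carries the kernel.\<close>

lemma truncated_kernel:
  assumes int: "integrable F \<phi>" and lim: "(\<phi> \<longlongrightarrow> d) at_top"
  defines "\<Phi> \<equiv> \<lambda>t. \<integral>u. indicator {t<..} u * \<phi> u \<partial>F"
  shows "\<Phi> \<in> borel_measurable borel" "\<bar>\<Phi> t\<bar> \<le> (\<integral>u. \<bar>\<phi> u\<bar> \<partial>F)" "((\<lambda>t. \<Phi> t / Fbar t) \<longlongrightarrow> d) at_top"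
proof -
  have [measurable]: "\<phi> \<in> borel_measurable borel" using int by auto
  have tint: "integrable F (\<lambda>u. indicator {t<..} u * \<phi> u)" for t
    by (rule Bochner_Integration.integrable_bound[OF int]) (auto simp: indicator_def)
  have "(\<lambda>(t, u). (if t < u then 1 else 0) * \<phi> u) \<in> borel_measurable (borel \<Otimes>\<^sub>M F)" by measurable
  then have "(\<lambda>(t, u). indicator {t<..} u * \<phi> u) \<in> borel_measurable (borel \<Otimes>\<^sub>M F)"
    by (simp add: indicator_def)
  then show "\<Phi> \<in> borel_measurable borel"
    unfolding \<Phi>_def by (intro F.borel_measurable_lebesgue_integral)
  have "\<bar>\<Phi> t\<bar> \<le> (\<integral>u. \<bar>indicator {t<..} u * \<phi> u\<bar> \<partial>F)" unfolding \<Phi>_def by (rule integral_abs_bound)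
  also have "\<dots> \<le> (\<integral>u. \<bar>\<phi> u\<bar> \<partial>F)"
    using int tint by (intro integral_mono) (auto simp: indicator_def)
  finally show "\<bar>\<Phi> t\<bar> \<le> (\<integral>u. \<bar>\<phi> u\<bar> \<partial>F)" .
  show "((\<lambda>t. \<Phi> t / Fbar t) \<longlongrightarrow> d) at_top"
  proof (rule tendstoI)
    fix e :: real assume e: "0 < e"
    then have "\<forall>\<^sub>F u in at_top. dist (\<phi> u) d < e / 2" by (intro tendstoD[OF lim]) simp
    then obtain T where T: "\<And>u. T \<le> u \<Longrightarrow> \<bar>\<phi> u - d\<bar> < e / 2"
      unfolding eventually_at_top_linorder dist_real_def by auto
    show "\<forall>\<^sub>F t in at_top. dist (\<Phi> t / Fbar t) d < e"
      using eventually_ge_at_top[of T]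
    proof eventually_elim
      fix t assume t: "T \<le> t"
      have iint: "integrable F (indicator {t<..} :: real \<Rightarrow> real)"
        by (rule F.integrable_const_bound[where B=1]) auto
      have "\<Phi> t - d * Fbar t = (\<integral>u. indicator {t<..} u * \<phi> u - d * indicator {t<..} u \<partial>F)"
        unfolding \<Phi>_def using tint iint by (simp add: tail_def)
      then have "\<bar>\<Phi> t - d * Fbar t\<bar> \<le> (\<integral>u. \<bar>indicator {t<..} u * \<phi> u - d * indicator {t<..} u\<bar> \<partial>F)"
        by (simp only: integral_abs_bound)
      also have "\<dots> \<le> (\<integral>u. e / 2 * indicator {t<..} u \<partial>F)"
      proof (rule integral_mono)
        show "\<bar>indicator {t<..} u * \<phi> u - d * indicator {t<..} u\<bar> \<le> e / 2 * indicator {t<..} u" for u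
          using T[of u] t by (auto simp: indicator_def)
      qed (use tint iint in auto)
      also have "\<dots> = e / 2 * Fbar t" by (simp add: tail_def)
      finally have "\<bar>\<Phi> t - d * Fbar t\<bar> \<le> e / 2 * Fbar t" .
      moreover have "\<Phi> t / Fbar t - d = (\<Phi> t - d * Fbar t) / Fbar t" by (simp add: field_simps)
      ultimately have "\<bar>\<Phi> t / Fbar t - d\<bar> \<le> e / 2" using Fbar_pos[of t] by (simp add: abs_divide field_simps)
      then show "dist (\<Phi> t / Fbar t) d < e" using e by (simp add: dist_real_def)
    qed
  qed
qed

lemma sarmanov_product_tail_eq:
  assumes M: "prob_space M" and S: "sarmanov M X Y F G \<phi>1 \<phi>2 \<theta>"
    and Y0: "\<And>\<omega>. \<omega> \<in> space M \<Longrightarrow> 0 \<le> Y \<omega>" and x: "0 \<le> x"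
  defines "\<Phi> \<equiv> \<lambda>t. \<integral>u. indicator {t<..} u * \<phi>1 u \<partial>F"
  shows "\<P>(\<omega> in M. X \<omega> * Y \<omega> > x)
    = (\<integral>\<omega>. scaled Fbar x (Y \<omega>) + \<theta> * (\<phi>2 (Y \<omega>) * scaled \<Phi> x (Y \<omega>)) \<partial>M)"
proof -
  interpret M: prob_space M by fact
  have [measurable]: "X \<in> borel_measurable M" "Y \<in> borel_measurable M"
      "\<phi>1 \<in> borel_measurable borel" "\<phi>2 \<in> borel_measurable borel"
    and FX: "distr M borel X = F" and GY: "distr M borel Y = G"
    and i1: "integrable M (\<lambda>\<omega>. \<phi>1 (X \<omega>))" and i2: "integrable M (\<lambda>\<omega>. \<phi>2 (Y \<omega>))"
    and pos: "\<And>x y. x \<in> law_support F \<Longrightarrow> y \<in> law_support G \<Longrightarrow> 0 \<le> 1 + \<theta> * \<phi>1 x * \<phi>2 y"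
    and joint: "distr M (borel \<Otimes>\<^sub>M borel) (\<lambda>\<omega>. (X \<omega>, Y \<omega>)) =
       density (F \<Otimes>\<^sub>M G) (\<lambda>(x, y). ennreal (1 + \<theta> * \<phi>1 x * \<phi>2 y))"
    using S unfolding sarmanov_def by auto
  interpret G: real_distribution G
    unfolding GY[symmetric] by (rule M.real_distribution_distr) simp
  interpret P: pair_prob_space F G ..
  have p1: "integrable F \<phi>1" using i1 unfolding FX[symmetric] by (simp add: integrable_distr_eq)
  have p2: "integrable G \<phi>2" using i2 unfolding GY[symmetric] by (simp add: integrable_distr_eq)
  let ?p = "\<lambda>z. 1 + \<theta> * \<phi>1 (fst z) * \<phi>2 (snd z)"
  have pint: "integrable (F \<Otimes>\<^sub>M G) ?p"
  proof -
    have "integrable (F \<Otimes>\<^sub>M G) (\<lambda>z. \<phi>1 (fst z) * \<phi>2 (snd z))"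
    proof (rule P.Fubini_integrable)
      show "integrable F (\<lambda>x. \<integral>y. norm (\<phi>1 (fst (x, y)) * \<phi>2 (snd (x, y))) \<partial>G)"
        using p1 by (simp add: abs_mult)
      show "AE x in F. integrable G (\<lambda>y. \<phi>1 (fst (x, y)) * \<phi>2 (snd (x, y)))"
        using p2 by simp
    qed measurable
    then have "integrable (F \<Otimes>\<^sub>M G) (\<lambda>z. \<theta> * (\<phi>1 (fst z) * \<phi>2 (snd z)))" by (rule integrable_mult_right)
    then show ?thesis by (simp add: mult.assoc)
  qed
  have ppos: "AE z in F \<Otimes>\<^sub>M G. 0 \<le> ?p z"
  proof (rule P.AE_pair_measure)
    show "{z \<in> space (F \<Otimes>\<^sub>M G). 0 \<le> ?p z} \<in> sets (F \<Otimes>\<^sub>M G)" by measurable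
    show "AE u in F. AE y in G. 0 \<le> ?p (u, y)"
      using AE_law_support[OF law]
    proof eventually_elim
      case (elim u)
      show ?case using AE_law_support[OF G.real_distribution_axioms]
        by eventually_elim (use pos elim in auto)
    qed
  qed
  define A where "A = {z :: real \<times> real. fst z * snd z > x}"
  have A[measurable]: "A \<in> sets (borel \<Otimes>\<^sub>M borel)" unfolding A_def by (rule product_set_measurable)
  have A'[measurable]: "A \<in> sets (F \<Otimes>\<^sub>M G)" using A by (simp cong: sets_pair_measure_cong)
  have pAint: "integrable (F \<Otimes>\<^sub>M G) (\<lambda>z. ?p z * indicator A z)"
    by (rule integrable_real_mult_indicator[OF A' pint])
  have "emeasure M {\<omega> \<in> space M. X \<omega> * Y \<omega> > x} = emeasure (distr M (borel \<Otimes>\<^sub>M borel) (\<lambda>\<omega>. (X \<omega>, Y \<omega>))) A"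
    by (subst emeasure_distr[OF _ A]) (auto simp: A_def intro!: arg_cong[where f="emeasure M"])
  also have "\<dots> = (\<integral>\<^sup>+z. ennreal (?p z) * indicator A z \<partial>(F \<Otimes>\<^sub>M G))"
    unfolding joint by (subst emeasure_density) (auto simp: case_prod_beta')
  also have "\<dots> = (\<integral>\<^sup>+z. ennreal (?p z * indicator A z) \<partial>(F \<Otimes>\<^sub>M G))"
    by (intro nn_integral_cong) (auto simp: indicator_def)
  also have "\<dots> = ennreal (\<integral>z. ?p z * indicator A z \<partial>(F \<Otimes>\<^sub>M G))"
    using ppos by (intro nn_integral_eq_integral pAint) (auto simp: indicator_def elim: eventually_mono)
  finally have "\<P>(\<omega> in M. X \<omega> * Y \<omega> > x) = (\<integral>z. ?p z * indicator A z \<partial>(F \<Otimes>\<^sub>M G))"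
    unfolding measure_def using ppos
    by (simp add: indicator_def) (intro enn2real_ennreal integral_nonneg_AE, auto elim: eventually_mono)
  also have "\<dots> = (\<integral>y. (\<integral>u. ?p (u, y) * indicator A (u, y) \<partial>F) \<partial>G)"
    using P.integral_snd[of "\<lambda>u y. ?p (u, y) * indicator A (u, y)"] pAint by (simp add: case_prod_beta')
  also have "\<dots> = (\<integral>\<omega>. (\<integral>u. ?p (u, Y \<omega>) * indicator A (u, Y \<omega>) \<partial>F) \<partial>M)"
    unfolding GY[symmetric] by (subst integral_distr) auto
  also have "\<dots> = (\<integral>\<omega>. scaled Fbar x (Y \<omega>) + \<theta> * (\<phi>2 (Y \<omega>) * scaled \<Phi> x (Y \<omega>)) \<partial>M)"
  proof (rule Bochner_Integration.integral_cong[OF refl])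
    fix \<omega> assume "\<omega> \<in> space M"
    then consider "Y \<omega> = 0" | "0 < Y \<omega>" using Y0 by fastforce
    then show "(\<integral>u. ?p (u, Y \<omega>) * indicator A (u, Y \<omega>) \<partial>F) = scaled Fbar x (Y \<omega>) + \<theta> * (\<phi>2 (Y \<omega>) * scaled \<Phi> x (Y \<omega>))"
    proof cases
      case 1 then show ?thesis using x by (simp add: scaled_def A_def)
    next
      case 2
      have tint: "integrable F (\<lambda>u. indicator {t<..} u * \<phi>1 u)" for t
        by (rule Bochner_Integration.integrable_bound[OF p1]) (auto simp: indicator_def)
      have iint: "integrable F (indicator {t<..} :: real \<Rightarrow> real)" for t
        by (rule F.integrable_const_bound[where B=1]) auto
      let ?t = "x / Y \<omega>"
      have "(\<integral>u. ?p (u, Y \<omega>) * indicator A (u, Y \<omega>) \<partial>F)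
        = (\<integral>u. indicator {?t<..} u + \<theta> * \<phi>2 (Y \<omega>) * (indicator {?t<..} u * \<phi>1 u) \<partial>F)"
        using 2 by (intro Bochner_Integration.integral_cong) (auto simp: A_def indicator_def field_simps)
      also have "\<dots> = Fbar ?t + \<theta> * \<phi>2 (Y \<omega>) * \<Phi> ?t"
        unfolding \<Phi>_def using tint iint by (simp add: tail_def)
      finally show ?thesis using 2 by (simp add: scaled_def)
    qed
  qed
  finally show ?thesis .
qed

text \<open>The dependent part is a weighted Breiman limit, with the kernel \<open>\<phi>2\<close> as the weight and the truncated
kernel \<open>\<phi>1\<close> instead of the tail.  If \<open>\<theta> \<phi>1\<close> vanishes almost everywhere, then \<open>\<phi>2\<close> may be unbounded, but
the dependent part vanishes and so does \<open>\<theta> d1\<close>.\<close>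

lemma sarmanov_product_tail:
  assumes M: "prob_space M" and S: "sarmanov M X Y F G \<phi>1 \<phi>2 \<theta>"
    and Y: "breiman M Y" and lim: "(\<phi>1 \<longlongrightarrow> d1) at_top"
  shows "((\<lambda>x. \<P>(\<omega> in M. X \<omega> * Y \<omega> > x) / Fbar x)
    \<longlongrightarrow> moment M Y \<alpha> + \<theta> * d1 * (\<integral>\<omega>. \<phi>2 (Y \<omega>) * Y \<omega> powr \<alpha> \<partial>M)) at_top"
proof -
  interpret M: prob_space M by fact
  have [measurable]: "X \<in> borel_measurable M" "Y \<in> borel_measurable M"
      "\<phi>1 \<in> borel_measurable borel" "\<phi>2 \<in> borel_measurable borel"
    and FX: "distr M borel X = F" and GY: "distr M borel Y = G"
    and i1: "integrable M (\<lambda>\<omega>. \<phi>1 (X \<omega>))" and i2: "integrable M (\<lambda>\<omega>. \<phi>2 (Y \<omega>))"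
    using S unfolding sarmanov_def by auto
  have Y0: "\<And>\<omega>. \<omega> \<in> space M \<Longrightarrow> 0 \<le> Y \<omega>" and
    Ylim: "((\<lambda>x. mean_scaled M Fbar Y x / Fbar x) \<longlongrightarrow> moment M Y \<alpha>) at_top"
    using Y by (auto simp: breiman_def)
  have p1: "integrable F \<phi>1" using i1 unfolding FX[symmetric] by (simp add: integrable_distr_eq)
  define \<Phi> where "\<Phi> = (\<lambda>t. \<integral>u. indicator {t<..} u * \<phi>1 u \<partial>F)"
  define E1 where "E1 = (\<integral>u. \<bar>\<phi>1 u\<bar> \<partial>F)"
  have \<Phi>m[measurable]: "\<Phi> \<in> borel_measurable borel" and \<Phi>b: "\<And>t. \<bar>\<Phi> t\<bar> \<le> E1"
    and \<Phi>l: "((\<lambda>t. \<Phi> t / Fbar t) \<longlongrightarrow> d1) at_top"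
    using truncated_kernel[OF p1 lim] unfolding \<Phi>_def E1_def by auto
  have "((\<lambda>x. \<theta> * ((\<integral>\<omega>. \<phi>2 (Y \<omega>) * scaled \<Phi> x (Y \<omega>) \<partial>M) / Fbar x))
      \<longlongrightarrow> \<theta> * (d1 * (\<integral>\<omega>. \<phi>2 (Y \<omega>) * Y \<omega> powr \<alpha> \<partial>M))) at_top"
    using sarmanov_kernel_bounded[OF S law]
  proof
    assume "AE u in F. \<theta> * \<phi>1 u = 0"
    show ?thesis
    proof (cases "\<theta> = 0")
      case False
      with \<open>AE u in F. \<theta> * \<phi>1 u = 0\<close> have z: "AE u in F. \<phi>1 u = 0" by simp
      have "\<Phi> t = (\<integral>u. 0 \<partial>F)" for t unfolding \<Phi>_def
        by (rule integral_cong_AE) (use z in \<open>auto elim: eventually_mono\<close>)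
      then have \<Phi>0: "\<Phi> = (\<lambda>_. 0)" by auto
      with \<Phi>l have "d1 = 0" by (simp add: tendsto_const_iff)
      then show ?thesis using \<Phi>0 by (simp add: scaled_def)
    qed simp
  next
    assume "\<exists>B\<ge>0. \<forall>y\<in>law_support G. \<bar>\<phi>2 y\<bar> \<le> B"
    then obtain B where B: "0 \<le> B" "\<And>y. y \<in> law_support G \<Longrightarrow> \<bar>\<phi>2 y\<bar> \<le> B" by blast
    define w where "w = (\<lambda>\<omega>. max (- B) (min B (\<phi>2 (Y \<omega>))))"
    have [measurable]: "w \<in> borel_measurable M" unfolding w_def by measurable
    have "real_distribution G" unfolding GY[symmetric] by (rule M.real_distribution_distr) simp
    from AE_law_support[OF this] have "AE y in distr M borel Y. \<bar>\<phi>2 y\<bar> \<le> B"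
      unfolding GY by eventually_elim (rule B(2))
    then have "AE \<omega> in M. \<bar>\<phi>2 (Y \<omega>)\<bar> \<le> B" by (simp add: AE_distr_iff)
    then have weq: "AE \<omega> in M. w \<omega> = \<phi>2 (Y \<omega>)" by eventually_elim (auto simp: w_def)
    have "((\<lambda>x. (\<integral>\<omega>. w \<omega> * scaled \<Phi> x (Y \<omega>) \<partial>M) / Fbar x) \<longlongrightarrow> d1 * (\<integral>\<omega>. w \<omega> * Y \<omega> powr \<alpha> \<partial>M)) at_top"
      by (rule weighted_breiman[OF M Y \<Phi>m \<Phi>l \<Phi>b, where W=B]) (use B in \<open>auto simp: w_def\<close>)
    moreover have "(\<integral>\<omega>. w \<omega> * scaled \<Phi> x (Y \<omega>) \<partial>M) = (\<integral>\<omega>. \<phi>2 (Y \<omega>) * scaled \<Phi> x (Y \<omega>) \<partial>M)" for x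
      by (rule integral_cong_AE) (use weq in \<open>auto elim: eventually_mono\<close>)
    moreover have "(\<integral>\<omega>. w \<omega> * Y \<omega> powr \<alpha> \<partial>M) = (\<integral>\<omega>. \<phi>2 (Y \<omega>) * Y \<omega> powr \<alpha> \<partial>M)"
      by (rule integral_cong_AE) (use weq in \<open>auto elim: eventually_mono\<close>)
    ultimately show ?thesis by (intro tendsto_mult_left) simp
  qed
  from tendsto_add[OF Ylim this]
  have "((\<lambda>x. mean_scaled M Fbar Y x / Fbar x + \<theta> * ((\<integral>\<omega>. \<phi>2 (Y \<omega>) * scaled \<Phi> x (Y \<omega>) \<partial>M) / Fbar x))
    \<longlongrightarrow> moment M Y \<alpha> + \<theta> * d1 * (\<integral>\<omega>. \<phi>2 (Y \<omega>) * Y \<omega> powr \<alpha> \<partial>M)) at_top"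
    by (simp add: mult.assoc)
  moreover have "\<forall>\<^sub>F x in at_top. mean_scaled M Fbar Y x / Fbar x + \<theta> * ((\<integral>\<omega>. \<phi>2 (Y \<omega>) * scaled \<Phi> x (Y \<omega>) \<partial>M) / Fbar x)
      = \<P>(\<omega> in M. X \<omega> * Y \<omega> > x) / Fbar x"
    using eventually_ge_at_top[of 0]
  proof eventually_elim
    fix x :: real assume x: "0 \<le> x"
    have E1: "0 \<le> E1" using \<Phi>b[of 0] by linarith
    have "integrable M (\<lambda>\<omega>. \<phi>2 (Y \<omega>) * scaled \<Phi> x (Y \<omega>))"
    proof (rule Bochner_Integration.integrable_bound)
      show "integrable M (\<lambda>\<omega>. E1 * \<phi>2 (Y \<omega>))" using i2 by simp
      show "AE \<omega> in M. norm (\<phi>2 (Y \<omega>) * scaled \<Phi> x (Y \<omega>)) \<le> norm (E1 * \<phi>2 (Y \<omega>))"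
        using \<Phi>b E1 by (intro AE_I2) (auto simp: abs_mult scaled_def mult.commute[of E1] intro!: mult_left_mono)
    qed measurable
    then have "\<P>(\<omega> in M. X \<omega> * Y \<omega> > x)
        = mean_scaled M Fbar Y x + \<theta> * (\<integral>\<omega>. \<phi>2 (Y \<omega>) * scaled \<Phi> x (Y \<omega>) \<partial>M)"
      using sarmanov_product_tail_eq[OF M S Y0 x] scaled_Fbar_integrable[OF M] unfolding \<Phi>_def by simp
    then show "mean_scaled M Fbar Y x / Fbar x + \<theta> * ((\<integral>\<omega>. \<phi>2 (Y \<omega>) * scaled \<Phi> x (Y \<omega>) \<partial>M) / Fbar x)
      = \<P>(\<omega> in M. X \<omega> * Y \<omega> > x) / Fbar x" by (simp add: add_divide_distrib)
  qed
  ultimately show ?thesis by (rule Lim_transform_eventually)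
qed

end

section \<open>Tails of sums with summable tail bounds\<close>

lemma powr_convex_atLeast:
  assumes p: "1 \<le> p" shows "convex_on {0..} (\<lambda>x::real. x powr p)"
proof (rule convex_onI)
  have scale: "(t * y) powr p \<le> t * y powr p" if "0 < t" "t < 1" "0 \<le> y" for t y :: real
  proof -
    have "t powr p \<le> t powr 1" using that p by (intro powr_mono') auto
    then have "t powr p * y powr p \<le> t * y powr p" using that by (intro mult_right_mono) auto
    then show ?thesis using that by (simp add: powr_mult)
  qed
  fix t x y :: real assume t: "0 < t" "t < 1" and xy: "x \<in> {0..}" "y \<in> {0..}"
  consider "x = 0" | "y = 0" | "0 < x" "0 < y" using xy by fastforce
  then show "((1 - t) *\<^sub>R x + t *\<^sub>R y) powr p \<le> (1 - t) * x powr p + t * y powr p"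
  proof cases
    case 1 then show ?thesis using scale[of t y] t xy by simp
  next
    case 2 then show ?thesis using scale[of "1 - t" x] t xy by simp
  next
    case 3 then show ?thesis using convex_onD[OF powr_convex[OF p], of t x y] t by simp
  qed
qed simp

text \<open>Convexity with weights proportional to \<open>b i\<close>.  When the expectation of \<open>T i powr p\<close> is at most
\<open>b i powr p\<close> times a constant, this yields the bound that Minkowski's inequality would give.\<close>

lemma powr_sum_jensen:
  fixes T b :: "'i \<Rightarrow> real"
  assumes I: "finite I" "I \<noteq> {}" and b: "\<And>i. i \<in> I \<Longrightarrow> 0 < b i" and T: "\<And>i. i \<in> I \<Longrightarrow> 0 \<le> T i" and p: "1 \<le> p"
  shows "(\<Sum>i\<in>I. T i) powr p \<le> (\<Sum>i\<in>I. b i) powr (p - 1) * (\<Sum>i\<in>I. b i * (T i / b i) powr p)"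
proof -
  define B where "B = (\<Sum>i\<in>I. b i)"
  have B: "0 < B" unfolding B_def using I b by (intro sum_pos) auto
  have conv: "convex_on {0..} (\<lambda>x::real. x powr p)" by (rule powr_convex_atLeast[OF p])
  have "(\<Sum>i\<in>I. (b i / B) *\<^sub>R (B * T i / b i)) powr p \<le> (\<Sum>i\<in>I. (b i / B) * (B * T i / b i) powr p)"
  proof (rule convex_on_sum[OF I(1) I(2) conv])
    show "(\<Sum>i\<in>I. b i / B) = 1" using B by (simp add: B_def sum_divide_distrib[symmetric])
    show "0 \<le> b i / B" "B * T i / b i \<in> {0..}" if "i \<in> I" for i
      using b[OF that] T[OF that] B by auto
  qed
  also have "(\<Sum>i\<in>I. (b i / B) *\<^sub>R (B * T i / b i)) = (\<Sum>i\<in>I. T i)"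
    using b B by (intro sum.cong) (auto simp: less_imp_neq[THEN not_sym])
  also have "(\<Sum>i\<in>I. (b i / B) * (B * T i / b i) powr p) = B powr (p - 1) * (\<Sum>i\<in>I. b i * (T i / b i) powr p)"
    unfolding sum_distrib_left
  proof (rule sum.cong[OF refl])
    fix i assume i: "i \<in> I"
    have "(B * T i / b i) powr p = B powr p * (T i / b i) powr p"
      using B T[OF i] b[OF i] by (simp flip: powr_mult)
    moreover have "B powr p = B * B powr (p - 1)" using B by (simp add: powr_mult_base)
    ultimately show "(b i / B) * (B * T i / b i) powr p = B powr (p - 1) * (b i * (T i / b i) powr p)"
      using B by simp
  qed
  finally show ?thesis unfolding B_def .
qed

context rv_law begin

text \<open>The other half of Potter's bounds, extended down to \<open>u = 0\<close>.  This works because \<open>r\<close> exceeds both \<open>q\<close>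
and \<open>\<alpha>\<close>: near zero the right-hand side grows faster than the left-hand side, and
\<open>x powr r * Fbar x\<close> is bounded away from zero.\<close>

lemma weighted_tail_comparison:
  assumes q: "0 \<le> q" "q < \<alpha>" and r: "\<alpha> < r"
  obtains C x0 where "0 \<le> C" "0 < x0"
    "\<And>x u. x0 \<le> x \<Longrightarrow> 0 < u \<Longrightarrow> u \<le> x \<Longrightarrow> Fbar u * max 1 (u powr (-q)) \<le> C * (x / u) powr r * Fbar x"
proof -
  obtain C t where C: "1 \<le> C" "0 < t"
    and pot: "\<And>l s. 1 \<le> l \<Longrightarrow> t \<le> s \<Longrightarrow> Fbar s \<le> C * l powr r * Fbar (l * s)"
    using potter_lower[OF r] by blast
  define t0 where "t0 = max 1 t"
  have t0: "1 \<le> t0" "t \<le> t0" unfolding t0_def by auto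
  define K' where "K' = C * t0 powr r / Fbar t0"
  have K': "0 \<le> K'" unfolding K'_def using C Fbar_nonneg by auto
  show ?thesis
  proof (rule that[of "max C K'" t0])
    show "0 \<le> max C K'" using K' by simp
    show "0 < t0" using t0 by simp
    fix x u :: real assume x: "t0 \<le> x" and u: "0 < u" "u \<le> x"
    have x0: "0 < x" using x t0 by simp
    show "Fbar u * max 1 (u powr (-q)) \<le> max C K' * (x / u) powr r * Fbar x"
    proof (cases "t0 \<le> u")
      case True
      have "u powr (-q) \<le> 1" using True t0 q by (simp add: powr_minus_divide ge_one_powr_ge_zero)
      then have "Fbar u * max 1 (u powr (-q)) = Fbar u" by (simp add: max_absorb1)
      also have "\<dots> \<le> C * (x / u) powr r * Fbar (x / u * u)" using True t0 u by (intro pot) auto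
      also have "\<dots> \<le> max C K' * (x / u) powr r * Fbar x"
        using u Fbar_nonneg by (auto intro!: mult_right_mono)
      finally show ?thesis .
    next
      case False
      have "Fbar t0 \<le> C * (x / t0) powr r * Fbar (x / t0 * t0)" using t0 x by (intro pot) auto
      also have "\<dots> = C * (x / t0) powr r * Fbar x" using t0 by simp
      finally have 1: "1 \<le> C / Fbar t0 * (x / t0) powr r * Fbar x" using Fbar_pos[of t0] by (simp add: field_simps)
      have 2: "Fbar u * max 1 (u powr (-q)) \<le> t0 powr r * (t0 / u) powr r"
      proof -
        have "1 \<le> t0 powr r" using t0 r alpha_pos by (intro ge_one_powr_ge_zero) auto
        moreover have "1 \<le> (t0 / u) powr r" using False u r alpha_pos by (intro ge_one_powr_ge_zero) auto
        moreover have "u powr (-q) \<le> t0 powr r * (t0 / u) powr r"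
        proof (cases "u \<le> 1")
          case True
          have "u powr (-q) \<le> u powr (- r)" using True u q r by (intro powr_mono') auto
          also have "\<dots> = (1 / u) powr r" using u by (simp add: powr_divide powr_minus field_simps)
          also have "\<dots> \<le> (t0 / u) powr r" using u t0 r alpha_pos by (intro powr_mono2) (auto simp: field_simps)
          also have "\<dots> \<le> t0 powr r * (t0 / u) powr r"
            using mult_right_mono[OF \<open>1 \<le> t0 powr r\<close>, of "(t0 / u) powr r"] by simp
          finally show ?thesis .
        next
          case False
          then have "u powr (-q) \<le> 1" using q by (simp add: powr_minus_divide ge_one_powr_ge_zero)
          then show ?thesis using calculation mult_mono[of 1 "t0 powr r" 1 "(t0 / u) powr r"] by simp
        qed
        ultimately have "max 1 (u powr (-q)) \<le> t0 powr r * (t0 / u) powr r"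
          using mult_mono[of 1 "t0 powr r" 1 "(t0 / u) powr r"] by simp
        then have "Fbar u * max 1 (u powr (-q)) \<le> 1 * (t0 powr r * (t0 / u) powr r)"
          using Fbar_le_1 Fbar_nonneg by (intro mult_mono) auto
        then show ?thesis by simp
      qed
      also have "\<dots> \<le> t0 powr r * (t0 / u) powr r * (C / Fbar t0 * (x / t0) powr r * Fbar x)"
        using mult_left_mono[OF 1, of "t0 powr r * (t0 / u) powr r"] by simp
      also have "\<dots> = K' * ((t0 / u) powr r * (x / t0) powr r) * Fbar x" unfolding K'_def by simp
      also have "(t0 / u) powr r * (x / t0) powr r = (x / u) powr r"
        using t0 by (simp flip: powr_mult)
      also have "K' * (x / u) powr r * Fbar x \<le> max C K' * (x / u) powr r * Fbar x"
        using Fbar_nonneg by (intro mult_right_mono) auto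
      finally show ?thesis .
    qed
  qed
qed

text \<open>Since \<open>p\<close> exceeds \<open>\<alpha>\<close>, the moment truncated at \<open>x\<close> is dominated by the values near \<open>x\<close>.  Summing
over the dyadic levels below \<open>x\<close>, the contributions decrease geometrically.\<close>

lemma truncated_power_moment:
  fixes M :: "'b measure"
  assumes M: "prob_space M" and q: "0 \<le> q" "q < \<alpha>" and p: "\<alpha> < p"
  obtains C x0 where "0 \<le> C" "0 < x0"
    "\<And>V \<beta> x. V \<in> borel_measurable M \<Longrightarrow> (\<And>\<omega>. \<omega> \<in> space M \<Longrightarrow> 0 \<le> V \<omega>) \<Longrightarrow> 0 \<le> \<beta> \<Longrightarrow>
      (\<And>u. 0 < u \<Longrightarrow> \<P>(\<omega> in M. V \<omega> > u) \<le> \<beta> * (Fbar u * max 1 (u powr (-q)))) \<Longrightarrow> x0 \<le> x \<Longrightarrow>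
      (\<integral>\<omega>. min (V \<omega>) x powr p \<partial>M) \<le> C * \<beta> * x powr p * Fbar x"
proof -
  interpret M: prob_space M by fact
  \<comment> \<open>Any exponent strictly between \<open>\<alpha>\<close> and \<open>p\<close> makes the ratio \<open>s\<close> below less than one.\<close>
  define r where "r = (\<alpha> + p) / 2"
  have r: "\<alpha> < r" "r < p" using p unfolding r_def by auto
  obtain C x0 where C: "0 \<le> C" "0 < x0" and
    cmp: "\<And>x u. x0 \<le> x \<Longrightarrow> 0 < u \<Longrightarrow> u \<le> x \<Longrightarrow> Fbar u * max 1 (u powr (-q)) \<le> C * (x / u) powr r * Fbar x"
    using weighted_tail_comparison[OF q r(1)] by blast
  define s where "s = (2::real) powr (r - p)"
  have s: "0 < s" "s < 1" unfolding s_def using r by (auto simp: powr_less_one)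
  define K where "K = C * 2 powr r / (1 - s)"
  show ?thesis
  proof (rule that[of K x0])
    show "0 \<le> K" unfolding K_def using C s by auto
    show "0 < x0" by fact
    fix V :: "'b \<Rightarrow> real" and \<beta> x :: real
    assume V[measurable]: "V \<in> borel_measurable M" and V0: "\<And>\<omega>. \<omega> \<in> space M \<Longrightarrow> 0 \<le> V \<omega>" and \<beta>: "0 \<le> \<beta>"
      and Vt: "\<And>u. 0 < u \<Longrightarrow> \<P>(\<omega> in M. V \<omega> > u) \<le> \<beta> * (Fbar u * max 1 (u powr (-q)))"
      and x: "x0 \<le> x"
    have x': "0 < x" using x C by simp
    have p0: "0 < p" using p alpha_pos by simp
    let ?D = "\<lambda>k. {\<omega> \<in> space M. V \<omega> > x / 2 ^ Suc k}"
    have pt: "ennreal (min (V \<omega>) x powr p) \<le> (\<Sum>k. ennreal ((x / 2 ^ k) powr p) * indicator (?D k) \<omega>)"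
      if \<omega>: "\<omega> \<in> space M" for \<omega>
    proof (cases "V \<omega> = 0")
      case False
      define T where "T = min (V \<omega>) x"
      have T: "0 < T" "T \<le> x" "T \<le> V \<omega>" unfolding T_def using False V0[OF \<omega>] x' by auto
      have "1 \<le> x / T" using T by simp
      then obtain n :: nat where n: "2 ^ n \<le> x / T" "x / T < 2 * 2 ^ n" by (rule dyadic_step)
      have Tn: "T \<le> x / 2 ^ n" "x / 2 ^ Suc n < T" using n T by (auto simp: field_simps)
      have "ennreal (T powr p) \<le> ennreal ((x / 2 ^ n) powr p)"
        using T Tn p0 by (intro ennreal_leI powr_mono2) auto
      also have "\<dots> = (\<Sum>k\<in>{n}. ennreal ((x / 2 ^ k) powr p) * indicator (?D k) \<omega>)"
        using Tn T \<omega> by simp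
      also have "\<dots> \<le> (\<Sum>k. ennreal ((x / 2 ^ k) powr p) * indicator (?D k) \<omega>)"
        by (intro sum_le_suminf) auto
      finally show ?thesis unfolding T_def .
    qed (use x' in simp)
    have level: "ennreal ((x / 2 ^ k) powr p) * emeasure M (?D k) \<le> ennreal (C * 2 powr r * \<beta> * x powr p * Fbar x * s ^ k)" for k
    proof -
      define u where "u = x / 2 ^ Suc k"
      have u: "0 < u" "u \<le> x" unfolding u_def using x' one_le_power[of "2::real" "Suc k"] by (auto simp: field_simps simp del: power_Suc)
      have "measure M (?D k) \<le> \<beta> * (C * (x / u) powr r * Fbar x)"
        using Vt[OF u(1)] mult_left_mono[OF cmp[OF x u] \<beta>] unfolding u_def by linarith
      then have "(x / 2 ^ k) powr p * measure M (?D k) \<le> (x / 2 ^ k) powr p * (\<beta> * (C * (x / u) powr r * Fbar x))"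
        by (intro mult_left_mono) auto
      also have "x / u = 2 ^ Suc k" unfolding u_def using x' by simp
      also have "(x / 2 ^ k) powr p * (\<beta> * (C * (2 ^ Suc k) powr r * Fbar x)) = C * 2 powr r * \<beta> * x powr p * Fbar x * s ^ k"
      proof -
        have "(x / 2 ^ k) powr p = x powr p * 2 powr (- p * real k)"
        proof -
          have "(2 ^ k :: real) powr p = 2 powr (p * real k)"
            by (simp add: powr_powr mult.commute flip: powr_realpow)
          then show ?thesis unfolding powr_divide by (simp add: powr_minus divide_inverse)
        qed
        moreover have "(2 ^ Suc k :: real) powr r = 2 powr r * 2 powr (r * real k)"
          by (simp add: powr_mult powr_powr mult.commute flip: powr_realpow)
        moreover have "s ^ k = 2 powr (- p * real k) * 2 powr (r * real k)"
          unfolding s_def by (simp add: powr_power flip: powr_add) (simp add: algebra_simps)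
        ultimately show ?thesis by simp
      qed
      finally show ?thesis by (simp add: M.emeasure_eq_measure flip: ennreal_mult) (intro ennreal_leI)
    qed
    have "ennreal (\<integral>\<omega>. min (V \<omega>) x powr p \<partial>M) = (\<integral>\<^sup>+\<omega>. ennreal (min (V \<omega>) x powr p) \<partial>M)"
    proof (intro nn_integral_eq_integral[symmetric] AE_I2)
      show "integrable M (\<lambda>\<omega>. min (V \<omega>) x powr p)"
        by (rule M.integrable_const_bound[where B="x powr p"])
           (use V0 x' p0 in \<open>auto intro!: AE_I2 powr_mono2\<close>)
    qed auto
    also have "\<dots> \<le> (\<integral>\<^sup>+\<omega>. (\<Sum>k. ennreal ((x / 2 ^ k) powr p) * indicator (?D k) \<omega>) \<partial>M)"
      by (rule nn_integral_mono) (rule pt)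
    also have "\<dots> = (\<Sum>k. (\<integral>\<^sup>+\<omega>. ennreal ((x / 2 ^ k) powr p) * indicator (?D k) \<omega> \<partial>M))"
      by (rule nn_integral_suminf) measurable
    also have "\<dots> = (\<Sum>k. ennreal ((x / 2 ^ k) powr p) * emeasure M (?D k))"
      by (intro suminf_cong nn_integral_cmult_indicator) measurable
    also have "\<dots> \<le> (\<Sum>k. ennreal (C * 2 powr r * \<beta> * x powr p * Fbar x * s ^ k))"
      by (intro suminf_le level) auto
    also have "\<dots> = ennreal (\<Sum>k. C * 2 powr r * \<beta> * x powr p * Fbar x * s ^ k)"
      using s C \<beta> Fbar_nonneg by (intro suminf_ennreal2 summable_mult summable_geometric) auto
    also have "(\<Sum>k. C * 2 powr r * \<beta> * x powr p * Fbar x * s ^ k) = K * \<beta> * x powr p * Fbar x"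
      using s by (subst suminf_mult) (auto simp: suminf_geometric K_def intro: summable_geometric)
    finally show "(\<integral>\<omega>. min (V \<omega>) x powr p \<partial>M) \<le> K * \<beta> * x powr p * Fbar x"
      using C s \<beta> Fbar_nonneg by (subst (asm) ennreal_le_iff) (auto simp: K_def)
  qed
qed

text \<open>If a sum of nonnegative terms exceeds \<open>x\<close>, then the sum of the terms truncated at \<open>x\<close> is at least
\<open>x\<close>; Markov's inequality of order \<open>p\<close> applies to the latter.  The constants do not depend on the
index set, which is what allows passing to the tail of an infinite series.\<close>

lemma sum_tail_bound:
  fixes M :: "'b measure"
  assumes M: "prob_space M" and q: "0 \<le> q" "q < \<alpha>" and p: "\<alpha> < p" "1 \<le> p"
  obtains C x0 where "0 \<le> C" "0 < x0"
    "\<And>V b (I::nat set) x. finite I \<Longrightarrow> (\<And>i. i \<in> I \<Longrightarrow> V i \<in> borel_measurable M) \<Longrightarrow>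
      (\<And>i \<omega>. i \<in> I \<Longrightarrow> \<omega> \<in> space M \<Longrightarrow> 0 \<le> V i \<omega>) \<Longrightarrow> (\<And>i. i \<in> I \<Longrightarrow> 0 < b i) \<Longrightarrow>
      (\<And>i u. i \<in> I \<Longrightarrow> 0 < u \<Longrightarrow> \<P>(\<omega> in M. V i \<omega> > u) \<le> b i powr p * (Fbar u * max 1 (u powr (-q)))) \<Longrightarrow>
      x0 \<le> x \<Longrightarrow> \<P>(\<omega> in M. (\<Sum>i\<in>I. V i \<omega>) > x) \<le> C * (\<Sum>i\<in>I. b i) powr p * Fbar x"
proof -
  interpret M: prob_space M by fact
  obtain C x0 where C: "0 \<le> C" "0 < x0" and
    mom: "\<And>V \<beta> x. V \<in> borel_measurable M \<Longrightarrow> (\<And>\<omega>. \<omega> \<in> space M \<Longrightarrow> 0 \<le> V \<omega>) \<Longrightarrow> 0 \<le> \<beta> \<Longrightarrow>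
      (\<And>u. 0 < u \<Longrightarrow> \<P>(\<omega> in M. V \<omega> > u) \<le> \<beta> * (Fbar u * max 1 (u powr (-q)))) \<Longrightarrow> x0 \<le> x \<Longrightarrow>
      (\<integral>\<omega>. min (V \<omega>) x powr p \<partial>M) \<le> C * \<beta> * x powr p * Fbar x"
    by (rule truncated_power_moment[OF M q p(1)]) blast
  show ?thesis
  proof (rule that[of C x0])
    show "0 \<le> C" "0 < x0" by fact+
    fix V :: "nat \<Rightarrow> 'b \<Rightarrow> real" and b :: "nat \<Rightarrow> real" and I :: "nat set" and x :: real
    assume I: "finite I" and V: "\<And>i. i \<in> I \<Longrightarrow> V i \<in> borel_measurable M"
      and V0: "\<And>i \<omega>. i \<in> I \<Longrightarrow> \<omega> \<in> space M \<Longrightarrow> 0 \<le> V i \<omega>" and b: "\<And>i. i \<in> I \<Longrightarrow> 0 < b i"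
      and Vt: "\<And>i u. i \<in> I \<Longrightarrow> 0 < u \<Longrightarrow> \<P>(\<omega> in M. V i \<omega> > u) \<le> b i powr p * (Fbar u * max 1 (u powr (-q)))"
      and x: "x0 \<le> x"
    have x': "0 < x" using x C by simp
    define B where "B = (\<Sum>i\<in>I. b i)"
    show "\<P>(\<omega> in M. (\<Sum>i\<in>I. V i \<omega>) > x) \<le> C * (\<Sum>i\<in>I. b i) powr p * Fbar x"
    proof (cases "I = {}")
      case True
      have "{\<omega> \<in> space M. (\<Sum>i\<in>I. V i \<omega>) > x} = {}" using True x' by auto
      then have "\<P>(\<omega> in M. (\<Sum>i\<in>I. V i \<omega>) > x) = 0" by (simp only: measure_empty)
      then show ?thesis using C Fbar_nonneg by simp
    next
      case False
      have B: "0 < B" unfolding B_def using I False b by (intro sum_pos) auto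
      let ?T = "\<lambda>i \<omega>. min (V i \<omega>) x"
      let ?R = "\<lambda>\<omega>. B powr (p - 1) * (\<Sum>i\<in>I. b i * (?T i \<omega> / b i) powr p)"
      have Tint: "integrable M (\<lambda>\<omega>. ?T i \<omega> powr p)" if "i \<in> I" for i
      proof (rule M.integrable_const_bound[where B="x powr p"])
        note V[OF that, measurable]
        show "(\<lambda>\<omega>. ?T i \<omega> powr p) \<in> borel_measurable M" by measurable
        show "AE \<omega> in M. norm (?T i \<omega> powr p) \<le> x powr p"
          using V0[OF that] x' p by (auto intro!: AE_I2 powr_mono2)
      qed
      have div: "b i * (?T i \<omega> / b i) powr p = b i * (1 / b i powr p) * ?T i \<omega> powr p" if "i \<in> I" "\<omega> \<in> space M" for i \<omega>
        using b[OF that(1)] V0[OF that] x' by (simp add: powr_divide)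
      have Rint: "integrable M (\<lambda>\<omega>. b i * (1 / b i powr p) * ?T i \<omega> powr p)" if "i \<in> I" for i
        using Tint[OF that] by (intro integrable_mult_right)
      have Rint': "integrable M (\<lambda>\<omega>. b i * (?T i \<omega> / b i) powr p)" if "i \<in> I" for i
        using Rint[OF that] div[OF that] by (simp cong: Bochner_Integration.integrable_cong)
      have Vs[measurable]: "(\<lambda>\<omega>. \<Sum>i\<in>I. V i \<omega>) \<in> borel_measurable M" by (intro borel_measurable_sum V)
      have "x powr p * \<P>(\<omega> in M. (\<Sum>i\<in>I. V i \<omega>) > x)
          = (\<integral>\<omega>. x powr p * indicator {\<omega> \<in> space M. (\<Sum>i\<in>I. V i \<omega>) > x} \<omega> \<partial>M)"
        by (simp add: Int_def conj_ac cong: conj_cong)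
      also have "\<dots> \<le> (\<integral>\<omega>. ?R \<omega> \<partial>M)"
      proof (rule integral_mono)
        show "integrable M (\<lambda>\<omega>. x powr p * indicator {\<omega> \<in> space M. (\<Sum>i\<in>I. V i \<omega>) > x} \<omega>)"
          by (intro integrable_mult_right M.integrable_const_bound[where B=1]) (auto simp: indicator_def)
        show "integrable M ?R" by (intro integrable_mult_right Bochner_Integration.integrable_sum Rint')
        fix \<omega> assume \<omega>: "\<omega> \<in> space M"
        have jen: "(\<Sum>i\<in>I. ?T i \<omega>) powr p \<le> ?R \<omega>"
          unfolding B_def using V0 \<omega> x' b p by (intro powr_sum_jensen I False) auto
        show "x powr p * indicator {\<omega> \<in> space M. (\<Sum>i\<in>I. V i \<omega>) > x} \<omega> \<le> ?R \<omega>"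
        proof (cases "(\<Sum>i\<in>I. V i \<omega>) > x")
          case True
          \<comment> \<open>Either one summand alone exceeds \<open>x\<close>, or the truncation changes nothing.\<close>
          have "x \<le> (\<Sum>i\<in>I. ?T i \<omega>)"
          proof (cases "\<exists>i\<in>I. x \<le> V i \<omega>")
            case True
            then obtain i where i: "i \<in> I" "x \<le> V i \<omega>" by blast
            have "x = ?T i \<omega>" using i by simp
            also have "\<dots> \<le> (\<Sum>i\<in>I. ?T i \<omega>)" using V0 \<omega> x' I i by (intro member_le_sum) auto
            finally show ?thesis .
          next
            case False
            then have "(\<Sum>i\<in>I. ?T i \<omega>) = (\<Sum>i\<in>I. V i \<omega>)" by (intro sum.cong) auto
            then show ?thesis using True by simp
          qed
          then have "x powr p \<le> (\<Sum>i\<in>I. ?T i \<omega>) powr p" using x' p by (intro powr_mono2) auto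
          with jen True \<omega> show ?thesis by simp
        next
          case False
          have "0 \<le> (\<Sum>i\<in>I. ?T i \<omega>) powr p" by simp
          with jen have "0 \<le> ?R \<omega>" by linarith
          with False show ?thesis by simp
        qed
      qed
      also have "\<dots> = B powr (p - 1) * (\<Sum>i\<in>I. (\<integral>\<omega>. b i * (?T i \<omega> / b i) powr p \<partial>M))"
        unfolding integral_mult_right_zero[of M "B powr (p - 1)"]
        by (subst Bochner_Integration.integral_sum[OF Rint']) auto
      also have "\<dots> \<le> B powr (p - 1) * (\<Sum>i\<in>I. b i * (C * x powr p * Fbar x))"
      proof (intro mult_left_mono sum_mono)
        fix i assume i: "i \<in> I"
        have bp: "0 < b i powr p" using b[OF i] by simp
        have "(\<integral>\<omega>. b i * (?T i \<omega> / b i) powr p \<partial>M) = (\<integral>\<omega>. b i * (1 / b i powr p) * ?T i \<omega> powr p \<partial>M)"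
          using div[OF i] by (intro Bochner_Integration.integral_cong) auto
        also have "\<dots> = b i * (1 / b i powr p) * (\<integral>\<omega>. ?T i \<omega> powr p \<partial>M)"
          by (rule integral_mult_right_zero)
        also have "\<dots> \<le> b i * (1 / b i powr p) * (C * b i powr p * x powr p * Fbar x)"
          using b[OF i] V0 i Vt x by (intro mult_left_mono mom V) auto
        also have "\<dots> = b i * (C * x powr p * Fbar x)" using bp b[OF i] by simp
        finally show "(\<integral>\<omega>. b i * (?T i \<omega> / b i) powr p \<partial>M) \<le> b i * (C * x powr p * Fbar x)" .
      qed simp
      also have "\<dots> = (B powr (p - 1) * B) * (C * x powr p * Fbar x)"
        by (simp add: B_def sum_distrib_right[symmetric])
      also have "B powr (p - 1) * B = B powr p" using B by (simp add: powr_mult_base mult.commute)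
      finally have "x powr p * \<P>(\<omega> in M. (\<Sum>i\<in>I. V i \<omega>) > x) \<le> x powr p * (C * B powr p * Fbar x)"
        by (simp add: mult_ac)
      then show ?thesis unfolding B_def using x' by (simp add: mult_le_cancel_left)
    qed
  qed
qed

end

section \<open>Products of weights and joint exceedances\<close>

lemma nonneg_tendsto_0I:
  fixes f :: "real \<Rightarrow> real"
  assumes "\<And>x. 0 \<le> f x" and "\<And>e. 0 < e \<Longrightarrow> \<exists>g L. (g \<longlongrightarrow> L) at_top \<and> L < e \<and> (\<forall>\<^sub>F x in at_top. f x \<le> g x)"
  shows "(f \<longlongrightarrow> 0) at_top"
proof (rule tendstoI)
  fix e :: real assume "0 < e"
  then obtain g L where g: "(g \<longlongrightarrow> L) at_top" "L < e" "\<forall>\<^sub>F x in at_top. f x \<le> g x" using assms(2) by blast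
  show "\<forall>\<^sub>F x in at_top. dist (f x) 0 < e"
    using order_tendstoD(2)[OF g(1,2)] g(3) by eventually_elim (use assms(1) in \<open>simp add: dist_real_def\<close>)
qed

text \<open>The setting after the dependence between \<open>X\<close> and \<open>Y\<close> and the Denisov-Zwart conditions have been
reduced to three properties of the first pair: Breiman's lemma for \<open>Y 1\<close>, a tail of \<open>Y 1\<close> that is
negligible, and the tail of the product \<open>X 1 * Y 1\<close>.\<close>

locale iid_perpetuity = rv_law F \<alpha> for F \<alpha> +
  fixes M :: "'a measure" and X Y :: "nat \<Rightarrow> 'a \<Rightarrow> real" and k \<rho> :: real
  assumes prob: "prob_space M"
    and indep: "prob_space.indep_vars M (\<lambda>_. borel \<Otimes>\<^sub>M borel) (\<lambda>i \<omega>. (X i \<omega>, Y i \<omega>)) {1..}"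
    and ident: "\<forall>i\<ge>1. distr M (borel \<Otimes>\<^sub>M borel) (\<lambda>\<omega>. (X i \<omega>, Y i \<omega>))
              = distr M (borel \<Otimes>\<^sub>M borel) (\<lambda>\<omega>. (X 1 \<omega>, Y 1 \<omega>))"
    and Y_nonneg: "\<And>i \<omega>. 1 \<le> i \<Longrightarrow> \<omega> \<in> space M \<Longrightarrow> 0 \<le> Y i \<omega>"
    and Y_breiman: "breiman M (Y 1)"
    and \<rho>_def: "\<rho> = moment M (Y 1) \<alpha>" and \<rho>_less_1: "\<rho> < 1"
    and Y_tail: "((\<lambda>t. \<P>(\<omega> in M. Y 1 \<omega> > t) / Fbar t) \<longlongrightarrow> 0) at_top"
    and XY_tail: "((\<lambda>t. \<P>(\<omega> in M. X 1 \<omega> * Y 1 \<omega> > t) / Fbar t) \<longlongrightarrow> k) at_top"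
begin

sublocale M: prob_space M by (rule prob)

abbreviation \<zeta> :: "nat \<Rightarrow> 'a \<Rightarrow> real" where "\<zeta> \<equiv> zeta_prod Y"

definition Z :: "nat \<Rightarrow> 'a \<Rightarrow> real" where "Z i \<omega> = \<zeta> i \<omega> * (X i \<omega> * Y i \<omega>)"

lemma XY_measurable: "1 \<le> i \<Longrightarrow> X i \<in> borel_measurable M" "1 \<le> i \<Longrightarrow> Y i \<in> borel_measurable M"
proof -
  assume "1 \<le> i"
  then have "(\<lambda>\<omega>. (X i \<omega>, Y i \<omega>)) \<in> measurable M (borel \<Otimes>\<^sub>M borel)"
    using indep unfolding M.indep_vars_def by auto
  from measurable_compose[OF this measurable_fst] measurable_compose[OF this measurable_snd]
  show "X i \<in> borel_measurable M" "Y i \<in> borel_measurable M" by auto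
qed

lemma zeta_measurable[measurable]: "\<zeta> i \<in> borel_measurable M"
  unfolding zeta_prod_def by (intro borel_measurable_prod XY_measurable) auto

lemma Z_measurable: "1 \<le> i \<Longrightarrow> Z i \<in> borel_measurable M"
  unfolding Z_def using XY_measurable by (auto intro!: borel_measurable_times)

lemma zeta_nonneg: "\<omega> \<in> space M \<Longrightarrow> 0 \<le> \<zeta> i \<omega>"
  unfolding zeta_prod_def by (intro prod_nonneg Y_nonneg) auto

lemma zeta_1: "\<zeta> (Suc 0) \<omega> = 1" by (simp add: zeta_prod_def)

lemma zeta_Suc: "1 \<le> i \<Longrightarrow> \<zeta> (Suc i) \<omega> = \<zeta> i \<omega> * Y i \<omega>"
  by (simp add: zeta_prod_def prod.atLeastLessThan_Suc)

lemma zeta_split: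
  assumes "1 \<le> i" "i < j" shows "\<zeta> j \<omega> = \<zeta> (Suc i) \<omega> * (\<Prod>l\<in>{Suc i..<j}. Y l \<omega>)"
  unfolding zeta_prod_def using assms
  by (subst prod.union_disjoint[symmetric]) (auto intro!: prod.cong)

lemma ident_integral:
  assumes "1 \<le> i" and f[measurable]: "f \<in> borel_measurable (borel \<Otimes>\<^sub>M borel)"
  shows "(\<integral>\<omega>. f (X i \<omega>, Y i \<omega>) \<partial>M) = (\<integral>\<omega>. f (X 1 \<omega>, Y 1 \<omega>) \<partial>M :: real)"
    and "integrable M (\<lambda>\<omega>. f (X i \<omega>, Y i \<omega>)) = integrable M (\<lambda>\<omega>. f (X 1 \<omega>, Y 1 \<omega>))"
proof -
  note [measurable] = XY_measurable[OF assms(1)] XY_measurable[OF order_refl] XY_measurable[of "Suc 0", simplified]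
  let ?P = "borel \<Otimes>\<^sub>M borel :: (real \<times> real) measure"
  have "(\<integral>\<omega>. f (X i \<omega>, Y i \<omega>) \<partial>M) = integral\<^sup>L (distr M ?P (\<lambda>\<omega>. (X i \<omega>, Y i \<omega>))) f"
    by (subst integral_distr) auto
  also have "\<dots> = integral\<^sup>L (distr M ?P (\<lambda>\<omega>. (X 1 \<omega>, Y 1 \<omega>))) f" using ident[rule_format, OF assms(1)] by (simp only:)
  also have "\<dots> = (\<integral>\<omega>. f (X 1 \<omega>, Y 1 \<omega>) \<partial>M)" by (subst integral_distr) auto
  finally show "(\<integral>\<omega>. f (X i \<omega>, Y i \<omega>) \<partial>M) = (\<integral>\<omega>. f (X 1 \<omega>, Y 1 \<omega>) \<partial>M)" .
  have "integrable M (\<lambda>\<omega>. f (X i \<omega>, Y i \<omega>)) = integrable (distr M ?P (\<lambda>\<omega>. (X i \<omega>, Y i \<omega>))) f"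
    by (subst integrable_distr_eq) auto
  also have "\<dots> = integrable (distr M ?P (\<lambda>\<omega>. (X 1 \<omega>, Y 1 \<omega>))) f" using ident[rule_format, OF assms(1)] by (simp only:)
  also have "\<dots> = integrable M (\<lambda>\<omega>. f (X 1 \<omega>, Y 1 \<omega>))" by (subst integrable_distr_eq) auto
  finally show "integrable M (\<lambda>\<omega>. f (X i \<omega>, Y i \<omega>)) = integrable M (\<lambda>\<omega>. f (X 1 \<omega>, Y 1 \<omega>))" .
qed

lemma ident_measure:
  assumes "1 \<le> i" and A[measurable]: "A \<in> sets (borel \<Otimes>\<^sub>M borel)"
  shows "\<P>(\<omega> in M. (X i \<omega>, Y i \<omega>) \<in> A) = \<P>(\<omega> in M. (X 1 \<omega>, Y 1 \<omega>) \<in> A)"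
proof -
  note [measurable] = XY_measurable[OF assms(1)] XY_measurable[OF order_refl] XY_measurable[of "Suc 0", simplified]
  let ?P = "borel \<Otimes>\<^sub>M borel :: (real \<times> real) measure"
  have "\<P>(\<omega> in M. (X j \<omega>, Y j \<omega>) \<in> A) = measure (distr M ?P (\<lambda>\<omega>. (X j \<omega>, Y j \<omega>))) A" if "1 \<le> j" for j
  proof -
    note [measurable] = XY_measurable[OF that]
    show ?thesis by (subst measure_distr) (auto intro!: arg_cong[where f="measure M"])
  qed
  from this[OF assms(1)] this[OF order_refl] show ?thesis using ident[rule_format, OF assms(1)] by (simp only:)
qed

lemma Y_breiman_all: assumes "1 \<le> i" shows "breiman M (Y i)" and "moment M (Y i) \<alpha> = \<rho>"
proof -
  have 1: "mean_scaled M Fbar (Y i) x = mean_scaled M Fbar (Y 1) x" for x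
    using ident_integral(1)[OF assms, of "\<lambda>z. scaled Fbar x (snd z)"] by simp
  have 2: "integrable M (\<lambda>\<omega>. Y i \<omega> powr \<alpha>) = integrable M (\<lambda>\<omega>. Y 1 \<omega> powr \<alpha>)"
    using ident_integral(2)[OF assms, of "\<lambda>z. snd z powr \<alpha>"] by simp
  have 3: "moment M (Y i) \<alpha> = moment M (Y 1) \<alpha>"
    using ident_integral(1)[OF assms, of "\<lambda>z. snd z powr \<alpha>"] by simp
  show "moment M (Y i) \<alpha> = \<rho>" using 3 \<rho>_def by simp
  show "breiman M (Y i)"
    using Y_breiman Y_nonneg[OF assms] XY_measurable(2)[OF assms] unfolding breiman_def 1 2 3 by auto
qed

lemma Y_tail_all: "1 \<le> i \<Longrightarrow> ((\<lambda>t. \<P>(\<omega> in M. Y i \<omega> > t) / Fbar t) \<longlongrightarrow> 0) at_top"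
proof -
  assume i: "1 \<le> i"
  have "\<P>(\<omega> in M. Y i \<omega> > t) = \<P>(\<omega> in M. Y 1 \<omega> > t)" for t
    using ident_measure[OF i, of "UNIV \<times> {t<..}"] by simp
  then show ?thesis using Y_tail by simp
qed

lemma XY_tail_all: "1 \<le> i \<Longrightarrow> ((\<lambda>t. \<P>(\<omega> in M. X i \<omega> * Y i \<omega> > t) / Fbar t) \<longlongrightarrow> k) at_top"
  and XY_tail_eq: "1 \<le> i \<Longrightarrow> \<P>(\<omega> in M. X i \<omega> * Y i \<omega> > t) = \<P>(\<omega> in M. X 1 \<omega> * Y 1 \<omega> > t)"
proof -
  assume i: "1 \<le> i"
  have *: "\<P>(\<omega> in M. X i \<omega> * Y i \<omega> > t) = \<P>(\<omega> in M. X 1 \<omega> * Y 1 \<omega> > t)" for t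
    using ident_measure[OF i product_set_measurable] by simp
  then show "((\<lambda>t. \<P>(\<omega> in M. X i \<omega> * Y i \<omega> > t) / Fbar t) \<longlongrightarrow> k) at_top" using XY_tail by simp
  show "\<P>(\<omega> in M. X i \<omega> * Y i \<omega> > t) = \<P>(\<omega> in M. X 1 \<omega> * Y 1 \<omega> > t)" by (rule *)
qed

text \<open>Every use of independence below concerns a function of the pairs with index less than \<open>m\<close> and a
function of the remaining pairs.\<close>

lemma block_indep:
  fixes f g :: "(nat \<Rightarrow> real \<times> real) \<Rightarrow> real"
  assumes m: "1 \<le> m" and f: "f \<in> borel_measurable (PiM {1..<m} (\<lambda>_. borel \<Otimes>\<^sub>M borel))"
    and g: "g \<in> borel_measurable (PiM {m..} (\<lambda>_. borel \<Otimes>\<^sub>M borel))"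
    and V: "\<And>\<omega>. \<omega> \<in> space M \<Longrightarrow> V \<omega> = f (\<lambda>i\<in>{1..<m}. (X i \<omega>, Y i \<omega>))"
    and Q: "\<And>\<omega>. \<omega> \<in> space M \<Longrightarrow> Q \<omega> = g (\<lambda>i\<in>{m..}. (X i \<omega>, Y i \<omega>))"
  shows "M.indep_var borel V borel Q"
proof -
  have "M.indep_var (PiM {1..<m} (\<lambda>_. borel \<Otimes>\<^sub>M borel)) (\<lambda>\<omega>. \<lambda>i\<in>{1..<m}. (X i \<omega>, Y i \<omega>))
      (PiM {m..} (\<lambda>_. borel \<Otimes>\<^sub>M borel)) (\<lambda>\<omega>. \<lambda>i\<in>{m..}. (X i \<omega>, Y i \<omega>))"
    by (rule M.indep_var_restrict[OF indep]) (use m in auto)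
  from M.indep_var_compose[OF this f g]
  have ind: "M.indep_var borel (\<lambda>\<omega>. f (\<lambda>i\<in>{1..<m}. (X i \<omega>, Y i \<omega>))) borel (\<lambda>\<omega>. g (\<lambda>i\<in>{m..}. (X i \<omega>, Y i \<omega>)))"
    by (simp add: comp_def)
  have Vm: "V \<in> borel_measurable M"
    using M.indep_var_rv1[OF ind] V by (simp cong: measurable_cong)
  have Qm: "Q \<in> borel_measurable M"
    using M.indep_var_rv2[OF ind] Q by (simp cong: measurable_cong)
  have dV: "distr M borel V = distr M borel (\<lambda>\<omega>. f (\<lambda>i\<in>{1..<m}. (X i \<omega>, Y i \<omega>)))"
    and dQ: "distr M borel Q = distr M borel (\<lambda>\<omega>. g (\<lambda>i\<in>{m..}. (X i \<omega>, Y i \<omega>)))"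
    and dVQ: "distr M (borel \<Otimes>\<^sub>M borel) (\<lambda>\<omega>. (V \<omega>, Q \<omega>)) = distr M (borel \<Otimes>\<^sub>M borel)
      (\<lambda>\<omega>. (f (\<lambda>i\<in>{1..<m}. (X i \<omega>, Y i \<omega>)), g (\<lambda>i\<in>{m..}. (X i \<omega>, Y i \<omega>))))"
    using V Q by (auto intro!: distr_cong)
  show ?thesis using ind Vm Qm unfolding M.indep_var_distribution_eq dV dQ dVQ by auto
qed

lemma component_measurable:
  assumes "i \<in> I"
  shows "(\<lambda>p. fst (p i)) \<in> borel_measurable (PiM I (\<lambda>_. borel \<Otimes>\<^sub>M borel :: (real \<times> real) measure))"
    and "(\<lambda>p. snd (p i)) \<in> borel_measurable (PiM I (\<lambda>_. borel \<Otimes>\<^sub>M borel :: (real \<times> real) measure))"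
proof -
  have "(\<lambda>p. p i) \<in> measurable (PiM I (\<lambda>_. borel \<Otimes>\<^sub>M borel :: (real \<times> real) measure)) (borel \<Otimes>\<^sub>M borel)"
    using measurable_component_singleton[OF assms] .
  from measurable_compose[OF this measurable_fst] measurable_compose[OF this measurable_snd]
  show "(\<lambda>p. fst (p i)) \<in> borel_measurable (PiM I (\<lambda>_. borel \<Otimes>\<^sub>M borel :: (real \<times> real) measure))"
    "(\<lambda>p. snd (p i)) \<in> borel_measurable (PiM I (\<lambda>_. borel \<Otimes>\<^sub>M borel :: (real \<times> real) measure))" by auto
qed

lemma indep_zeta_Y: assumes "1 \<le> i" shows "M.indep_var borel (\<zeta> i) borel (Y i)"
proof (rule block_indep[OF assms])
  show "(\<lambda>p :: nat \<Rightarrow> real \<times> real. \<Prod>j\<in>{1..<i}. snd (p j)) \<in> borel_measurable (PiM {1..<i} (\<lambda>_. borel \<Otimes>\<^sub>M borel))"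
    by (intro borel_measurable_prod component_measurable) auto
  show "(\<lambda>p :: nat \<Rightarrow> real \<times> real. snd (p i)) \<in> borel_measurable (PiM {i..} (\<lambda>_. borel \<Otimes>\<^sub>M borel))"
    by (intro component_measurable) auto
qed (auto simp: zeta_prod_def intro!: prod.cong)

lemma breiman_zeta: assumes "1 \<le> i" shows "breiman M (\<zeta> i)" and "moment M (\<zeta> i) \<alpha> = \<rho> ^ (i - 1)"
proof -
  have "breiman M (\<zeta> i) \<and> moment M (\<zeta> i) \<alpha> = \<rho> ^ (i - 1)"
    using assms
  proof (induction i rule: dec_induct)
    case base
    have b: "breiman M (\<zeta> 1)" by (rule breiman_bounded[OF prob, where c=1]) (auto simp: zeta_1)
    have "(\<integral>\<omega>. \<zeta> 1 \<omega> powr \<alpha> \<partial>M) = \<rho> ^ (1 - 1)" by (simp add: zeta_1 M.prob_space)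
    with b show ?case by (rule conjI)
  next
    case (step i)
    have eq: "\<zeta> (Suc i) = (\<lambda>\<omega>. \<zeta> i \<omega> * Y i \<omega>)" using zeta_Suc[OF step(1)] by auto
    have "(\<rho> ^ (i - 1)) * \<rho> = \<rho> ^ i" using step(1) by (cases i) auto
    then show ?case
      using breiman_product[OF prob _ Y_breiman_all(1)[OF step(1)] indep_zeta_Y[OF step(1)]] step Y_breiman_all(2)[OF step(1)]
      unfolding eq by simp
  qed
  then show "breiman M (\<zeta> i)" "moment M (\<zeta> i) \<alpha> = \<rho> ^ (i - 1)" by auto
qed

lemma indep_zeta_XY:
  assumes "1 \<le> i" shows "M.indep_var borel (\<zeta> i) borel (\<lambda>\<omega>. X i \<omega> * Y i \<omega>)"
proof (rule block_indep[OF assms])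
  show "(\<lambda>p :: nat \<Rightarrow> real \<times> real. \<Prod>j\<in>{1..<i}. snd (p j)) \<in> borel_measurable (PiM {1..<i} (\<lambda>_. borel \<Otimes>\<^sub>M borel))"
    by (intro borel_measurable_prod component_measurable) auto
  show "(\<lambda>p :: nat \<Rightarrow> real \<times> real. fst (p i) * snd (p i)) \<in> borel_measurable (PiM {i..} (\<lambda>_. borel \<Otimes>\<^sub>M borel))"
    by (intro borel_measurable_times component_measurable) auto
qed (auto simp: zeta_prod_def intro!: prod.cong)

lemma indep_restricted_zeta_XY:
  assumes j: "1 \<le> j" "j < i"
  shows "M.indep_var borel (\<lambda>\<omega>. \<zeta> i \<omega> * indicator {\<omega> \<in> space M. N < \<bar>Z j \<omega>\<bar>} \<omega>) borel (\<lambda>\<omega>. X i \<omega> * Y i \<omega>)"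
proof -
  have i: "1 \<le> i" using j by simp
  let ?z = "\<lambda>j (p :: nat \<Rightarrow> real \<times> real). \<Prod>l\<in>{1..<j}. snd (p l)"
  let ?P = "PiM {1..<i} (\<lambda>_. borel \<Otimes>\<^sub>M borel) :: (nat \<Rightarrow> real \<times> real) measure"
  have [measurable]: "?z i \<in> borel_measurable ?P" "?z j \<in> borel_measurable ?P"
      "(\<lambda>p. fst (p j)) \<in> borel_measurable ?P" "(\<lambda>p. snd (p j)) \<in> borel_measurable ?P"
    by (intro borel_measurable_prod component_measurable; use j in auto)+
  show ?thesis
  proof (rule block_indep[OF i])
    show "(\<lambda>p :: nat \<Rightarrow> real \<times> real. ?z i p * (if N < \<bar>?z j p * (fst (p j) * snd (p j))\<bar> then 1 else 0)) \<in> borel_measurable ?P" by measurable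
    show "(\<lambda>p :: nat \<Rightarrow> real \<times> real. fst (p i) * snd (p i)) \<in> borel_measurable (PiM {i..} (\<lambda>_. borel \<Otimes>\<^sub>M borel))"
      by (intro borel_measurable_times component_measurable) auto
  qed (use j in \<open>auto simp: zeta_prod_def Z_def indicator_def intro!: prod.cong\<close>)
qed

lemma indep_Z_future:
  assumes i: "1 \<le> i" "i < j"
  shows "M.indep_var borel (Z i) borel (\<lambda>\<omega>. (\<Prod>l\<in>{Suc i..<j}. Y l \<omega>) * \<bar>X j \<omega> * Y j \<omega>\<bar>)"
proof (rule block_indep[of "Suc i"])
  show "(\<lambda>p :: nat \<Rightarrow> real \<times> real. (\<Prod>l\<in>{1..<i}. snd (p l)) * (fst (p i) * snd (p i))) \<in> borel_measurable (PiM {1..<Suc i} (\<lambda>_. borel \<Otimes>\<^sub>M borel))"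
    using i by (intro borel_measurable_times borel_measurable_prod component_measurable) auto
  show "(\<lambda>p :: nat \<Rightarrow> real \<times> real. (\<Prod>l\<in>{Suc i..<j}. snd (p l)) * \<bar>fst (p j) * snd (p j)\<bar>) \<in> borel_measurable (PiM {Suc i..} (\<lambda>_. borel \<Otimes>\<^sub>M borel))"
    using i by (intro borel_measurable_times borel_measurable_abs borel_measurable_prod component_measurable) auto
qed (use i in \<open>auto simp: zeta_prod_def Z_def intro!: prod.cong\<close>)

lemma Z_tail: "1 \<le> i \<Longrightarrow> ((\<lambda>x. \<P>(\<omega> in M. Z i \<omega> > x) / Fbar x) \<longlongrightarrow> k * \<rho> ^ (i - 1)) at_top"
  using breiman_tail[OF prob breiman_zeta(1) indep_zeta_XY XY_tail_all] breiman_zeta(2) unfolding Z_def by simp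

text \<open>The tail of \<open>Y i\<close> is comparable with constant zero, so \<open>breiman_tail\<close> applies with \<open>k = 0\<close>.\<close>

lemma zeta_tail: "1 \<le> i \<Longrightarrow> ((\<lambda>x. \<P>(\<omega> in M. \<zeta> (Suc i) \<omega> > x) / Fbar x) \<longlongrightarrow> 0) at_top"
  using breiman_tail[OF prob breiman_zeta(1) indep_zeta_Y Y_tail_all] by (simp add: zeta_Suc)

lemma rescale:
  assumes "((\<lambda>x. f x / Fbar x) \<longlongrightarrow> L) at_top" "0 < c"
  shows "((\<lambda>x. f (c * x) / Fbar x) \<longlongrightarrow> L * c powr (-\<alpha>)) at_top"
proof -
  have "filterlim (\<lambda>x::real. c * x) at_top at_top"
    using filterlim_tendsto_pos_mult_at_top[OF tendsto_const assms(2) filterlim_ident] .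
  then have "((\<lambda>x. f (c * x) / Fbar (c * x) * (Fbar (x * c) / Fbar x)) \<longlongrightarrow> L * c powr (-\<alpha>)) at_top"
    by (intro tendsto_mult filterlim_compose[OF assms(1)] Fbar_ratio assms(2))
  then show ?thesis by (simp add: mult.commute[of c])
qed

lemma measure_tail_tendsto_0:
  assumes [measurable]: "R \<in> borel_measurable M"
  shows "((\<lambda>N::real. \<P>(\<omega> in M. N < R \<omega>)) \<longlongrightarrow> 0) at_top"
proof -
  have "((\<lambda>N. \<integral>\<omega>. (if N < R \<omega> then 1 else 0 :: real) \<partial>M) \<longlongrightarrow> (\<integral>\<omega>. 0 \<partial>M)) at_top"
  proof (rule integral_dominated_convergence_at_top[where w="\<lambda>_. 1"])
    show "AE \<omega> in M. ((\<lambda>N. if N < R \<omega> then 1 else 0 :: real) \<longlongrightarrow> 0) at_top"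
    proof (rule AE_I2)
      fix \<omega>
      show "((\<lambda>N. if N < R \<omega> then 1 else 0 :: real) \<longlongrightarrow> 0) at_top"
        by (rule tendsto_eventually, use eventually_ge_at_top[of "R \<omega>"] in eventually_elim) auto
    qed
  qed auto
  moreover have "(\<integral>\<omega>. (if N < R \<omega> then 1 else 0 :: real) \<partial>M) = \<P>(\<omega> in M. N < R \<omega>)" for N
  proof -
    have "(\<integral>\<omega>. (if N < R \<omega> then 1 else 0 :: real) \<partial>M) = (\<integral>\<omega>. indicator {\<omega> \<in> space M. N < R \<omega>} \<omega> \<partial>M)"
      by (intro Bochner_Integration.integral_cong) (auto simp: indicator_def)
    then show ?thesis by (simp add: Int_def conj_ac cong: conj_cong)
  qed
  ultimately show ?thesis by simp
qed

lemma k_nonneg: "0 \<le> k"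
  by (rule tendsto_lowerbound[OF XY_tail]) (auto intro!: always_eventually divide_nonneg_nonneg Fbar_nonneg)

lemma \<rho>_nonneg: "0 \<le> \<rho>" unfolding \<rho>_def by (intro Bochner_Integration.integral_nonneg) auto

text \<open>The earlier term \<open>Z j\<close> is tight and independent of \<open>X i * Y i\<close>.  Requiring it to exceed a fixed level \<open>N\<close>
amounts to restricting the weight \<open>\<zeta> i\<close> to that event, and the \<open>\<alpha>\<close>-th moment of the restricted weight
tends to zero as \<open>N\<close> grows.\<close>

lemma cross_past:
  assumes j: "1 \<le> j" "j < i"
  shows "((\<lambda>x. \<P>(\<omega> in M. x < Z i \<omega> \<and> x < \<bar>Z j \<omega>\<bar>) / Fbar x) \<longlongrightarrow> 0) at_top"
proof (rule nonneg_tendsto_0I)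
  show "0 \<le> \<P>(\<omega> in M. x < Z i \<omega> \<and> x < \<bar>Z j \<omega>\<bar>) / Fbar x" for x
    by (intro divide_nonneg_nonneg Fbar_nonneg) auto
  fix e :: real assume e: "0 < e"
  have i: "1 \<le> i" using j by simp
  note [measurable] = Z_measurable[OF i] Z_measurable[OF j(1)]
  define V where "V = (\<lambda>N \<omega>. \<zeta> i \<omega> * indicator {\<omega> \<in> space M. N < \<bar>Z j \<omega>\<bar>} \<omega>)"
  have Vint: "integrable M (\<lambda>\<omega>. \<zeta> i \<omega> powr \<alpha>)" using breiman_zeta(1)[OF i] by (simp add: breiman_def)
  have "((\<lambda>N. \<integral>\<omega>. V N \<omega> powr \<alpha> \<partial>M) \<longlongrightarrow> (\<integral>\<omega>. 0 \<partial>M)) at_top"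
  proof (rule integral_dominated_convergence_at_top[where w="\<lambda>\<omega>. \<zeta> i \<omega> powr \<alpha>"])
    show "AE \<omega> in M. ((\<lambda>N. V N \<omega> powr \<alpha>) \<longlongrightarrow> 0) at_top"
    proof (rule AE_I2)
      fix \<omega>
      show "((\<lambda>N. V N \<omega> powr \<alpha>) \<longlongrightarrow> 0) at_top"
        by (rule tendsto_eventually, use eventually_ge_at_top[of "\<bar>Z j \<omega>\<bar>"] in eventually_elim) (auto simp: V_def)
    qed
    show "\<forall>\<^sub>F N in at_top. AE \<omega> in M. norm (V N \<omega> powr \<alpha>) \<le> \<zeta> i \<omega> powr \<alpha>"
      by (intro always_eventually allI AE_I2) (auto simp: V_def indicator_def)
  qed (use Vint in \<open>auto simp: V_def\<close>)
  from tendsto_mult_left[OF this, of k]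
  have "\<forall>\<^sub>F N in at_top. k * moment M (V N) \<alpha> < e" using e by (intro order_tendstoD) auto
  from eventually_happens'[OF trivial_limit_at_top_linorder this]
  obtain N where N: "k * moment M (V N) \<alpha> < e" by blast
  have "breiman M (V N)" unfolding V_def by (rule breiman_restrict[OF prob breiman_zeta(1)[OF i]]) measurable
  then have lim: "((\<lambda>x. \<P>(\<omega> in M. V N \<omega> * (X i \<omega> * Y i \<omega>) > x) / Fbar x) \<longlongrightarrow> k * moment M (V N) \<alpha>) at_top"
    using indep_restricted_zeta_XY[OF j, of N] unfolding V_def by (intro breiman_tail[OF prob] XY_tail_all i)
  have [measurable]: "X i \<in> borel_measurable M" "Y i \<in> borel_measurable M" using XY_measurable[OF i] by auto
  have "\<forall>\<^sub>F x in at_top. \<P>(\<omega> in M. x < Z i \<omega> \<and> x < \<bar>Z j \<omega>\<bar>) / Fbar x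
      \<le> \<P>(\<omega> in M. V N \<omega> * (X i \<omega> * Y i \<omega>) > x) / Fbar x"
    using eventually_ge_at_top[of N]
  proof eventually_elim
    fix x assume x: "N \<le> x"
    have [measurable]: "V N \<in> borel_measurable M" unfolding V_def by measurable
    have "{\<omega> \<in> space M. x < Z i \<omega> \<and> x < \<bar>Z j \<omega>\<bar>} \<subseteq> {\<omega> \<in> space M. V N \<omega> * (X i \<omega> * Y i \<omega>) > x}"
    proof safe
      fix \<omega> assume \<omega>: "\<omega> \<in> space M" "x < Z i \<omega>" "x < \<bar>Z j \<omega>\<bar>"
      have "V N \<omega> = \<zeta> i \<omega>" using \<omega> x by (simp add: V_def)
      then show "x < V N \<omega> * (X i \<omega> * Y i \<omega>)" using \<omega>(2) unfolding Z_def by (simp only:)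
    qed
    then have "\<P>(\<omega> in M. x < Z i \<omega> \<and> x < \<bar>Z j \<omega>\<bar>) \<le> \<P>(\<omega> in M. V N \<omega> * (X i \<omega> * Y i \<omega>) > x)"
      by (rule M.finite_measure_mono) measurable
    then show "\<P>(\<omega> in M. x < Z i \<omega> \<and> x < \<bar>Z j \<omega>\<bar>) / Fbar x
      \<le> \<P>(\<omega> in M. V N \<omega> * (X i \<omega> * Y i \<omega>) > x) / Fbar x"
      by (rule divide_right_mono) (rule Fbar_nonneg)
  qed
  from conjI[OF lim conjI[OF N this]] show "\<exists>g L. (g \<longlongrightarrow> L) at_top \<and> L < e \<and>
      (\<forall>\<^sub>F x in at_top. \<P>(\<omega> in M. x < Z i \<omega> \<and> x < \<bar>Z j \<omega>\<bar>) / Fbar x \<le> g x)" by (intro exI)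
qed

text \<open>The later term \<open>Z j\<close> contains the factor \<open>\<zeta> (Suc i)\<close>, which shares \<open>Y i\<close> with \<open>Z i\<close>; its remaining factor
\<open>R\<close> is independent of \<open>Z i\<close>.  Either \<open>R\<close> exceeds a level \<open>N\<close>, which costs a small independent factor,
or \<open>\<zeta> (Suc i)\<close> exceeds \<open>x / N\<close>, which is negligible in itself.\<close>

lemma cross_future:
  assumes i: "1 \<le> i" "i < j"
  shows "((\<lambda>x. \<P>(\<omega> in M. x < Z i \<omega> \<and> x < \<bar>Z j \<omega>\<bar>) / Fbar x) \<longlongrightarrow> 0) at_top"
proof (rule nonneg_tendsto_0I)
  show "0 \<le> \<P>(\<omega> in M. x < Z i \<omega> \<and> x < \<bar>Z j \<omega>\<bar>) / Fbar x" for x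
    by (intro divide_nonneg_nonneg Fbar_nonneg) auto
  fix e :: real assume e: "0 < e"
  have j: "1 \<le> j" using i by simp
  note [measurable] = Z_measurable[OF i(1)] Z_measurable[OF j]
  define R where "R = (\<lambda>\<omega>. (\<Prod>l\<in>{Suc i..<j}. Y l \<omega>) * \<bar>X j \<omega> * Y j \<omega>\<bar>)"
  have ind: "M.indep_var borel (Z i) borel R" using indep_Z_future[OF i] unfolding R_def .
  then have [measurable]: "R \<in> borel_measurable M" by (rule M.indep_var_rv2)
  have ZR: "\<bar>Z j \<omega>\<bar> = \<zeta> (Suc i) \<omega> * R \<omega>" if "\<omega> \<in> space M" for \<omega>
  proof -
    have "0 \<le> (\<Prod>l\<in>{Suc i..<j}. Y l \<omega>)" using that by (intro prod_nonneg Y_nonneg) auto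
    then show ?thesis using zeta_nonneg[OF that, of "Suc i"]
      unfolding Z_def R_def zeta_split[OF i] by (simp add: abs_mult)
  qed
  from tendsto_mult_left[OF measure_tail_tendsto_0[of R], of "k * \<rho> ^ (i - 1)"]
  have "\<forall>\<^sub>F N in at_top. k * \<rho> ^ (i - 1) * \<P>(\<omega> in M. N < R \<omega>) < e"
    using e by (intro order_tendstoD) auto
  from eventually_happens'[OF trivial_limit_at_top_linorder eventually_conj[OF this eventually_gt_at_top[of 0]]]
  obtain N where N: "k * \<rho> ^ (i - 1) * \<P>(\<omega> in M. N < R \<omega>) < e" "0 < N" by auto
  let ?g = "\<lambda>x. \<P>(\<omega> in M. Z i \<omega> > x) / Fbar x * \<P>(\<omega> in M. N < R \<omega>)
      + \<P>(\<omega> in M. \<zeta> (Suc i) \<omega> > 1 / N * x) / Fbar x"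
  have "(?g \<longlongrightarrow> k * \<rho> ^ (i - 1) * \<P>(\<omega> in M. N < R \<omega>) + 0 * (1 / N) powr (-\<alpha>)) at_top"
    using N(2) by (intro tendsto_add tendsto_mult_right Z_tail i(1) rescale[OF zeta_tail]) auto
  moreover have "\<P>(\<omega> in M. x < Z i \<omega> \<and> x < \<bar>Z j \<omega>\<bar>) / Fbar x \<le> ?g x" for x
  proof -
    have "\<P>(\<omega> in M. x < Z i \<omega> \<and> x < \<bar>Z j \<omega>\<bar>)
      \<le> measure M ({\<omega> \<in> space M. x < Z i \<omega> \<and> N < R \<omega>} \<union> {\<omega> \<in> space M. \<zeta> (Suc i) \<omega> > 1 / N * x})"
    proof (rule M.finite_measure_mono)
      show "{\<omega> \<in> space M. x < Z i \<omega> \<and> x < \<bar>Z j \<omega>\<bar>}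
        \<subseteq> {\<omega> \<in> space M. x < Z i \<omega> \<and> N < R \<omega>} \<union> {\<omega> \<in> space M. \<zeta> (Suc i) \<omega> > 1 / N * x}"
      proof safe
        fix \<omega> assume \<omega>: "\<omega> \<in> space M" and a: "x < \<bar>Z j \<omega>\<bar>" and b: "\<not> 1 / N * x < \<zeta> (Suc i) \<omega>"
        show "N < R \<omega>"
        proof (rule ccontr)
          assume "\<not> N < R \<omega>"
          then have "\<zeta> (Suc i) \<omega> * R \<omega> \<le> \<zeta> (Suc i) \<omega> * N"
            using zeta_nonneg[OF \<omega>] by (intro mult_left_mono) auto
          moreover have "\<zeta> (Suc i) \<omega> * N \<le> x" using b N(2) by (simp add: field_simps)
          ultimately show False using a ZR[OF \<omega>] by simp
        qed
      qed
    qed measurable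
    also have "\<dots> \<le> \<P>(\<omega> in M. x < Z i \<omega> \<and> N < R \<omega>) + \<P>(\<omega> in M. \<zeta> (Suc i) \<omega> > 1 / N * x)"
      by (rule measure_Un_le) measurable
    also have "\<P>(\<omega> in M. x < Z i \<omega> \<and> N < R \<omega>)
        = \<P>(\<omega> in M. Z i \<omega> > x) * \<P>(\<omega> in M. N < R \<omega>)"
    proof -
      have "measure M ((\<lambda>\<omega>. (Z i \<omega>, R \<omega>)) -` ({x<..} \<times> {N<..}) \<inter> space M)
          = measure M (Z i -` {x<..} \<inter> space M) * measure M (R -` {N<..} \<inter> space M)"
        using M.indep_varD[OF ind, of "{x<..}" "{N<..}"] by simp
      moreover have "(\<lambda>\<omega>. (Z i \<omega>, R \<omega>)) -` ({x<..} \<times> {N<..}) \<inter> space M = {\<omega> \<in> space M. x < Z i \<omega> \<and> N < R \<omega>}"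
        "Z i -` {x<..} \<inter> space M = {\<omega> \<in> space M. Z i \<omega> > x}" "R -` {N<..} \<inter> space M = {\<omega> \<in> space M. N < R \<omega>}" by auto
      ultimately show ?thesis by simp
    qed
    finally show ?thesis using Fbar_pos[of x] by (simp add: add_divide_distrib[symmetric] divide_right_mono)
  qed
  ultimately show "\<exists>g L. (g \<longlongrightarrow> L) at_top \<and> L < e \<and>
      (\<forall>\<^sub>F x in at_top. \<P>(\<omega> in M. x < Z i \<omega> \<and> x < \<bar>Z j \<omega>\<bar>) / Fbar x \<le> g x)"
    using N(1) by (intro exI[of _ ?g] exI[of _ "k * \<rho> ^ (i - 1) * \<P>(\<omega> in M. N < R \<omega>) + 0 * (1 / N) powr (-\<alpha>)"]) auto
qed

lemma cross_negligible:
  assumes "1 \<le> i" "1 \<le> j" "i \<noteq> j"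
  shows "((\<lambda>x. \<P>(\<omega> in M. x < Z i \<omega> \<and> x < \<bar>Z j \<omega>\<bar>) / Fbar x) \<longlongrightarrow> 0) at_top"
  using cross_past[of j i] cross_future[of i j] assms by (cases "j < i") auto

end

section \<open>The supremum of the partial sums\<close>

text \<open>If a sum exceeds \<open>y\<close> while no term exceeds \<open>(1 - \<delta>) * y\<close>, then, with any one term removed, the others
still add up to more than \<open>\<delta> * y\<close>, so at least two terms are of the order of \<open>y\<close>.\<close>

lemma one_big_jump_upper:
  fixes z :: "nat \<Rightarrow> real"
  assumes sum: "y < (\<Sum>i=1..n. z i)" and y: "0 < y" and n: "1 \<le> n" "n \<le> m" and \<delta>: "0 < \<delta>" "\<delta> < 1"
    and no: "\<And>i. i \<in> {1..m} \<Longrightarrow> z i \<le> (1 - \<delta>) * y"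
  shows "\<exists>i\<in>{1..m}. \<exists>j\<in>{1..m}. i \<noteq> j \<and> \<delta> / m * y < z i \<and> \<delta> / m * y < z j"
proof -
  have m: "0 < real m" using n by simp
  have "\<exists>i\<in>{1..n}. \<delta> / m * y < z i"
  proof (rule ccontr)
    assume "\<not> ?thesis"
    then have "(\<Sum>i=1..n. z i) \<le> (\<Sum>i=1..n. \<delta> / m * y)" by (intro sum_mono) (auto simp: not_less)
    also have "\<dots> = real n / real m * (\<delta> * y)" by simp
    also have "\<dots> \<le> 1 * (1 * y)" using n m \<delta> y by (intro mult_mono) auto
    finally show False using sum by simp
  qed
  then obtain i where i: "i \<in> {1..n}" "\<delta> / m * y < z i" by blast
  have "\<exists>j\<in>{1..n} - {i}. \<delta> / m * y < z j"
  proof (rule ccontr)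
    assume "\<not> ?thesis"
    then have "(\<Sum>j\<in>{1..n} - {i}. z j) \<le> (\<Sum>j\<in>{1..n} - {i}. \<delta> / m * y)" by (intro sum_mono) (auto simp: not_less)
    also have "\<dots> = real (card ({1..n} - {i})) / real m * (\<delta> * y)" by simp
    also have "\<dots> \<le> 1 * (\<delta> * y)" using n m \<delta> y i by (intro mult_right_mono) auto
    finally have "(\<Sum>j\<in>{1..n} - {i}. z j) \<le> \<delta> * y" by simp
    moreover have "z i \<le> (1 - \<delta>) * y" using i n by (intro no) auto
    moreover have "(\<Sum>i=1..n. z i) = z i + (\<Sum>j\<in>{1..n} - {i}. z j)" using i by (intro sum.remove) auto
    ultimately show False using sum by (simp add: algebra_simps)
  qed
  then show ?thesis using i n by fastforce
qed

text \<open>Without a second term of the order of \<open>x\<close> in absolute value, one term above \<open>(1 + \<delta>) * x\<close> cannot be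
compensated by the others.\<close>

lemma one_big_jump_lower:
  fixes z :: "nat \<Rightarrow> real"
  assumes x: "0 < x" and m: "1 \<le> m" and \<delta>: "0 < \<delta>" "\<delta> < 1"
    and no: "\<And>i j. i \<in> {1..m} \<Longrightarrow> j \<in> {1..m} \<Longrightarrow> i \<noteq> j \<Longrightarrow> \<not> (\<delta> / m * x < z i \<and> \<delta> / m * x < \<bar>z j\<bar>)"
  shows "(\<Sum>i=1..m. (if (1 + \<delta>) * x < z i then 1 else 0)) \<le> (if x < (\<Sum>i=1..m. z i) then 1 else 0 :: real)"
proof (cases "\<exists>i\<in>{1..m}. (1 + \<delta>) * x < z i")
  case True
  then obtain i where i: "i \<in> {1..m}" "(1 + \<delta>) * x < z i" by blast
  have m': "1 \<le> real m" using m by simp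
  have "\<delta> / real m \<le> \<delta> / 1" using \<delta> m' by (intro divide_left_mono) auto
  then have "\<delta> / real m \<le> 1 + \<delta>" by simp
  then have "\<delta> / m * x \<le> (1 + \<delta>) * x" using x by (intro mult_right_mono) auto
  then have zi: "\<delta> / m * x < z i" using i by simp
  have small: "\<bar>z j\<bar> \<le> \<delta> / m * x" if "j \<in> {1..m} - {i}" for j
    using no[of i j] that i zi by auto
  have others: "\<not> (1 + \<delta>) * x < z j" if "j \<in> {1..m} - {i}" for j
    using small[OF that] \<open>\<delta> / m * x \<le> (1 + \<delta>) * x\<close> by linarith
  have "- (\<Sum>j\<in>{1..m} - {i}. z j) \<le> (\<Sum>j\<in>{1..m} - {i}. \<delta> / m * x)"
    unfolding sum_negf[symmetric] using small by (intro sum_mono) fastforce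
  also have "\<dots> = real (card ({1..m} - {i})) / real m * (\<delta> * x)" by simp
  also have "\<dots> \<le> 1 * (\<delta> * x)" using m' \<delta> x i by (intro mult_right_mono) auto
  finally have "- \<delta> * x \<le> (\<Sum>j\<in>{1..m} - {i}. z j)" by simp
  moreover have "(\<Sum>i=1..m. z i) = z i + (\<Sum>j\<in>{1..m} - {i}. z j)" using i by (intro sum.remove) auto
  ultimately have "x < (\<Sum>i=1..m. z i)" using i by (simp add: algebra_simps)
  moreover have "(\<Sum>i=1..m. (if (1 + \<delta>) * x < z i then 1 else 0 :: real)) = 1 + (\<Sum>j\<in>{1..m} - {i}. (if (1 + \<delta>) * x < z j then 1 else 0))"
    using i by (subst sum.remove[of _ i]) auto
  moreover have "(\<Sum>j\<in>{1..m} - {i}. (if (1 + \<delta>) * x < z j then 1 else 0 :: real)) = 0"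
    using others by (intro sum.neutral) auto
  ultimately show ?thesis by simp
next
  case False
  then have "(\<Sum>i=1..m. (if (1 + \<delta>) * x < z i then 1 else 0 :: real)) = 0" by (intro sum.neutral) auto
  then show ?thesis by simp
qed

context iid_perpetuity begin

definition cross :: "nat \<Rightarrow> real \<Rightarrow> real" where
  "cross m x = (\<Sum>(i, j)\<in>{(i, j). i \<in> {1..m} \<and> j \<in> {1..m} \<and> i \<noteq> j}. \<P>(\<omega> in M. x < Z i \<omega> \<and> x < \<bar>Z j \<omega>\<bar>))"

lemma finite_pairs: "finite {(i, j). i \<in> {1..m::nat} \<and> j \<in> {1..m} \<and> i \<noteq> j}"
  by (rule finite_subset[of _ "{1..m} \<times> {1..m}"]) auto

lemma cross_tendsto: "((\<lambda>x. cross m x / Fbar x) \<longlongrightarrow> 0) at_top"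
proof -
  have "((\<lambda>x. \<Sum>p\<in>{(i, j). i \<in> {1..m} \<and> j \<in> {1..m} \<and> i \<noteq> j}.
     \<P>(\<omega> in M. x < Z (fst p) \<omega> \<and> x < \<bar>Z (snd p) \<omega>\<bar>) / Fbar x) \<longlongrightarrow> 0) at_top"
    by (rule tendsto_null_sum) (auto intro!: cross_negligible)
  then show ?thesis unfolding cross_def by (simp add: sum_divide_distrib case_prod_beta')
qed

lemma max_sum_upper:
  assumes m: "1 \<le> m" and y: "0 < y" and \<delta>: "0 < \<delta>" "\<delta> < 1"
  shows "\<P>(\<omega> in M. \<exists>n\<in>{1..m}. y < (\<Sum>i=1..n. Z i \<omega>))
    \<le> (\<Sum>i=1..m. \<P>(\<omega> in M. Z i \<omega> > (1 - \<delta>) * y)) + cross m (\<delta> / m * y)"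
proof -
  let ?J = "{(i, j). i \<in> {1..m} \<and> j \<in> {1..m} \<and> i \<noteq> j}"
  let ?A = "\<lambda>i. {\<omega> \<in> space M. Z i \<omega> > (1 - \<delta>) * y}"
  let ?C = "\<lambda>p. {\<omega> \<in> space M. \<delta> / m * y < Z (fst p) \<omega> \<and> \<delta> / m * y < \<bar>Z (snd p) \<omega>\<bar>}"
  have Am: "?A i \<in> sets M" if "i \<in> {1..m}" for i
  proof -
    have [measurable]: "Z i \<in> borel_measurable M" using that by (intro Z_measurable) auto
    show ?thesis by measurable
  qed
  have Cm: "?C p \<in> sets M" if "p \<in> ?J" for p
  proof -
    have [measurable]: "Z (fst p) \<in> borel_measurable M" "Z (snd p) \<in> borel_measurable M"
      using that by (auto intro!: Z_measurable)
    show ?thesis by measurable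
  qed
  have UA: "(\<Union>i\<in>{1..m}. ?A i) \<in> sets M" by (rule sets.finite_UN[OF finite_atLeastAtMost Am])
  have UC: "(\<Union>p\<in>?J. ?C p) \<in> sets M" by (rule sets.finite_UN[OF finite_pairs Cm])
  have "\<P>(\<omega> in M. \<exists>n\<in>{1..m}. y < (\<Sum>i=1..n. Z i \<omega>)) \<le> measure M ((\<Union>i\<in>{1..m}. ?A i) \<union> (\<Union>p\<in>?J. ?C p))"
  proof (rule M.finite_measure_mono)
    show "(\<Union>i\<in>{1..m}. ?A i) \<union> (\<Union>p\<in>?J. ?C p) \<in> sets M"
      by (rule sets.Un[OF UA UC])
    show "{\<omega> \<in> space M. \<exists>n\<in>{1..m}. y < (\<Sum>i=1..n. Z i \<omega>)} \<subseteq> (\<Union>i\<in>{1..m}. ?A i) \<union> (\<Union>p\<in>?J. ?C p)"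
    proof (rule subsetI)
      fix \<omega> assume "\<omega> \<in> {\<omega> \<in> space M. \<exists>n\<in>{1..m}. y < (\<Sum>i=1..n. Z i \<omega>)}"
      then obtain n where \<omega>: "\<omega> \<in> space M" and n: "n \<in> {1..m}" "y < (\<Sum>i=1..n. Z i \<omega>)" by blast
      show "\<omega> \<in> (\<Union>i\<in>{1..m}. ?A i) \<union> (\<Union>p\<in>?J. ?C p)"
      proof (cases "\<exists>i\<in>{1..m}. (1 - \<delta>) * y < Z i \<omega>")
        case True then show ?thesis using \<omega> by blast
      next
        case False
        then have small: "\<And>i. i \<in> {1..m} \<Longrightarrow> Z i \<omega> \<le> (1 - \<delta>) * y" by (simp add: not_less)
        have n': "1 \<le> n" "n \<le> m" using n(1) by auto
        from one_big_jump_upper[OF n(2) y n' \<delta> small]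
        obtain i j where ij: "i \<in> {1..m}" "j \<in> {1..m}" "i \<noteq> j" "\<delta> / m * y < Z i \<omega>" "\<delta> / m * y < Z j \<omega>" by blast
        have "(i, j) \<in> ?J" using ij by simp
        moreover have "\<omega> \<in> ?C (i, j)" using \<omega> ij by simp
        ultimately show ?thesis by (intro UnI2 UN_I)
      qed
    qed
  qed
  also have "\<dots> \<le> measure M (\<Union>i\<in>{1..m}. ?A i) + measure M (\<Union>p\<in>?J. ?C p)"
    by (rule measure_Un_le[OF UA UC])
  also have "\<dots> \<le> (\<Sum>i=1..m. measure M (?A i)) + (\<Sum>p\<in>?J. measure M (?C p))"
    by (intro add_mono M.finite_measure_subadditive_finite finite_atLeastAtMost finite_pairs image_subsetI Am Cm)
  finally show ?thesis unfolding cross_def by (simp add: case_prod_beta')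
qed

lemma sum_lower:
  assumes m: "1 \<le> m" and x: "0 < x" and \<delta>: "0 < \<delta>" "\<delta> < 1"
  shows "(\<Sum>i=1..m. \<P>(\<omega> in M. Z i \<omega> > (1 + \<delta>) * x)) - m * cross m (\<delta> / m * x)
    \<le> \<P>(\<omega> in M. x < (\<Sum>i=1..m. Z i \<omega>))"
proof -
  have Zm: "Z i \<in> borel_measurable M" if "i \<in> {1..m}" for i using that by (intro Z_measurable) auto
  let ?J = "{(i, j). i \<in> {1..m} \<and> j \<in> {1..m} \<and> i \<noteq> j}"
  let ?A = "\<lambda>i. {\<omega> \<in> space M. Z i \<omega> > (1 + \<delta>) * x}"
  let ?C = "\<lambda>p. {\<omega> \<in> space M. \<delta> / m * x < Z (fst p) \<omega> \<and> \<delta> / m * x < \<bar>Z (snd p) \<omega>\<bar>}"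
  let ?B = "{\<omega> \<in> space M. x < (\<Sum>i=1..m. Z i \<omega>)}"
  have Am: "?A i \<in> sets M" if "i \<in> {1..m}" for i
  proof -
    note Zm[OF that, measurable] show ?thesis by measurable
  qed
  have Cm: "?C p \<in> sets M" if "p \<in> ?J" for p
  proof -
    have [measurable]: "Z (fst p) \<in> borel_measurable M" "Z (snd p) \<in> borel_measurable M"
      using that by (auto intro!: Z_measurable)
    show ?thesis by measurable
  qed
  have Bm: "?B \<in> sets M"
  proof -
    have [measurable]: "(\<lambda>\<omega>. \<Sum>i=1..m. Z i \<omega>) \<in> borel_measurable M" by (intro borel_measurable_sum Zm)
    show ?thesis by measurable
  qed
  have ind: "integrable M (indicator A :: 'a \<Rightarrow> real)" if "A \<in> sets M" for A
    using that by (intro M.integrable_const_bound[where B=1]) auto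
  have "(\<Sum>i=1..m. measure M (?A i)) = (\<integral>\<omega>. (\<Sum>i=1..m. indicator (?A i) \<omega>) \<partial>M)"
    using Am ind by (subst Bochner_Integration.integral_sum) (auto simp: Int_absorb2 sets.sets_into_space)
  also have "\<dots> \<le> (\<integral>\<omega>. indicator ?B \<omega> + real m * (\<Sum>p\<in>?J. indicator (?C p) \<omega>) \<partial>M)"
  proof (rule integral_mono)
    show "integrable M (\<lambda>\<omega>. \<Sum>i=1..m. indicator (?A i) \<omega> :: real)"
      using Am ind by (intro Bochner_Integration.integrable_sum) auto
    show "integrable M (\<lambda>\<omega>. indicator ?B \<omega> + real m * (\<Sum>p\<in>?J. indicator (?C p) \<omega>))"
      using Bm Cm ind by (intro Bochner_Integration.integrable_add integrable_mult_right Bochner_Integration.integrable_sum) auto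
    fix \<omega> assume \<omega>: "\<omega> \<in> space M"
    show "(\<Sum>i=1..m. indicator (?A i) \<omega> :: real) \<le> indicator ?B \<omega> + real m * (\<Sum>p\<in>?J. indicator (?C p) \<omega>)"
    proof (cases "\<exists>p\<in>?J. \<omega> \<in> ?C p")
      case True
      then obtain p where p: "p \<in> ?J" "\<omega> \<in> ?C p" by blast
      have "(\<Sum>i=1..m. indicator (?A i) \<omega> :: real) \<le> (\<Sum>i=1..m. 1)" by (intro sum_mono) (simp add: indicator_def)
      also have "\<dots> = real m * indicator (?C p) \<omega>" using p by simp
      also have "\<dots> \<le> real m * (\<Sum>p\<in>?J. indicator (?C p) \<omega>)"
        using p finite_pairs by (intro mult_left_mono member_le_sum) auto
      also have "\<dots> \<le> indicator ?B \<omega> + real m * (\<Sum>p\<in>?J. indicator (?C p) \<omega>)" by simp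
      finally show ?thesis .
    next
      case False
      have "(\<Sum>i=1..m. indicator (?A i) \<omega> :: real) = (\<Sum>i=1..m. (if (1 + \<delta>) * x < Z i \<omega> then 1 else 0))"
        by (rule sum.cong[OF refl]) (use \<omega> in \<open>simp add: indicator_def\<close>)
      also have "\<dots> \<le> (if x < (\<Sum>i=1..m. Z i \<omega>) then 1 else 0)"
        by (rule one_big_jump_lower[OF x m \<delta>]) (use False \<omega> in auto)
      also have "\<dots> = indicator ?B \<omega> + 0" using \<omega> by (simp add: indicator_def)
      also have "\<dots> \<le> indicator ?B \<omega> + real m * (\<Sum>p\<in>?J. indicator (?C p) \<omega>)"
        by (intro add_left_mono mult_nonneg_nonneg sum_nonneg) auto
      finally show ?thesis .
    qed
  qed
  also have "\<dots> = measure M ?B + m * (\<Sum>p\<in>?J. measure M (?C p))"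
  proof -
    have i1: "integrable M (\<lambda>\<omega>. real m * (\<Sum>p\<in>?J. indicator (?C p) \<omega>))"
      using Cm ind by (intro integrable_mult_right Bochner_Integration.integrable_sum) auto
    have i2: "(\<integral>\<omega>. (\<Sum>p\<in>?J. indicator (?C p) \<omega>) \<partial>M) = (\<Sum>p\<in>?J. measure M (?C p))"
      using Cm ind by (subst Bochner_Integration.integral_sum) (auto simp: Int_absorb2 sets.sets_into_space intro!: sum.cong)
    have i3: "(\<integral>\<omega>. indicator ?B \<omega> \<partial>M) = measure M ?B" using Bm by (simp add: Int_absorb2 sets.sets_into_space)
    show ?thesis unfolding Bochner_Integration.integral_add[OF ind[OF Bm] i1] integral_mult_right_zero i2 i3 ..
  qed
  finally show ?thesis unfolding cross_def by (simp add: case_prod_beta')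
qed

text \<open>For the lower bound the supremum is at least any fixed partial sum.  For the upper bound either one
of the first \<open>m\<close> partial sums exceeds \<open>(1 - \<delta>) * x\<close>, or the positive parts of the later terms add up to
more than \<open>\<delta> * x\<close>; the latter has probability at most a small multiple of the tail, uniformly in the
number of terms, so \<open>\<delta>\<close> is chosen first and \<open>m\<close> afterwards.\<close>

lemma perpetuity_tail:
  assumes p: "\<alpha> < p" "1 \<le> p" and q: "0 \<le> q" "q < \<alpha>" and b: "\<And>i. 0 < b i" "summable b"
    and dom: "\<And>i u. 2 \<le> i \<Longrightarrow> 0 < u \<Longrightarrow>
      \<P>(\<omega> in M. Z i \<omega> > u) \<le> b i powr p * (Fbar u * max 1 (u powr (- q)))"
  shows "((\<lambda>x. \<P>(\<omega> in M. \<exists>n\<ge>1. x < (\<Sum>i=1..n. Z i \<omega>)) / Fbar x) \<longlongrightarrow> k / (1 - \<rho>)) at_top"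
proof -
  let ?S = "\<lambda>x. {\<omega> \<in> space M. \<exists>n\<ge>1. x < (\<Sum>i=1..n. Z i \<omega>)}"
  have Zm: "Z i \<in> borel_measurable M" if "1 \<le> i" for i using that by (rule Z_measurable)
  have Sn: "{\<omega> \<in> space M. x < (\<Sum>i=1..n. Z i \<omega>)} \<in> sets M" for n x
  proof -
    have "(\<lambda>\<omega>. \<Sum>i=1..n. Z i \<omega>) \<in> borel_measurable M" by (intro borel_measurable_sum Zm) auto
    then show ?thesis by (rule borel_measurable_less[OF borel_measurable_const])
  qed
  have Bm: "{\<omega> \<in> space M. \<exists>n\<in>A. x < (\<Sum>i=1..n. Z i \<omega>)} \<in> sets M" for A x
  proof -
    have "{\<omega> \<in> space M. \<exists>n\<in>A. x < (\<Sum>i=1..n. Z i \<omega>)} = (\<Union>n\<in>A. {\<omega> \<in> space M. x < (\<Sum>i=1..n. Z i \<omega>)})" by blast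
    then show ?thesis using Sn by (simp only:) (intro sets.countable_UN', auto)
  qed
  have S_eq: "?S x = {\<omega> \<in> space M. \<exists>n\<in>{1..}. x < (\<Sum>i=1..n. Z i \<omega>)}" for x by (simp add: Bex_def)
  have Sm: "?S x \<in> sets M" for x unfolding S_eq by (rule Bm)
  define \<Sigma> where "\<Sigma> = (\<lambda>m. \<Sum>i=1..m. k * \<rho> ^ (i - 1))"
  have \<Sigma>_eq: "\<Sigma> m = k * (\<Sum>i<m. \<rho> ^ i)" for m
    unfolding \<Sigma>_def sum_distrib_left by (rule sum.reindex_bij_witness[of _ Suc "\<lambda>i. i - 1"]) auto
  have geo: "(\<lambda>i. \<rho> ^ i) sums (1 / (1 - \<rho>))" using \<rho>_nonneg \<rho>_less_1 by (intro geometric_sums) simp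
  have \<Sigma>_lim: "\<Sigma> \<longlonglongrightarrow> k / (1 - \<rho>)"
    using tendsto_mult_left[OF geo[unfolded sums_def], of k] unfolding \<Sigma>_eq by simp
  have \<Sigma>_le: "\<Sigma> m \<le> k / (1 - \<rho>)" for m
  proof -
    have "(\<Sum>i<m. \<rho> ^ i) \<le> 1 / (1 - \<rho>)"
      using sum_le_suminf[of "\<lambda>i. \<rho> ^ i" "{..<m}"] geo \<rho>_nonneg by (simp add: sums_iff)
    from mult_left_mono[OF this k_nonneg] show ?thesis unfolding \<Sigma>_eq by simp
  qed
  have Zsum: "((\<lambda>x. (\<Sum>i=1..m. \<P>(\<omega> in M. Z i \<omega> > c * x)) / Fbar x) \<longlongrightarrow> \<Sigma> m * c powr (-\<alpha>)) at_top"
    if "0 < c" for c m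
    unfolding sum_divide_distrib \<Sigma>_def sum_distrib_right by (intro tendsto_sum rescale[OF Z_tail that]) auto
  have crs: "((\<lambda>x. cross m (c * x) / Fbar x) \<longlongrightarrow> 0) at_top" if "0 < c" for c m
    using rescale[OF cross_tendsto that] by simp
  show ?thesis
  proof (rule order_tendstoI)
    fix a assume a: "a < k / (1 - \<rho>)"
    from eventually_happens'[OF sequentially_bot eventually_conj[OF order_tendstoD(1)[OF \<Sigma>_lim a] eventually_ge_at_top[of 1]]]
    obtain m where m: "a < \<Sigma> m" "1 \<le> m" by blast
    have "((\<lambda>\<delta>. \<Sigma> m * (1 + \<delta>) powr (-\<alpha>)) \<longlongrightarrow> \<Sigma> m * (1 + 0) powr (-\<alpha>)) (at_right 0)"
      by (intro tendsto_intros) auto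
    then have "\<forall>\<^sub>F \<delta> in at_right 0. a < \<Sigma> m * (1 + \<delta>) powr (-\<alpha>)" using m by (intro order_tendstoD) auto
    moreover have "\<forall>\<^sub>F \<delta>::real in at_right 0. 0 < \<delta> \<and> \<delta> < 1"
      using eventually_at_right_real[of 0 1] by simp
    ultimately have ev: "\<forall>\<^sub>F \<delta> in at_right 0. a < \<Sigma> m * (1 + \<delta>) powr (-\<alpha>) \<and> 0 < \<delta> \<and> \<delta> < 1" by (rule eventually_conj)
    obtain \<delta> where \<delta>: "a < \<Sigma> m * (1 + \<delta>) powr (-\<alpha>)" "0 < \<delta>" "\<delta> < 1"
      using eventually_happens'[OF trivial_limit_at_right_real ev] by blast
    let ?L = "\<lambda>x. (\<Sum>i=1..m. \<P>(\<omega> in M. Z i \<omega> > (1 + \<delta>) * x)) / Fbar x - m * (cross m (\<delta> / m * x) / Fbar x)"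
    have "(?L \<longlongrightarrow> \<Sigma> m * (1 + \<delta>) powr (-\<alpha>) - real m * 0) at_top"
      using \<delta> m by (intro tendsto_diff tendsto_mult_left Zsum crs) auto
    then have "\<forall>\<^sub>F x in at_top. a < ?L x" using \<delta>(1) by (intro order_tendstoD) auto
    then show "\<forall>\<^sub>F x in at_top. a < measure M (?S x) / Fbar x"
      using eventually_gt_at_top[of 0]
    proof eventually_elim
      fix x :: real assume L: "a < ?L x" and x: "0 < x"
      have "\<P>(\<omega> in M. x < (\<Sum>i=1..m. Z i \<omega>)) \<le> measure M (?S x)"
      proof (rule M.finite_measure_mono[OF _ Sm], rule subsetI)
        fix \<omega> assume "\<omega> \<in> {\<omega> \<in> space M. x < (\<Sum>i=1..m. Z i \<omega>)}"
        then show "\<omega> \<in> ?S x" using m(2) by blast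
      qed
      with sum_lower[OF m(2) x \<delta>(2,3)]
      have "((\<Sum>i=1..m. \<P>(\<omega> in M. Z i \<omega> > (1 + \<delta>) * x)) - m * cross m (\<delta> / m * x)) / Fbar x \<le> measure M (?S x) / Fbar x"
        by (intro divide_right_mono Fbar_nonneg) (rule order_trans)
      with L show "a < measure M (?S x) / Fbar x" by (simp add: diff_divide_distrib)
    qed
  next
    fix a assume a: "k / (1 - \<rho>) < a"
    have "((\<lambda>\<delta>. k / (1 - \<rho>) * ((1 - \<delta>) * (1 - \<delta>)) powr (-\<alpha>)) \<longlongrightarrow> k / (1 - \<rho>) * ((1 - 0) * (1 - 0)) powr (-\<alpha>)) (at_right 0)"
      by (intro tendsto_intros) auto
    then have "\<forall>\<^sub>F \<delta> in at_right 0. k / (1 - \<rho>) * ((1 - \<delta>) * (1 - \<delta>)) powr (-\<alpha>) < a" using a by (intro order_tendstoD) auto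
    moreover have "\<forall>\<^sub>F \<delta>::real in at_right 0. 0 < \<delta> \<and> \<delta> < 1"
      using eventually_at_right_real[of 0 1] by simp
    ultimately have ev: "\<forall>\<^sub>F \<delta> in at_right 0. k / (1 - \<rho>) * ((1 - \<delta>) * (1 - \<delta>)) powr (-\<alpha>) < a \<and> 0 < \<delta> \<and> \<delta> < 1" by (rule eventually_conj)
    obtain \<delta> where \<delta>: "k / (1 - \<rho>) * ((1 - \<delta>) * (1 - \<delta>)) powr (-\<alpha>) < a" "0 < \<delta>" "\<delta> < 1"
      using eventually_happens'[OF trivial_limit_at_right_real ev] by blast
    define e where "e = a - k / (1 - \<rho>) * ((1 - \<delta>) * (1 - \<delta>)) powr (-\<alpha>)"
    have e: "0 < e" using \<delta> unfolding e_def by simp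
    obtain C x0 where C: "0 \<le> C" "0 < x0" and
      far: "\<And>V b (I::nat set) x. finite I \<Longrightarrow> (\<And>i. i \<in> I \<Longrightarrow> V i \<in> borel_measurable M) \<Longrightarrow>
        (\<And>i \<omega>. i \<in> I \<Longrightarrow> \<omega> \<in> space M \<Longrightarrow> 0 \<le> V i \<omega>) \<Longrightarrow> (\<And>i. i \<in> I \<Longrightarrow> 0 < b i) \<Longrightarrow>
        (\<And>i u. i \<in> I \<Longrightarrow> 0 < u \<Longrightarrow> \<P>(\<omega> in M. V i \<omega> > u) \<le> b i powr p * (Fbar u * max 1 (u powr (-q)))) \<Longrightarrow>
        x0 \<le> x \<Longrightarrow> \<P>(\<omega> in M. (\<Sum>i\<in>I. V i \<omega>) > x) \<le> C * (\<Sum>i\<in>I. b i) powr p * Fbar x"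
      by (rule sum_tail_bound[OF prob q p]) blast
    have "((\<lambda>r. C * r powr p * \<delta> powr (-\<alpha>)) \<longlongrightarrow> C * 0 powr p * \<delta> powr (-\<alpha>)) (at_right 0)"
    proof (intro tendsto_mult_left tendsto_mult_right tendsto_powr' tendsto_const tendsto_ident_at)
      show "(0::real) \<noteq> 0 \<or> 0 < p \<and> (\<forall>\<^sub>F r::real in at_right 0. 0 \<le> r)"
        using p eventually_at_right_less[of "0::real"] by (auto elim: eventually_mono)
    qed
    then have "\<forall>\<^sub>F r in at_right 0. C * r powr p * \<delta> powr (-\<alpha>) < e" using e p by (intro order_tendstoD) auto
    moreover have "\<forall>\<^sub>F r::real in at_right 0. 0 < r" by (rule eventually_at_right_less)
    ultimately have ev: "\<forall>\<^sub>F r in at_right 0. C * r powr p * \<delta> powr (-\<alpha>) < e \<and> 0 < r" by (rule eventually_conj)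
    obtain r where r: "C * r powr p * \<delta> powr (-\<alpha>) < e" "0 < r"
      using eventually_happens'[OF trivial_limit_at_right_real ev] by blast
    obtain N where N: "\<And>m n. N \<le> m \<Longrightarrow> norm (sum b {m..<n}) < r"
      using b(2) r(2) unfolding summable_Cauchy by blast
    define m where "m = max 1 N"
    have m: "1 \<le> m" "N \<le> m" unfolding m_def by auto
    define V where "V = (\<lambda>i \<omega>. max 0 (Z i \<omega>))"
    have Vm: "V i \<in> borel_measurable M" if "1 \<le> i" for i
      unfolding V_def using Zm[OF that] by measurable
    let ?E = "\<lambda>x n. {\<omega> \<in> space M. (\<Sum>i\<in>{m<..n}. V i \<omega>) > x}"
    have En: "measure M (?E x n) \<le> C * r powr p * Fbar x" if x: "x0 \<le> x" for x n
    proof -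
      have "measure M (?E x n) \<le> C * (\<Sum>i\<in>{m<..n}. b i) powr p * Fbar x"
      proof (rule far)
        show "V i \<in> borel_measurable M" if "i \<in> {m<..n}" for i using that m by (intro Vm) auto
        show "\<P>(\<omega> in M. V i \<omega> > u) \<le> b i powr p * (Fbar u * max 1 (u powr (-q)))"
          if "i \<in> {m<..n}" "0 < u" for i u
        proof -
          have "{\<omega> \<in> space M. V i \<omega> > u} = {\<omega> \<in> space M. Z i \<omega> > u}" using that by (auto simp: V_def)
          then show ?thesis using dom[of i u] that m by simp
        qed
      qed (use x b in \<open>auto simp: V_def\<close>)
      also have "\<dots> \<le> C * r powr p * Fbar x"
      proof (intro mult_right_mono mult_left_mono powr_mono2 Fbar_nonneg C(1))
        have "{m<..n} = {Suc m..<Suc n}" by auto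
        then show "(\<Sum>i\<in>{m<..n}. b i) \<le> r" using N[of "Suc m" "Suc n"] m by simp
        show "0 \<le> (\<Sum>i\<in>{m<..n}. b i)" using b by (intro sum_nonneg) (auto intro: less_imp_le)
      qed (use p in simp)
      finally show ?thesis .
    qed
    have Em: "?E x n \<in> sets M" for x n
    proof -
      have [measurable]: "(\<lambda>\<omega>. \<Sum>i\<in>{m<..n}. V i \<omega>) \<in> borel_measurable M" using m by (intro borel_measurable_sum Vm) auto
      show ?thesis by measurable
    qed
    have EU: "measure M (\<Union>n. ?E x n) \<le> C * r powr p * Fbar x" if x: "x0 \<le> x" for x
    proof (rule LIMSEQ_le_const2)
      have "incseq (?E x)"
      proof (rule incseq_SucI, safe)
        fix n \<omega> assume "x < (\<Sum>i\<in>{m<..n}. V i \<omega>)"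
        also have "\<dots> \<le> (\<Sum>i\<in>{m<..Suc n}. V i \<omega>)" by (intro sum_mono2) (auto simp: V_def)
        finally show "x < (\<Sum>i\<in>{m<..Suc n}. V i \<omega>)" .
      qed
      then show "(\<lambda>n. measure M (?E x n)) \<longlonglongrightarrow> measure M (\<Union>n. ?E x n)"
        using Em by (intro M.finite_Lim_measure_incseq) auto
    qed (use En[OF x] in auto)
    let ?U = "\<lambda>x. (\<Sum>i=1..m. \<P>(\<omega> in M. Z i \<omega> > ((1 - \<delta>) * (1 - \<delta>)) * x)) / Fbar x
      + cross m ((\<delta> / m * (1 - \<delta>)) * x) / Fbar x + C * r powr p * (Fbar (x * \<delta>) / Fbar x)"
    have "(?U \<longlongrightarrow> \<Sigma> m * ((1 - \<delta>) * (1 - \<delta>)) powr (-\<alpha>) + 0 + C * r powr p * \<delta> powr (-\<alpha>)) at_top"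
      using \<delta> m by (intro tendsto_add tendsto_mult_left Zsum crs Fbar_ratio) auto
    moreover have "\<Sigma> m * ((1 - \<delta>) * (1 - \<delta>)) powr (-\<alpha>) + 0 + C * r powr p * \<delta> powr (-\<alpha>) < a"
      using mult_right_mono[OF \<Sigma>_le[of m], of "((1 - \<delta>) * (1 - \<delta>)) powr (-\<alpha>)"] r(1) unfolding e_def by simp
    ultimately have "\<forall>\<^sub>F x in at_top. ?U x < a" by (rule order_tendstoD)
    then show "\<forall>\<^sub>F x in at_top. measure M (?S x) / Fbar x < a"
      using eventually_gt_at_top[of 0] eventually_ge_at_top[of "x0 / \<delta>"]
    proof eventually_elim
      fix x :: real assume U: "?U x < a" and x: "0 < x" "x0 / \<delta> \<le> x"
      have x\<delta>: "x0 \<le> x * \<delta>" using x \<delta> by (simp add: field_simps)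
      have y: "0 < (1 - \<delta>) * x" using x \<delta> by simp
      let ?B = "{\<omega> \<in> space M. \<exists>n\<in>{1..m}. (1 - \<delta>) * x < (\<Sum>i=1..n. Z i \<omega>)}"
      have "?S x \<subseteq> ?B \<union> (\<Union>n. ?E (x * \<delta>) n)"
      proof (rule subsetI)
        fix \<omega> assume "\<omega> \<in> ?S x"
        then obtain n where \<omega>: "\<omega> \<in> space M" and n: "1 \<le> n" "x < (\<Sum>i=1..n. Z i \<omega>)" by blast
        show "\<omega> \<in> ?B \<union> (\<Union>n. ?E (x * \<delta>) n)"
        proof (cases "n \<le> m")
          case True
          have "(1 - \<delta>) * x \<le> x" using x \<delta> by (simp add: algebra_simps)
          then have "(1 - \<delta>) * x < (\<Sum>i=1..n. Z i \<omega>)" using n(2) by linarith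
          then have "\<omega> \<in> ?B" using \<omega> n(1) True by (intro CollectI conjI bexI[of _ n]) auto
          then show ?thesis by (rule UnI1)
        next
          case False
          have "{1..n} = {1..m} \<union> {m<..n}" using False by auto
          then have "(\<Sum>i=1..n. Z i \<omega>) = (\<Sum>i=1..m. Z i \<omega>) + (\<Sum>i\<in>{m<..n}. Z i \<omega>)"
            by (simp only:) (rule sum.union_disjoint, auto)
          moreover have "(\<Sum>i\<in>{m<..n}. Z i \<omega>) \<le> (\<Sum>i\<in>{m<..n}. V i \<omega>)" by (intro sum_mono) (simp add: V_def)
          moreover have "x = (1 - \<delta>) * x + x * \<delta>" by (simp add: algebra_simps)
          ultimately have "(1 - \<delta>) * x < (\<Sum>i=1..m. Z i \<omega>) \<or> x * \<delta> < (\<Sum>i\<in>{m<..n}. V i \<omega>)"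
            using n(2) by linarith
          then show ?thesis
          proof
            assume "(1 - \<delta>) * x < (\<Sum>i=1..m. Z i \<omega>)"
            then have "\<omega> \<in> ?B" using \<omega> m by (intro CollectI conjI bexI[of _ m]) auto
            then show ?thesis by (rule UnI1)
          next
            assume "x * \<delta> < (\<Sum>i\<in>{m<..n}. V i \<omega>)"
            then have "\<omega> \<in> ?E (x * \<delta>) n" using \<omega> by (intro CollectI conjI)
            then show ?thesis by (intro UnI2 UN_I[of n]) auto
          qed
        qed
      qed
      then have "measure M (?S x) \<le> measure M (?B \<union> (\<Union>n. ?E (x * \<delta>) n))"
        using Bm Em by (intro M.finite_measure_mono sets.Un sets.countable_UN) auto
      also have "\<dots> \<le> measure M ?B + measure M (\<Union>n. ?E (x * \<delta>) n)"
        using Bm Em by (intro measure_Un_le sets.countable_UN) auto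
      also have "\<dots> \<le> ((\<Sum>i=1..m. \<P>(\<omega> in M. Z i \<omega> > (1 - \<delta>) * ((1 - \<delta>) * x))) + cross m (\<delta> / m * ((1 - \<delta>) * x)))
          + C * r powr p * Fbar (x * \<delta>)"
        by (intro add_mono max_sum_upper m y \<delta> EU x\<delta>)
      finally have "measure M (?S x) / Fbar x \<le> (((\<Sum>i=1..m. \<P>(\<omega> in M. Z i \<omega> > (1 - \<delta>) * ((1 - \<delta>) * x))) + cross m (\<delta> / m * ((1 - \<delta>) * x)))
          + C * r powr p * Fbar (x * \<delta>)) / Fbar x" by (rule divide_right_mono) (rule Fbar_nonneg)
      also have "\<dots> = ?U x" by (simp add: add_divide_distrib mult.assoc)
      finally show "measure M (?S x) / Fbar x < a" using U by linarith
    qed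
  qed
qed

end

section \<open>Summability of the tail bounds\<close>

lemma powr_subadditive:
  fixes a b s :: real
  assumes "0 \<le> a" "0 \<le> b" "0 < s" "s \<le> 1"
  shows "(a + b) powr s \<le> a powr s + b powr s"
proof (cases "a + b = 0")
  case True then show ?thesis using assms by simp
next
  case False
  then have ab: "0 < a + b" using assms by simp
  have *: "x / (a + b) \<le> (x / (a + b)) powr s" if "0 \<le> x" "x \<le> a + b" for x
  proof -
    have "(x / (a + b)) powr 1 \<le> (x / (a + b)) powr s" using that ab assms by (intro powr_mono') auto
    then show ?thesis using that ab by simp
  qed
  have "1 = a / (a + b) + b / (a + b)" using ab by (simp add: add_divide_distrib[symmetric])
  also have "\<dots> \<le> (a / (a + b)) powr s + (b / (a + b)) powr s"
    using assms by (intro add_mono *) auto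
  also have "\<dots> = (a powr s + b powr s) / (a + b) powr s"
    using assms by (simp add: powr_divide add_divide_distrib)
  finally show ?thesis using ab by (simp add: field_simps)
qed

lemma summable_geometric_powr:
  fixes r s :: real
  assumes "0 \<le> r" "r < 1" "0 < s"
  shows "summable (\<lambda>i. (r ^ i) powr s)"
proof (cases "r = 0")
  case True
  have "summable (\<lambda>i. (0 ^ Suc i :: real) powr s)" by simp
  then show ?thesis using True summable_Suc_iff[of "\<lambda>i. (0 ^ i :: real) powr s"] by simp
next
  case False
  then have r: "0 < r" using assms by simp
  have "(r ^ i) powr s = (r powr s) ^ i" for i
    using r by (simp add: powr_powr powr_power mult.commute flip: powr_realpow)
  moreover have "r powr s < 1" using r assms powr_less_mono2[of s r 1] by simp
  ultimately show ?thesis by (simp add: summable_geometric)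
qed

context iid_perpetuity begin

lemma zeta_low_moment:
  assumes q: "0 < q" "q < \<alpha>"
  defines "\<sigma> \<equiv> \<integral>\<omega>. Y 1 \<omega> powr q \<partial>M"
  assumes i: "1 \<le> i"
  shows "integrable M (\<lambda>\<omega>. \<zeta> i \<omega> powr q)" "moment M (\<zeta> i) q = \<sigma> ^ (i - 1)"
proof -
  have Yq: "integrable M (\<lambda>\<omega>. Y j \<omega> powr q)" if "1 \<le> j" for j
  proof -
    have "integrable M (\<lambda>\<omega>. Y j \<omega> powr \<alpha>)" using Y_breiman_all(1)[OF that] by (simp add: breiman_def)
    from integrable_lower_powr[OF prob XY_measurable(2)[OF that] Y_nonneg[OF that] this] q
    show ?thesis by simp
  qed
  have Yeq: "moment M (Y j) q = \<sigma>" if "1 \<le> j" for j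
    using ident_integral(1)[OF that, of "\<lambda>z. snd z powr q"] unfolding \<sigma>_def by simp
  have "integrable M (\<lambda>\<omega>. \<zeta> i \<omega> powr q) \<and> moment M (\<zeta> i) q = \<sigma> ^ (i - 1)"
    using i
  proof (induction i rule: dec_induct)
    case base
    show ?case by (simp add: zeta_1 M.prob_space)
  next
    case (step i)
    have eq: "\<zeta> (Suc i) \<omega> powr q = \<zeta> i \<omega> powr q * Y i \<omega> powr q" if "\<omega> \<in> space M" for \<omega>
      using zeta_nonneg[OF that] Y_nonneg[OF step(1) that] by (simp add: zeta_Suc[OF step(1)] powr_mult)
    have ind: "M.indep_var borel (\<lambda>\<omega>. \<zeta> i \<omega> powr q) borel (\<lambda>\<omega>. Y i \<omega> powr q)"
      using M.indep_var_compose[OF indep_zeta_Y[OF step(1)], of "\<lambda>v. v powr q" borel "\<lambda>v. v powr q" borel] by (simp add: comp_def)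
    have int: "integrable M (\<lambda>\<omega>. \<zeta> i \<omega> powr q)" "integrable M (\<lambda>\<omega>. Y i \<omega> powr q)" using step Yq by auto
    have "(\<sigma> ^ (i - 1)) * \<sigma> = \<sigma> ^ i" using step(1) by (cases i) auto
    then show ?case
      using M.indep_var_lebesgue_integral[OF ind int] M.indep_var_integrable[OF ind int] step Yeq[OF step(1)]
        Bochner_Integration.integral_cong[OF refl eq, of M] Bochner_Integration.integrable_cong[OF refl eq, of M] by simp
  qed
  then show "integrable M (\<lambda>\<omega>. \<zeta> i \<omega> powr q)" "moment M (\<zeta> i) q = \<sigma> ^ (i - 1)" by auto
qed

text \<open>By the Cauchy-Schwarz inequality, here in the form that a variance is nonnegative.\<close>

lemma half_moment_less_1: "(\<integral>\<omega>. Y 1 \<omega> powr (\<alpha> / 2) \<partial>M) < 1"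
proof -
  define \<sigma> where "\<sigma> = (\<integral>\<omega>. Y 1 \<omega> powr (\<alpha> / 2) \<partial>M)"
  have q: "0 < \<alpha> / 2" "\<alpha> / 2 < \<alpha>" using alpha_pos by auto
  have i1: "integrable M (\<lambda>\<omega>. Y 1 \<omega> powr (\<alpha> / 2))"
    using zeta_low_moment(1)[OF q, of 2] by (simp add: zeta_prod_def numeral_2_eq_2 atLeastLessThanSuc)
  have i2: "integrable M (\<lambda>\<omega>. Y 1 \<omega> powr \<alpha>)" using Y_breiman by (simp add: breiman_def)
  have half: "Y 1 \<omega> powr \<alpha> = Y 1 \<omega> powr (\<alpha> / 2) * Y 1 \<omega> powr (\<alpha> / 2)" for \<omega> by (simp flip: powr_add)
  have sq: "(Y 1 \<omega> powr (\<alpha> / 2) - \<sigma>)\<^sup>2 = Y 1 \<omega> powr \<alpha> - 2 * \<sigma> * Y 1 \<omega> powr (\<alpha> / 2) + \<sigma>\<^sup>2" for \<omega>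
    unfolding half by (simp add: power2_eq_square algebra_simps)
  have "0 \<le> (\<integral>\<omega>. (Y 1 \<omega> powr (\<alpha> / 2) - \<sigma>)\<^sup>2 \<partial>M)" by (intro Bochner_Integration.integral_nonneg) auto
  also have "\<dots> = \<rho> - 2 * \<sigma> * \<sigma> + \<sigma>\<^sup>2"
    unfolding sq using i1 i2 by (simp add: \<rho>_def \<sigma>_def[symmetric] M.prob_space del: One_nat_def)
  finally have "\<sigma>\<^sup>2 \<le> \<rho>" by (simp add: power2_eq_square)
  then have "\<sigma>\<^sup>2 < 1" using \<rho>_less_1 by linarith
  then have "\<sigma> < 1" using abs_square_less_1[of \<sigma>] by simp
  then show ?thesis unfolding \<sigma>_def .
qed

text \<open>The tails of the \<open>Z i\<close> are bounded by the sum of \<open>c i\<close> and two geometric sequences.  Its root of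
order \<open>p\<close> is summable, since \<open>powr (1 / p)\<close> is subadditive.\<close>

lemma perpetuity_tail_controlled:
  assumes con: "controls M h" and p: "\<alpha> < p" "1 \<le> p"
    and c0: "\<And>i. 2 \<le> i \<Longrightarrow> 0 \<le> c i"
    and ct: "\<And>i t. 2 \<le> i \<Longrightarrow> A \<le> t \<Longrightarrow> \<P>(\<omega> in M. \<zeta> i \<omega> > t) \<le> c i * h t"
    and cs: "summable (\<lambda>i. c (i + 2) powr (1 / p))"
  shows "((\<lambda>x. \<P>(\<omega> in M. \<exists>n\<ge>1. x < (\<Sum>i=1..n. Z i \<omega>)) / Fbar x) \<longlongrightarrow> k / (1 - \<rho>)) at_top"
proof -
  define q where "q = \<alpha> / 2"
  have q: "0 < q" "q < \<alpha>" "0 \<le> q" unfolding q_def using alpha_pos by auto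
  define \<sigma> where "\<sigma> = moment M (Y 1) q"
  have \<sigma>: "0 \<le> \<sigma>" "\<sigma> < 1" unfolding \<sigma>_def q_def using half_moment_less_1 by (auto intro: Bochner_Integration.integral_nonneg)
  let ?W = "\<lambda>t. \<P>(\<omega> in M. X 1 \<omega> * Y 1 \<omega> > t)"
  obtain D where D: "0 \<le> D" "\<And>t. 0 \<le> t \<Longrightarrow> \<bar>?W t\<bar> \<le> D * Fbar t"
    using comparable_bound[OF XY_tail, of 1] by auto
  obtain C where C: "0 \<le> C" and bd: "\<And>V c u. V \<in> borel_measurable M \<Longrightarrow> (\<forall>\<omega>\<in>space M. 0 \<le> V \<omega>) \<Longrightarrow>
     integrable M (\<lambda>\<omega>. V \<omega> powr \<alpha>) \<Longrightarrow> 0 \<le> c \<Longrightarrow>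
     (\<And>t. A \<le> t \<Longrightarrow> \<P>(\<omega> in M. V \<omega> > t) \<le> c * h t) \<Longrightarrow> 0 < u \<Longrightarrow>
     (mean_scaled M Fbar V u)
       \<le> C * (c + moment M V \<alpha> + moment M V q) * (Fbar u * max 1 (u powr (- q)))"
    by (rule controls_uniform_bound[OF prob con q(3,2)]) blast
  define s where "s = 1 / p"
  have s: "0 < s" "s \<le> 1" unfolding s_def using p by auto
  define K where "K = D * C"
  have K: "0 \<le> K" unfolding K_def using D C by simp
  define c' where "c' = (\<lambda>i. if 2 \<le> i then c i else 0)"
  have c': "0 \<le> c' i" for i unfolding c'_def using c0 by simp
  \<comment> \<open>The last summand only serves to make the bounds positive.\<close>
  define B where "B = (\<lambda>i. K * c' i + (K * \<rho> ^ (i - 1) + (K * \<sigma> ^ (i - 1) + (1 / 2) ^ i)))"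
  have B: "0 < B i" for i unfolding B_def using K c' \<rho>_nonneg \<sigma> by (intro add_nonneg_pos) auto
  define b where "b = (\<lambda>i. B i powr s)"
  have bp: "b i powr p = B i" for i unfolding b_def s_def using B[of i] p by (simp add: powr_powr)
  have "summable b"
  proof (rule summable_comparison_test)
    let ?g = "\<lambda>i. K powr s * c' i powr s + (K powr s * (\<rho> ^ (i - 1)) powr s + (K powr s * (\<sigma> ^ (i - 1)) powr s + ((1 / 2) ^ i) powr s))"
    have "b i \<le> ?g i" for i
    proof -
      have "b i \<le> (K * c' i) powr s + (K * \<rho> ^ (i - 1) + (K * \<sigma> ^ (i - 1) + (1 / 2) ^ i)) powr s"
        unfolding b_def B_def using K c' \<rho>_nonneg \<sigma> s by (intro powr_subadditive) auto
      also have "\<dots> \<le> (K * c' i) powr s + ((K * \<rho> ^ (i - 1)) powr s + (K * \<sigma> ^ (i - 1) + (1 / 2) ^ i) powr s)"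
        using K \<rho>_nonneg \<sigma> s by (intro add_left_mono powr_subadditive) auto
      also have "\<dots> \<le> (K * c' i) powr s + ((K * \<rho> ^ (i - 1)) powr s + ((K * \<sigma> ^ (i - 1)) powr s + ((1 / 2) ^ i) powr s))"
        using K \<sigma> s by (intro add_left_mono powr_subadditive) auto
      finally show ?thesis using K c' \<rho>_nonneg \<sigma> by (simp add: powr_mult)
    qed
    then show "\<exists>N. \<forall>n\<ge>N. norm (b n) \<le> ?g n" using B by (auto simp: b_def)
    have pred: "summable (\<lambda>i. (r ^ (i - 1)) powr s)" if "0 \<le> r" "r < 1" for r
      using summable_geometric_powr[OF that s(1)] summable_Suc_iff[of "\<lambda>i. (r ^ (i - 1)) powr s"] by simp
    have "summable (\<lambda>i. c' (i + 2) powr s)" using cs unfolding c'_def s_def by simp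
    then have "summable (\<lambda>i. c' i powr s)" using summable_iff_shift[of "\<lambda>i. c' i powr s" 2] by simp
    then show "summable ?g"
      using pred[OF \<rho>_nonneg \<rho>_less_1] pred[OF \<sigma>] summable_geometric_powr[of "1/2" s] s
      by (intro summable_add summable_mult) auto
  qed
  moreover have "\<P>(\<omega> in M. Z i \<omega> > u) \<le> b i powr p * (Fbar u * max 1 (u powr (- q)))"
    if i: "2 \<le> i" and u: "0 < u" for i u
  proof -
    have i1: "1 \<le> i" using i by simp
    have zint: "integrable M (\<lambda>\<omega>. \<zeta> i \<omega> powr \<alpha>)" using breiman_zeta(1)[OF i1] by (simp add: breiman_def)
    have \<Phi>0: "0 \<le> Fbar u * max 1 (u powr (- q))" using Fbar_nonneg by simp
    have Wm: "?W \<in> borel_measurable borel"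
      using XY_measurable[of 1] by (intro antimono_borel M.tail_antimono borel_measurable_times) auto
    have "\<P>(\<omega> in M. Z i \<omega> > u) = (mean_scaled M ?W (\<zeta> i) u)"
      unfolding Z_def using M.product_tail[OF indep_zeta_XY[OF i1] zeta_nonneg, of u] u XY_tail_eq[OF i1] by simp
    also have "\<dots> \<le> (\<integral>\<omega>. D * scaled Fbar u (\<zeta> i \<omega>) \<partial>M)"
    proof (rule integral_mono)
      show "integrable M (\<lambda>\<omega>. scaled ?W u (\<zeta> i \<omega>))"
      proof (rule M.integrable_const_bound[where B=1])
        show "(\<lambda>\<omega>. scaled ?W u (\<zeta> i \<omega>)) \<in> borel_measurable M" by (rule scaled_measurable[OF Wm zeta_measurable])
      qed (simp add: scaled_def)
      show "integrable M (\<lambda>\<omega>. D * scaled Fbar u (\<zeta> i \<omega>))"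
        by (intro integrable_mult_right scaled_Fbar_integrable prob zeta_measurable)
      show "scaled ?W u (\<zeta> i \<omega>) \<le> D * scaled Fbar u (\<zeta> i \<omega>)" for \<omega>
        using D(2)[of "u / \<zeta> i \<omega>"] u by (auto simp: scaled_def)
    qed
    also have "\<dots> = D * (mean_scaled M Fbar (\<zeta> i) u)" by simp
    also have "\<dots> \<le> D * (C * (c i + moment M (\<zeta> i) \<alpha> + moment M (\<zeta> i) q) * (Fbar u * max 1 (u powr (- q))))"
      using zeta_nonneg zint c0[OF i] ct[OF i] u D(1) by (intro mult_left_mono bd) auto
    also have "\<dots> = (K * (c i + \<rho> ^ (i - 1) + \<sigma> ^ (i - 1))) * (Fbar u * max 1 (u powr (- q)))"
      unfolding K_def \<sigma>_def using breiman_zeta(2)[OF i1] zeta_low_moment(2)[OF q(1,2) i1] by simp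
    also have "\<dots> \<le> B i * (Fbar u * max 1 (u powr (- q)))"
      using i by (intro mult_right_mono \<Phi>0) (simp add: B_def c'_def algebra_simps)
    finally show ?thesis unfolding bp .
  qed
  moreover have "0 < b i" for i using B[of i] unfolding b_def by simp
  ultimately show ?thesis by (intro perpetuity_tail[OF p q(3,2)])
qed

end

lemma C_summable_exponent:
  assumes "C_summable \<alpha> C" and nn: "\<And>i. 2 \<le> i \<Longrightarrow> 0 \<le> C i"
  obtains p where "\<alpha> < p" "1 \<le> p" "summable (\<lambda>i. real_of_ereal (C (i + 2)) powr (1 / p))"
proof (cases "\<alpha> < 1")
  case True
  then have "summable (\<lambda>i. real_of_ereal (C (i + 2)))" using assms unfolding C_summable_def by simp
  moreover have "real_of_ereal (C (i + 2)) powr (1 / 1) = real_of_ereal (C (i + 2))" for i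
    using nn[of "i + 2"] by (simp add: real_of_ereal_pos)
  ultimately show ?thesis using True by (intro that[of 1]) auto
next
  case False
  then obtain \<epsilon> where "0 < \<epsilon>" "summable (\<lambda>i. real_of_ereal (C (i + 2)) powr (1 / (\<alpha> + \<epsilon>)))"
    using assms unfolding C_summable_def by auto
  then show ?thesis using False by (intro that[of "\<alpha> + \<epsilon>"]) auto
qed

lemma SUP_ereal_bound:
  assumes "(SUP x\<in>{1..}. ereal (f x)) < \<infinity>" "1 \<le> x" "\<And>x::real. 1 \<le> x \<Longrightarrow> 0 \<le> f x"
  shows "f x \<le> real_of_ereal (SUP x\<in>{1..}. ereal (f x))" "0 \<le> (SUP x\<in>{1..}. ereal (f x))"
proof -
  have le: "ereal (f x) \<le> (SUP x\<in>{1..}. ereal (f x))" using assms(2) by (intro SUP_upper) auto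
  then show nn: "0 \<le> (SUP x\<in>{1..}. ereal (f x))" using assms(2,3) by (meson ereal_less_eq(5) order_trans)
  then show "f x \<le> real_of_ereal (SUP x\<in>{1..}. ereal (f x))"
    using le assms(1) by (cases "SUP x\<in>{1..}. ereal (f x)") auto
qed

lemma (in prob_space) upper_tail_markov:
  assumes Y[measurable]: "Y \<in> borel_measurable M" and Y0: "\<And>\<omega>. \<omega> \<in> space M \<Longrightarrow> 0 \<le> Y \<omega>"
    and int: "integrable M (\<lambda>\<omega>. Y \<omega> powr \<alpha>)" and \<alpha>: "0 < \<alpha>" and t: "0 < t"
  shows "prob {\<omega> \<in> space M. Y \<omega> > t} \<le> (\<integral>\<omega>. indicator {t<..} (Y \<omega>) * Y \<omega> powr \<alpha> \<partial>M) * t powr (-\<alpha>)"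
    and "prob {\<omega> \<in> space M. Y \<omega> > t} \<le> moment M Y \<alpha> * t powr (-\<alpha>)"
proof -
  have i1: "integrable M (\<lambda>\<omega>. indicator {t<..} (Y \<omega>) * Y \<omega> powr \<alpha>)"
    by (rule Bochner_Integration.integrable_bound[OF int]) (auto simp: indicator_def)
  have "t powr \<alpha> * prob {\<omega> \<in> space M. Y \<omega> > t} = (\<integral>\<omega>. t powr \<alpha> * indicator {\<omega> \<in> space M. Y \<omega> > t} \<omega> \<partial>M)"
    by (simp add: Int_def conj_ac cong: conj_cong)
  also have "\<dots> \<le> (\<integral>\<omega>. indicator {t<..} (Y \<omega>) * Y \<omega> powr \<alpha> \<partial>M)"
  proof (rule integral_mono[OF _ i1])
    show "integrable M (\<lambda>\<omega>. t powr \<alpha> * indicator {\<omega> \<in> space M. Y \<omega> > t} \<omega>)"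
      by (intro integrable_mult_right integrable_const_bound[where B=1]) auto
    show "t powr \<alpha> * indicator {\<omega> \<in> space M. Y \<omega> > t} \<omega> \<le> indicator {t<..} (Y \<omega>) * Y \<omega> powr \<alpha>" for \<omega>
      using \<alpha> t by (auto simp: indicator_def intro!: powr_mono2)
  qed
  finally have 1: "t powr \<alpha> * prob {\<omega> \<in> space M. Y \<omega> > t} \<le> (\<integral>\<omega>. indicator {t<..} (Y \<omega>) * Y \<omega> powr \<alpha> \<partial>M)" .
  then show "prob {\<omega> \<in> space M. Y \<omega> > t} \<le> (\<integral>\<omega>. indicator {t<..} (Y \<omega>) * Y \<omega> powr \<alpha> \<partial>M) * t powr (-\<alpha>)"
    using t by (simp add: powr_minus field_simps)
  also have "\<dots> \<le> moment M Y \<alpha> * t powr (-\<alpha>)"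
    using i1 int by (intro mult_right_mono integral_mono) (auto simp: indicator_def)
  finally show "prob {\<omega> \<in> space M. Y \<omega> > t} \<le> moment M Y \<alpha> * t powr (-\<alpha>)" .
qed

lemma smallo_bound:
  assumes "f \<in> o[at_top](g)" and "\<And>x. 0 \<le> g x" and "\<And>x. 0 \<le> f x" and \<eta>: "0 < \<eta>"
  shows "\<exists>A::real. \<forall>t\<ge>A. f t \<le> \<eta> * (g t :: real)"
  using landau_o.smallD[OF assms(1) \<eta>] assms(2,3) unfolding eventually_at_top_linorder by simp

section \<open>The tail of the supremum\<close>

text \<open>
It remains to match the hypotheses.  The only choice is that of \<open>h\<close>, made separately for each of the four
conditions; in the first one the constants are the moments \<open>\<rho> ^ (i - 1)\<close>, by Markov's inequality.\<close>

theorem theorem4p5: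
  fixes M :: "'a measure"
    and X Y :: "nat \<Rightarrow> 'a \<Rightarrow> real"
    and F G :: "real measure"
    and \<phi>1 \<phi>2 :: "real \<Rightarrow> real"
    and \<alpha> \<theta> d1 :: real
  defines "K \<equiv> ((\<integral>\<omega>. Y 1 \<omega> powr \<alpha> \<partial>M) + \<theta> * d1 * (\<integral>\<omega>. \<phi>2 (Y 1 \<omega>) * Y 1 \<omega> powr \<alpha> \<partial>M))
                / (1 - (\<integral>\<omega>. Y 1 \<omega> powr \<alpha> \<partial>M))"
    and "S \<equiv> (\<lambda>x. measure M {\<omega> \<in> space M.
                (SUP n\<in>{1..}. ereal (\<Sum>i=1..n. X i \<omega> * (\<Prod>j=1..i. Y j \<omega>))) > ereal x})"
    and "T \<equiv> (\<lambda>x. measure M {\<omega> \<in> space M. X 1 \<omega> > x})"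
  assumes "prob_space M"
    and "\<alpha> > 0"
    and "prob_space.indep_vars M (\<lambda>_. borel \<Otimes>\<^sub>M borel) (\<lambda>i \<omega>. (X i \<omega>, Y i \<omega>)) {1..}"
    and "\<forall>i\<ge>1. distr M (borel \<Otimes>\<^sub>M borel) (\<lambda>\<omega>. (X i \<omega>, Y i \<omega>))
              = distr M (borel \<Otimes>\<^sub>M borel) (\<lambda>\<omega>. (X 1 \<omega>, Y 1 \<omega>))"
    and "sarmanov M (X 1) (Y 1) F G \<phi>1 \<phi>2 \<theta>"
    and "regularly_varying_tail \<alpha> F"
    and "integrable M (\<lambda>\<omega>. Y 1 \<omega> powr \<alpha>)"
    and "(\<integral>\<omega>. Y 1 \<omega> powr \<alpha> \<partial>M) < 1"
    and "tail G \<in> o[at_top](tail F)"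
    and "(\<phi>1 \<longlongrightarrow> d1) at_top"
    and "DZ1 \<alpha> F
       \<or> DZ2 \<alpha> F \<and> C_summable \<alpha> (C_DZ2 M Y F)
       \<or> (\<exists>U. DZ3 \<alpha> F G U \<and> C_summable \<alpha> (C_DZ3 M Y \<alpha> U))
       \<or> DZ4 \<alpha> F G \<and> C_summable \<alpha> (C_DZ4 M Y \<alpha> F)"
  shows "(K \<noteq> 0 \<longrightarrow> tail_equiv S (\<lambda>x. K * T x)) \<and> (K = 0 \<longrightarrow> S \<in> o[at_top](T))"
proof -
  interpret M: prob_space M by fact
  note indep = assms(6) and ident = assms(7) and sar = assms(8) and rv = assms(9)
    and Yint = assms(10) and Yless = assms(11) and Gsmall = assms(12) and \<phi>lim = assms(13) and DZ = assms(14)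
  let ?P = "borel \<Otimes>\<^sub>M borel :: (real \<times> real) measure"
  have XYm: "(\<lambda>\<omega>. (X i \<omega>, Y i \<omega>)) \<in> measurable M ?P" if "1 \<le> i" for i
    using indep that unfolding M.indep_vars_def by auto
  have Xm: "X i \<in> borel_measurable M" and Ym: "Y i \<in> borel_measurable M" if "1 \<le> i" for i
    using measurable_compose[OF XYm[OF that] measurable_fst] measurable_compose[OF XYm[OF that] measurable_snd] by auto
  have s1: "AE \<omega> in M. 0 \<le> Y 1 \<omega>" and FX: "distr M borel (X 1) = F" and GY: "distr M borel (Y 1) = G"
    and \<phi>m: "\<phi>1 \<in> borel_measurable borel" "\<phi>2 \<in> borel_measurable borel"
    using sar unfolding sarmanov_def by auto
  have Ypos: "AE \<omega> in M. 0 \<le> Y i \<omega>" if i: "1 \<le> i" for i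
  proof -
    have pr: "{z \<in> space ?P. 0 \<le> snd z} \<in> sets ?P" by measurable
    have "AE z in distr M ?P (\<lambda>\<omega>. (X 1 \<omega>, Y 1 \<omega>)). 0 \<le> snd z"
      using s1 by (subst AE_distr_iff[OF XYm[OF order_refl] pr]) simp
    then have "AE z in distr M ?P (\<lambda>\<omega>. (X i \<omega>, Y i \<omega>)). 0 \<le> snd z"
      unfolding ident[rule_format, OF i] .
    then show ?thesis by (subst (asm) AE_distr_iff[OF XYm[OF i] pr]) simp
  qed
  \<comment> \<open>The weights are nonnegative only almost surely; truncation at zero makes them so everywhere.\<close>
  define Y' where "Y' = (\<lambda>i \<omega>. max 0 (Y i \<omega>))"
  have Y'm: "Y' i \<in> borel_measurable M" if "1 \<le> i" for i unfolding Y'_def using Ym[OF that] by measurable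
  have Y'0: "0 \<le> Y' i \<omega>" for i \<omega> unfolding Y'_def by simp
  have YY: "AE \<omega> in M. \<forall>i\<in>{1..}. Y' i \<omega> = Y i \<omega>"
    unfolding AE_ball_countable[OF countableI_type]
  proof
    fix i :: nat assume "i \<in> {1..}"
    then have "AE \<omega> in M. 0 \<le> Y i \<omega>" by (intro Ypos) simp
    then show "AE \<omega> in M. Y' i \<omega> = Y i \<omega>" by eventually_elim (simp add: Y'_def)
  qed
  have YY1: "AE \<omega> in M. Y' 1 \<omega> = Y 1 \<omega>" using YY by eventually_elim simp
  note m1 = Xm[OF order_refl] Ym[OF order_refl] Y'm[OF order_refl]
  have dY': "distr M borel (Y' 1) = G"
    unfolding GY[symmetric] by (rule distr_cong_AE) (use YY1 m1 in auto)
  have dXY': "distr M ?P (\<lambda>\<omega>. (X 1 \<omega>, Y' 1 \<omega>)) = distr M ?P (\<lambda>\<omega>. (X 1 \<omega>, Y 1 \<omega>))"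
  proof (rule distr_cong_AE)
    show "AE \<omega> in M. (X 1 \<omega>, Y' 1 \<omega>) = (X 1 \<omega>, Y 1 \<omega>)" using YY1 by eventually_elim simp
    show "(\<lambda>\<omega>. (X 1 \<omega>, Y' 1 \<omega>)) \<in> measurable M ?P" using m1 by (intro measurable_Pair)
    show "(\<lambda>\<omega>. (X 1 \<omega>, Y 1 \<omega>)) \<in> measurable M ?P" by (rule XYm[OF order_refl])
  qed simp_all
  have cong: "(\<integral>\<omega>. f (Y' 1 \<omega>) \<partial>M) = (\<integral>\<omega>. f (Y 1 \<omega>) \<partial>M)" "integrable M (\<lambda>\<omega>. f (Y' 1 \<omega>)) = integrable M (\<lambda>\<omega>. f (Y 1 \<omega>))"
    if "f \<in> borel_measurable borel" for f :: "real \<Rightarrow> real"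
  proof -
    have ae: "AE \<omega> in M. f (Y' 1 \<omega>) = f (Y 1 \<omega>)" using YY1 by eventually_elim simp
    note mm = measurable_compose[OF m1(3) that] measurable_compose[OF m1(2) that]
    show "(\<integral>\<omega>. f (Y' 1 \<omega>) \<partial>M) = (\<integral>\<omega>. f (Y 1 \<omega>) \<partial>M)" by (rule integral_cong_AE[OF mm ae])
    show "integrable M (\<lambda>\<omega>. f (Y' 1 \<omega>)) = integrable M (\<lambda>\<omega>. f (Y 1 \<omega>))" by (rule integrable_cong_AE[OF mm ae])
  qed
  have sar': "sarmanov M (X 1) (Y' 1) F G \<phi>1 \<phi>2 \<theta>"
    using sar m1 Y'0 unfolding sarmanov_def dY' dXY' cong[OF \<phi>m(2)] by simp
  have indep': "M.indep_vars (\<lambda>_. ?P) (\<lambda>i \<omega>. (X i \<omega>, Y' i \<omega>)) {1..}"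
  proof -
    have "M.indep_vars (\<lambda>_. ?P) (\<lambda>i \<omega>. (\<lambda>z. (fst z, max 0 (snd z))) (X i \<omega>, Y i \<omega>)) {1..}"
      by (rule M.indep_vars_compose2[OF indep]) measurable
    then show ?thesis unfolding Y'_def by simp
  qed
  have ident': "\<forall>i\<ge>1. distr M ?P (\<lambda>\<omega>. (X i \<omega>, Y' i \<omega>)) = distr M ?P (\<lambda>\<omega>. (X 1 \<omega>, Y' 1 \<omega>))"
  proof (intro allI impI)
    fix i :: nat assume i: "1 \<le> i"
    let ?g = "\<lambda>z :: real \<times> real. (fst z, max 0 (snd z))"
    have gm: "?g \<in> measurable ?P ?P" by measurable
    have *: "distr M ?P (\<lambda>\<omega>. (X j \<omega>, Y' j \<omega>)) = distr (distr M ?P (\<lambda>\<omega>. (X j \<omega>, Y j \<omega>))) ?P ?g" if "1 \<le> j" for j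
      by (subst distr_distr[OF gm XYm[OF that]]) (simp add: Y'_def comp_def)
    show "distr M ?P (\<lambda>\<omega>. (X i \<omega>, Y' i \<omega>)) = distr M ?P (\<lambda>\<omega>. (X 1 \<omega>, Y' 1 \<omega>))"
      unfolding *[OF i] *[OF order_refl] ident[rule_format, OF i] ..
  qed
  have law: "real_distribution F" unfolding FX[symmetric] by (rule M.real_distribution_distr[OF m1(1)])
  interpret R: rv_law F \<alpha> by (rule rv_law.intro) (use law rv assms(5) in auto)
  have Y'int: "integrable M (\<lambda>\<omega>. Y' 1 \<omega> powr \<alpha>)" using cong(2)[of "\<lambda>y. y powr \<alpha>"] Yint by simp
  have tG: "tail G t = measure M {\<omega> \<in> space M. Y' 1 \<omega> > t}" for t
    unfolding tail_def dY'[symmetric] by (subst measure_distr[OF m1(3)]) (auto intro!: arg_cong[where f="measure M"])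
  have tF: "tail F t = T t" for t
    unfolding tail_def T_def FX[symmetric] by (subst measure_distr[OF m1(1)]) (auto intro!: arg_cong[where f="measure M"])
  have tG0: "0 \<le> tail G t" for t unfolding tail_def by simp
  have g1: "\<exists>A. \<forall>t\<ge>A. tail G t \<le> \<eta> * t powr (-\<alpha>)" if "0 < \<eta>" for \<eta>
  proof -
    have "\<forall>\<^sub>F t in at_top. (\<integral>\<omega>. indicator {t<..} (Y' 1 \<omega>) * Y' 1 \<omega> powr \<alpha> \<partial>M) < \<eta>"
      using order_tendstoD(2)[OF M.upper_moment_tendsto_0[OF m1(3) Y'int] that] .
    then have "\<forall>\<^sub>F t in at_top. tail G t \<le> \<eta> * t powr (-\<alpha>)"
      using eventually_gt_at_top[of 0]
    proof eventually_elim
      fix t :: real assume *: "(\<integral>\<omega>. indicator {t<..} (Y' 1 \<omega>) * Y' 1 \<omega> powr \<alpha> \<partial>M) < \<eta>" and t: "0 < t"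
      have "tail G t \<le> (\<integral>\<omega>. indicator {t<..} (Y' 1 \<omega>) * Y' 1 \<omega> powr \<alpha> \<partial>M) * t powr (-\<alpha>)"
        unfolding tG by (rule M.upper_tail_markov(1)[OF m1(3) Y'0 Y'int assms(5) t])
      also have "\<dots> \<le> \<eta> * t powr (-\<alpha>)" using * by (intro mult_right_mono) auto
      finally show "tail G t \<le> \<eta> * t powr (-\<alpha>)" .
    qed
    then show ?thesis unfolding eventually_at_top_linorder .
  qed
  have br_of: "R.breiman M (Y' 1)" if "R.controls M h" "\<And>\<eta>. 0 < \<eta> \<Longrightarrow> \<exists>A. \<forall>t\<ge>A. tail G t \<le> \<eta> * h t" for h
    by (rule R.controls_imp_breiman[OF \<open>prob_space M\<close> that(1) m1(3) Y'0 Y'int]) (use that(2) tG in simp)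
  have m0: "0 \<le> truncated_moment \<alpha> F t" for t
    unfolding R.truncated_moment_eq by (intro Bochner_Integration.integral_nonneg) auto
  have br: "R.breiman M (Y' 1)"
    using DZ
  proof (elim disjE exE conjE)
    assume "DZ1 \<alpha> F"
    from br_of[OF R.DZ1_controls[OF \<open>prob_space M\<close> this] g1] show ?thesis .
  next
    assume "DZ2 \<alpha> F"
    show ?thesis
      by (rule br_of[OF R.DZ2_controls[OF \<open>prob_space M\<close> \<open>DZ2 \<alpha> F\<close>] smallo_bound[OF Gsmall R.Fbar_nonneg tG0]])
  next
    fix U assume "DZ3 \<alpha> F G U"
    then have "tail G \<in> o[at_top](\<lambda>x. x powr (-\<alpha>) * tail U (ln x))" unfolding DZ3_def by simp
    from smallo_bound[OF this _ tG0] show ?thesis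
      by (intro br_of[OF R.DZ3_controls[OF \<open>prob_space M\<close> \<open>DZ3 \<alpha> F G U\<close>]]) (simp_all add: tail_def)
  next
    assume "DZ4 \<alpha> F G"
    then have "tail G \<in> o[at_top](\<lambda>x. tail F x / truncated_moment \<alpha> F x)" unfolding DZ4_def by simp
    from smallo_bound[OF this _ tG0] show ?thesis
      using m0 R.Fbar_nonneg by (intro br_of[OF R.DZ4_controls[OF \<open>prob_space M\<close> \<open>DZ4 \<alpha> F G\<close>]]) simp_all
  qed
  define \<rho> where "\<rho> = (\<integral>\<omega>. Y' 1 \<omega> powr \<alpha> \<partial>M)"
  define k where "k = \<rho> + \<theta> * d1 * (\<integral>\<omega>. \<phi>2 (Y' 1 \<omega>) * Y' 1 \<omega> powr \<alpha> \<partial>M)"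
  have \<rho>_eq: "\<rho> = (\<integral>\<omega>. Y 1 \<omega> powr \<alpha> \<partial>M)" unfolding \<rho>_def using cong(1)[of "\<lambda>y. y powr \<alpha>"] by simp
  have k_eq: "K = k / (1 - \<rho>)"
    unfolding K_def k_def \<rho>_eq using cong(1)[of "\<lambda>y. \<phi>2 y * y powr \<alpha>"] \<phi>m by simp
  interpret I: iid_perpetuity F \<alpha> M X Y' k \<rho>
  proof (unfold_locales)
    show "((\<lambda>t. measure M {\<omega> \<in> space M. Y' 1 \<omega> > t} / tail F t) \<longlongrightarrow> 0) at_top"
      using smalloD_tendsto[OF Gsmall] unfolding tG .
    show "((\<lambda>t. measure M {\<omega> \<in> space M. X 1 \<omega> * Y' 1 \<omega> > t} / tail F t) \<longlongrightarrow> k) at_top"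
      unfolding k_def \<rho>_def by (rule R.sarmanov_product_tail[OF \<open>prob_space M\<close> sar' br \<phi>lim])
    show "\<rho> < 1" using Yless \<rho>_eq by simp
  qed (rule \<open>prob_space M\<close> indep' ident' Y'0 br \<rho>_def)+
  let ?S = "\<lambda>x. measure M {\<omega> \<in> space M. \<exists>n\<ge>1. x < (\<Sum>i=1..n. I.Z i \<omega>)}"
  have zeq: "measure M {\<omega> \<in> space M. zeta_prod Y' i \<omega> > x} = measure M {\<omega> \<in> space M. zeta_prod Y i \<omega> > x}" for i x
  proof (rule M.finite_measure_eq_AE)
    have "zeta_prod Y i \<in> borel_measurable M" unfolding zeta_prod_def by (intro borel_measurable_prod Ym) auto
    then show "{\<omega> \<in> space M. zeta_prod Y i \<omega> > x} \<in> sets M" by measurable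
    show "{\<omega> \<in> space M. zeta_prod Y' i \<omega> > x} \<in> sets M" by measurable
    show "AE \<omega> in M. \<omega> \<in> {\<omega> \<in> space M. zeta_prod Y' i \<omega> > x} \<longleftrightarrow> \<omega> \<in> {\<omega> \<in> space M. zeta_prod Y i \<omega> > x}"
      using YY
    proof eventually_elim
      fix \<omega> assume *: "\<forall>i\<in>{1..}. Y' i \<omega> = Y i \<omega>"
      have "zeta_prod Y' i \<omega> = zeta_prod Y i \<omega>" unfolding zeta_prod_def using * by (intro prod.cong) auto
      then show "\<omega> \<in> {\<omega> \<in> space M. zeta_prod Y' i \<omega> > x} \<longleftrightarrow> \<omega> \<in> {\<omega> \<in> space M. zeta_prod Y i \<omega> > x}" by simp
    qed
  qed
  \<comment> \<open>The three definitions of the constants differ only in the comparison function \<open>h\<close>.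
    The level \<open>A\<close> is there because the truncated moment, and with it \<open>h\<close>, may vanish at small arguments.\<close>
  have from_SUP: "((\<lambda>x. ?S x / tail F x) \<longlongrightarrow> k / (1 - \<rho>)) at_top"
    if con: "R.controls M h" and CS: "C_summable \<alpha> C" and hpos: "\<And>t. A \<le> t \<Longrightarrow> 0 < h t" and A: "1 \<le> A"
      and C: "\<And>i. C i = (SUP x\<in>{1..}. ereal (f i x))" and f0: "\<And>i x. 1 \<le> x \<Longrightarrow> 0 \<le> f i x"
      and f: "\<And>i x. A \<le> x \<Longrightarrow> f i x = measure M {\<omega> \<in> space M. zeta_prod Y i \<omega> > x} / h x"
    for h C A and f :: "nat \<Rightarrow> real \<Rightarrow> real"
  proof -
    have nn: "0 \<le> C i" and le: "1 \<le> x \<Longrightarrow> f i x \<le> real_of_ereal (C i)" if "2 \<le> i" for i x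
    proof -
      have fin: "(SUP x\<in>{1..}. ereal (f i x)) < \<infinity>" using CS that unfolding C_summable_def C by simp
      show "0 \<le> C i" using SUP_ereal_bound(2)[OF fin order_refl f0] unfolding C .
      show "1 \<le> x \<Longrightarrow> f i x \<le> real_of_ereal (C i)" using SUP_ereal_bound(1)[OF fin _ f0] unfolding C .
    qed
    obtain p where p: "\<alpha> < p" "1 \<le> p" "summable (\<lambda>i. real_of_ereal (C (i + 2)) powr (1 / p))"
      using C_summable_exponent[OF CS nn] by blast
    show ?thesis
    proof (rule I.perpetuity_tail_controlled[OF con p(1,2), where A=A and c="\<lambda>i. real_of_ereal (C i)"])
      show "0 \<le> real_of_ereal (C i)" if "2 \<le> i" for i using nn[OF that] by (rule real_of_ereal_pos)
      show "measure M {\<omega> \<in> space M. zeta_prod Y' i \<omega> > t} \<le> real_of_ereal (C i) * h t" if "2 \<le> i" "A \<le> t" for i t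
        using le[OF that(1), of t] f[OF that(2), of i] that(2) A hpos[OF that(2)] unfolding zeq
        by (simp add: divide_le_eq)
    qed (rule p(3))
  qed
  have lim: "((\<lambda>x. ?S x / tail F x) \<longlongrightarrow> k / (1 - \<rho>)) at_top"
    using DZ
  proof (elim disjE exE conjE)
    assume "DZ1 \<alpha> F"
    show ?thesis
    proof (rule I.perpetuity_tail_controlled[OF R.DZ1_controls[OF \<open>prob_space M\<close> \<open>DZ1 \<alpha> F\<close>], where A=1 and p="\<alpha> + 1" and c="\<lambda>i. \<rho> ^ (i - 1)"])
      show "1 \<le> \<alpha> + 1" using assms(5) by simp
      show "0 \<le> \<rho> ^ (i - 1)" for i using I.\<rho>_nonneg by simp
      show "measure M {\<omega> \<in> space M. zeta_prod Y' i \<omega> > t} \<le> \<rho> ^ (i - 1) * t powr (-\<alpha>)" if "2 \<le> i" "1 \<le> t" for i t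
      proof -
        have i: "1 \<le> i" using that by simp
        have "integrable M (\<lambda>\<omega>. zeta_prod Y' i \<omega> powr \<alpha>)" using I.breiman_zeta(1)[OF i] by (simp add: R.breiman_def)
        from M.upper_tail_markov(2)[OF I.zeta_measurable I.zeta_nonneg this assms(5), of t] that
        show ?thesis unfolding I.breiman_zeta(2)[OF i] by simp
      qed
      have "summable (\<lambda>i. (\<rho> ^ i) powr (1 / (\<alpha> + 1)))"
        using I.\<rho>_nonneg I.\<rho>_less_1 assms(5) by (intro summable_geometric_powr) auto
      then show "summable (\<lambda>i. (\<rho> ^ (i + 2 - 1)) powr (1 / (\<alpha> + 1)))"
        using summable_Suc_iff[of "\<lambda>i. (\<rho> ^ i) powr (1 / (\<alpha> + 1))"] by simp
    qed simp
  next
    assume D: "DZ2 \<alpha> F" "C_summable \<alpha> (C_DZ2 M Y F)"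
    show ?thesis
      by (rule from_SUP[OF R.DZ2_controls[OF \<open>prob_space M\<close> D(1)] D(2) R.Fbar_pos order_refl C_DZ2_def])
         (simp_all add: R.Fbar_nonneg)
  next
    fix U assume U: "DZ3 \<alpha> F G U" "C_summable \<alpha> (C_DZ3 M Y \<alpha> U)"
    have lt: "real_distribution U" "long_tailed U"
      using R.type_iii_or_iv_common(1,2) U(1) unfolding DZ3_def by auto
    show ?thesis
    proof (rule from_SUP[OF R.DZ3_controls[OF \<open>prob_space M\<close> U(1)] U(2) _ order_refl C_DZ3_def])
      show "0 < t powr - \<alpha> * tail U (ln t)" if "1 \<le> t" for t using R.long_tailed_pos(2)[OF lt] that by simp
    qed (simp_all add: tail_def)
  next
    assume D: "DZ4 \<alpha> F G" "C_summable \<alpha> (C_DZ4 M Y \<alpha> F)"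
    have "\<forall>\<^sub>F x in at_top. 1 \<le> truncated_moment \<alpha> F x" using D(1) unfolding DZ4_def filterlim_at_top by blast
    then obtain x2 where x2: "\<And>x. x2 \<le> x \<Longrightarrow> 1 \<le> truncated_moment \<alpha> F x" unfolding eventually_at_top_linorder by auto
    show ?thesis
    proof (rule from_SUP[OF R.DZ4_controls[OF \<open>prob_space M\<close> D(1)] D(2) _ _ C_DZ4_def])
      show "0 < tail F t / truncated_moment \<alpha> F t" if "max 1 x2 \<le> t" for t
        using x2[of t] that R.Fbar_pos[of t] by simp
    qed (simp_all add: m0 R.Fbar_nonneg)
  qed
  have S_eq: "S x = ?S x" for x
    unfolding S_def
  proof (rule M.finite_measure_eq_AE)
    have sup: "(SUP n\<in>{1..}. ereal (\<Sum>i=1..n. X i \<omega> * (\<Prod>j=1..i. Y j \<omega>))) > ereal x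
        \<longleftrightarrow> (\<exists>n\<in>{1..}. x < (\<Sum>i=1..n. X i \<omega> * (\<Prod>j=1..i. Y j \<omega>)))" for \<omega>
      by (simp add: less_SUP_iff)
    have "{\<omega> \<in> space M. \<exists>n\<in>{1..}. x < (\<Sum>i=1..n. X i \<omega> * (\<Prod>j=1..i. Y j \<omega>))}
      = (\<Union>n\<in>{1..}. {\<omega> \<in> space M. x < (\<Sum>i=1..n. X i \<omega> * (\<Prod>j=1..i. Y j \<omega>))})" by blast
    also have "\<dots> \<in> sets M"
    proof (intro sets.countable_UN' countableI_type image_subsetI)
      fix n :: nat
      have "(\<lambda>\<omega>. \<Sum>i=1..n. X i \<omega> * (\<Prod>j=1..i. Y j \<omega>)) \<in> borel_measurable M"
        by (intro borel_measurable_sum borel_measurable_times borel_measurable_prod Xm Ym) auto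
      then show "{\<omega> \<in> space M. x < (\<Sum>i=1..n. X i \<omega> * (\<Prod>j=1..i. Y j \<omega>))} \<in> sets M"
        by (rule borel_measurable_less[OF borel_measurable_const])
    qed
    finally show "{\<omega> \<in> space M. (SUP n\<in>{1..}. ereal (\<Sum>i=1..n. X i \<omega> * (\<Prod>j=1..i. Y j \<omega>))) > ereal x} \<in> sets M"
      unfolding sup .
    have "{\<omega> \<in> space M. \<exists>n\<ge>1. x < (\<Sum>i=1..n. I.Z i \<omega>)} = (\<Union>n\<in>{1..}. {\<omega> \<in> space M. x < (\<Sum>i=1..n. I.Z i \<omega>)})" by fastforce
    also have "\<dots> \<in> sets M"
    proof (intro sets.countable_UN' countableI_type image_subsetI)
      fix n :: nat
      have "(\<lambda>\<omega>. \<Sum>i=1..n. I.Z i \<omega>) \<in> borel_measurable M" by (intro borel_measurable_sum I.Z_measurable) auto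
      then show "{\<omega> \<in> space M. x < (\<Sum>i=1..n. I.Z i \<omega>)} \<in> sets M"
        by (rule borel_measurable_less[OF borel_measurable_const])
    qed
    finally show "{\<omega> \<in> space M. \<exists>n\<ge>1. x < (\<Sum>i=1..n. I.Z i \<omega>)} \<in> sets M" .
    show "AE \<omega> in M. \<omega> \<in> {\<omega> \<in> space M. (SUP n\<in>{1..}. ereal (\<Sum>i=1..n. X i \<omega> * (\<Prod>j=1..i. Y j \<omega>))) > ereal x}
      \<longleftrightarrow> \<omega> \<in> {\<omega> \<in> space M. \<exists>n\<ge>1. x < (\<Sum>i=1..n. I.Z i \<omega>)}"
      using YY
    proof eventually_elim
      fix \<omega> assume *: "\<forall>i\<in>{1..}. Y' i \<omega> = Y i \<omega>"
      have "X i \<omega> * (\<Prod>j=1..i. Y j \<omega>) = I.Z i \<omega>" if "1 \<le> i" for i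
      proof -
        have "(\<Prod>j=1..i. Y j \<omega>) = zeta_prod Y' (Suc i) \<omega>"
          unfolding zeta_prod_def using * by (intro prod.cong) auto
        then show ?thesis unfolding I.Z_def I.zeta_Suc[OF that] by simp
      qed
      then have "(\<Sum>i=1..n. X i \<omega> * (\<Prod>j=1..i. Y j \<omega>)) = (\<Sum>i=1..n. I.Z i \<omega>)" for n
        by (intro sum.cong) auto
      then show "\<omega> \<in> {\<omega> \<in> space M. (SUP n\<in>{1..}. ereal (\<Sum>i=1..n. X i \<omega> * (\<Prod>j=1..i. Y j \<omega>))) > ereal x}
        \<longleftrightarrow> \<omega> \<in> {\<omega> \<in> space M. \<exists>n\<ge>1. x < (\<Sum>i=1..n. I.Z i \<omega>)}"
        unfolding mem_Collect_eq sup by (simp add: Bex_def)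
    qed
  qed
  have ST: "((\<lambda>x. S x / T x) \<longlongrightarrow> K) at_top"
    using lim unfolding S_eq k_eq tF .
  have T0: "T x \<noteq> 0" for x using R.Fbar_pos[of x] unfolding tF by simp
  show ?thesis
  proof (intro conjI impI)
    assume "K \<noteq> 0"
    then have "((\<lambda>x. S x / T x / K) \<longlongrightarrow> K / K) at_top" by (intro tendsto_divide ST tendsto_const)
    then show "tail_equiv S (\<lambda>x. K * T x)"
      unfolding tail_equiv_def using \<open>K \<noteq> 0\<close> by (simp add: field_simps)
  next
    assume "K = 0"
    then show "S \<in> o[at_top](T)" using ST T0 by (intro smalloI_tendsto) auto
  qed
qed

end
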